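(* Let $(V,\mathrm{dist})$ be a metric space, let $P\subseteq V$ be a set of points, and let $\varepsilon\in(0,1)$ be a parameter. Let $L(\varepsilon)$ be the $\varepsilon$-comatching index of $(V,\mathrm{dist})$ (so that $L(\varepsilon^2/4)$ is its $(\varepsilon^2/4)$-comatching index). Let $d$ be the VC-dimension of the ball set system $\mathcal{B}_V$. Then there exists a furthest neighbor $\varepsilon$-coreset for $P$ of size $O\big(d\,\varepsilon^{-2}\cdot L(\varepsilon^2/4)\log L(\varepsilon^2/4)\big)$ that is computable in polynomial time.
   Context: A furthest neighbor $\varepsilon$-coreset for $P\subseteq V$ is a subset $Q\subseteq P$ such that for every $v\in V$ there exists $q\in Q$ with $\mathrm{dist}(v,q)\ge(1-\varepsilon)\max\{\mathrm{dist}(v,p): p\in P\}$. An $\varepsilon$-comatching in $(V,\mathrm{dist})$ is a sequence $(p_i,q_i)_{i=1}^{\ell}$ of pairs of points of $V$ such that, for some $R>0$, $\mathrm{dist}(p_i,q_i)>R$ for every $i\in[\ell]$ and $\mathrm{dist}(p_i,q_j)\le(1-\varepsilon)R$ for all $i,j\in[\ell]$ with $i\ne j$; its length is $\ell$. The $\varepsilon$-comatching index of $(V,\mathrm{dist})$ is the maximum length of an $\varepsilon$-comatching in it. For $v\in V$ and $r\ge 0$ let $B(v,r)=\{u\in V:\mathrm{dist}(u,v)\le r\}$. The ball set system $\mathcal{B}_V$ is the set system with ground set $V$ and family of sets $\{B(v,r): v\in V, r\in\mathbb{R}^+\}$. The VC-dimension of a set system is the maximum size of a subset $X$ of the ground set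 that is shattered, i.e. such that every $Y\subseteq X$ equals $A\cap X$ for some set $A$ of the family.
   Formalization: P is taken finite and nonempty (for infinite P the claim can fail), and the size bound is not asserted when V is a single point (there d = L = 0); polynomial time means polynomial in |V| for finite V given by its distances, while for infinite V existence with the size bound is stated. *)

theory Defs
  imports "HOL-Analysis.Analysis" "HOL-Library.Extended_Nat" "HOL-Library.Log_Nat"
begin

section \<open>Coresets, comatchings and VC-dimension\<close>

text \<open>A metric space is a carrier \<open>V\<close> with a distance \<open>\<delta>\<close>, as in the library locale
  \<^locale>\<open>Metric_space\<close>. The point set \<open>P\<close> is meant to be finite and nonempty,
  which is what makes the maximum below exist.\<close>

definition furthest_neighbor_coreset ::
    "'a set \<Rightarrow> ('a \<Rightarrow> 'a \<Rightarrow> real) \<Rightarrow> real \<Rightarrow> 'a set \<Rightarrow> 'a set \<Rightarrow> bool" where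
  "furthest_neighbor_coreset V \<delta> \<epsilon> P Q \<longleftrightarrow>
     Q \<subseteq> P \<and> (\<forall>v\<in>V. \<exists>q\<in>Q. \<delta> v q \<ge> (1 - \<epsilon>) * Max ((\<lambda>p. \<delta> v p) ` P))"

definition comatching ::
    "'a set \<Rightarrow> ('a \<Rightarrow> 'a \<Rightarrow> real) \<Rightarrow> real \<Rightarrow> ('a \<times> 'a) list \<Rightarrow> bool" where
  "comatching V \<delta> \<epsilon> ps \<longleftrightarrow>
     set ps \<subseteq> V \<times> V \<and>
     (\<exists>R>0. (\<forall>i<length ps. \<delta> (fst (ps ! i)) (snd (ps ! i)) > R) \<and>
            (\<forall>i<length ps. \<forall>j<length ps. i \<noteq> j \<longrightarrow>
                \<delta> (fst (ps ! i)) (snd (ps ! j)) \<le> (1 - \<epsilon>) * R))"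

text \<open>The maximum length is taken in \<^typ>\<open>enat\<close>; it is \<open>\<infinity>\<close> if the lengths are unbounded.
  The same convention is used for the VC-dimension.\<close>

definition comatching_index :: "'a set \<Rightarrow> ('a \<Rightarrow> 'a \<Rightarrow> real) \<Rightarrow> real \<Rightarrow> enat" where
  "comatching_index V \<delta> \<epsilon> = Sup {enat (length ps) | ps. comatching V \<delta> \<epsilon> ps}"

definition shattered :: "'a set set \<Rightarrow> 'a set \<Rightarrow> bool" where
  "shattered \<F> X \<longleftrightarrow> (\<forall>Y\<subseteq>X. \<exists>A\<in>\<F>. Y = A \<inter> X)"

text \<open>Restricting to finite \<open>X\<close> is harmless, since subsets of shattered sets are shattered;
  it is needed because \<^const>\<open>card\<close> vanishes on infinite sets.\<close>

definition vc_dimension :: "'a set \<Rightarrow> 'a set set \<Rightarrow> enat" where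
  "vc_dimension U \<F> = Sup {enat (card X) | X. X \<subseteq> U \<and> finite X \<and> shattered \<F> X}"

definition ball_family :: "'a set \<Rightarrow> ('a \<Rightarrow> 'a \<Rightarrow> real) \<Rightarrow> 'a set set" where
  "ball_family V \<delta> = {Metric_space.mcball V \<delta> v r | v r. v \<in> V \<and> r > 0}"

text \<open>The bound \<open>C d \<epsilon>\<^sup>-\<^sup>2 L log L\<close>, where \<open>d\<close> is the VC-dimension of the balls and \<open>L\<close> the
  \<open>\<epsilon>\<^sup>2/4\<close>-comatching index; it says nothing if one of them is infinite. In a one-point space
  \<open>d = L = 0\<close> while a coreset must be nonempty, so that space has to be excepted. As soon as
  there are two points \<open>x \<noteq> y\<close>, the pairs \<open>(x,y), (y,x)\<close> form a comatching, so
  \<open>L \<ge> 2\<close> and \<open>log L > 0\<close>.\<close>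

definition coreset_size_bound ::
    "real \<Rightarrow> 'a set \<Rightarrow> ('a \<Rightarrow> 'a \<Rightarrow> real) \<Rightarrow> real \<Rightarrow> 'a set \<Rightarrow> bool" where
  "coreset_size_bound C V \<delta> \<epsilon> Q \<longleftrightarrow>
     ((\<exists>x\<in>V. \<exists>y\<in>V. x \<noteq> y) \<longrightarrow>
      (\<forall>d L. vc_dimension V (ball_family V \<delta>) = enat d \<longrightarrow>
             comatching_index V \<delta> (\<epsilon>\<^sup>2 / 4) = enat L \<longrightarrow>
             real (card Q) \<le> C * real d * (1 / \<epsilon>\<^sup>2) * real L * ln (real L)))"

section \<open>Programs and their running time\<close>

text \<open>Polynomial time is measured on a deterministic real RAM, presented as a structured
  while-language with a cost semantics. The input is a metric on the points
  \<open>0, \<dots>, n - 1\<close>, a set \<open>P\<close> of points and \<open>\<epsilon>\<close>; it is read-only. The memory consists of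
  infinitely many arrays of naturals and infinitely many arrays of reals, initially zero.

  The instruction set is chosen so that the unit costs cannot be abused.
  Every elementary operation costs 1, except that a product of naturals additionally costs the
  bit length of the result; hence after time \<open>t\<close> all naturals have \<open>O(t + log n)\<close> bits.
  Reals can only be added, subtracted, compared, and multiplied by \<open>\<epsilon>\<close>, and there is no
  rounding; hence after time \<open>t\<close> every real in memory is a polynomial of degree \<open>O(t)\<close> in \<open>\<epsilon>\<close>,
  linear in the distances (and 1), with integer coefficients of \<open>O(t)\<close> bits.
  So a program that is polynomial here is polynomial on the usual real RAM, and, for
  rational distances and \<open>\<epsilon>\<close> in binary, on Turing machines.\<close>

record metric_input =
  points :: nat
  distance :: "nat \<Rightarrow> nat \<Rightarrow> real"
  subset_P :: "nat set"
  epsilon :: real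

record memory =
  nats :: "nat \<Rightarrow> nat \<Rightarrow> nat"
  reals :: "nat \<Rightarrow> nat \<Rightarrow> real"

text \<open>In \<open>NGet a e\<close> and \<open>RGet a e\<close>, \<open>a\<close> is the fixed name of an array and \<open>e\<close> an index.\<close>

datatype nexp =
    NConst nat
  | NPoints
  | NInP nexp
  | NGet nat nexp
  | NAdd nexp nexp
  | NSub nexp nexp
  | NMul nexp nexp
  | NDiv nexp nexp

datatype rexp =
    ROne
  | RDist nexp nexp
  | RGet nat nexp
  | RAdd rexp rexp
  | RSub rexp rexp
  | RMulEps rexp

datatype bexp =
    NLess nexp nexp
  | RLess rexp rexp
  | BNot bexp
  | BAnd bexp bexp

datatype com =
    CSkip
  | CNAssign nat nexp nexp
  | CRAssign nat nexp rexp
  | CSeq com com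
  | CIf bexp com com
  | CWhile bexp com

fun nval :: "metric_input \<Rightarrow> memory \<Rightarrow> nexp \<Rightarrow> nat" where
  "nval I s (NConst k) = k"
| "nval I s NPoints = points I"
| "nval I s (NInP e) = (if nval I s e < points I \<and> nval I s e \<in> subset_P I then 1 else 0)"
| "nval I s (NGet a e) = nats s a (nval I s e)"
| "nval I s (NAdd e f) = nval I s e + nval I s f"
| "nval I s (NSub e f) = nval I s e - nval I s f"
| "nval I s (NMul e f) = nval I s e * nval I s f"
| "nval I s (NDiv e f) = nval I s e div nval I s f"

fun ncost :: "metric_input \<Rightarrow> memory \<Rightarrow> nexp \<Rightarrow> nat" where
  "ncost I s (NConst k) = 1"
| "ncost I s NPoints = 1"
| "ncost I s (NInP e) = 1 + ncost I s e"
| "ncost I s (NGet a e) = 1 + ncost I s e"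
| "ncost I s (NAdd e f) = 1 + ncost I s e + ncost I s f"
| "ncost I s (NSub e f) = 1 + ncost I s e + ncost I s f"
| "ncost I s (NMul e f) =
     1 + floorlog 2 (nval I s e * nval I s f) + ncost I s e + ncost I s f"
| "ncost I s (NDiv e f) = 1 + ncost I s e + ncost I s f"

fun rval :: "metric_input \<Rightarrow> memory \<Rightarrow> rexp \<Rightarrow> real" where
  "rval I s ROne = 1"
| "rval I s (RDist e f) =
     (if nval I s e < points I \<and> nval I s f < points I
      then distance I (nval I s e) (nval I s f) else 0)"
| "rval I s (RGet a e) = reals s a (nval I s e)"
| "rval I s (RAdd x y) = rval I s x + rval I s y"
| "rval I s (RSub x y) = rval I s x - rval I s y"
| "rval I s (RMulEps x) = epsilon I * rval I s x"

fun rcost :: "metric_input \<Rightarrow> memory \<Rightarrow> rexp \<Rightarrow> nat" where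
  "rcost I s ROne = 1"
| "rcost I s (RDist e f) = 1 + ncost I s e + ncost I s f"
| "rcost I s (RGet a e) = 1 + ncost I s e"
| "rcost I s (RAdd x y) = 1 + rcost I s x + rcost I s y"
| "rcost I s (RSub x y) = 1 + rcost I s x + rcost I s y"
| "rcost I s (RMulEps x) = 1 + rcost I s x"

fun bval :: "metric_input \<Rightarrow> memory \<Rightarrow> bexp \<Rightarrow> bool" where
  "bval I s (NLess e f) \<longleftrightarrow> nval I s e < nval I s f"
| "bval I s (RLess x y) \<longleftrightarrow> rval I s x < rval I s y"
| "bval I s (BNot b) \<longleftrightarrow> \<not> bval I s b"
| "bval I s (BAnd b c) \<longleftrightarrow> bval I s b \<and> bval I s c"

fun bcost :: "metric_input \<Rightarrow> memory \<Rightarrow> bexp \<Rightarrow> nat" where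
  "bcost I s (NLess e f) = 1 + ncost I s e + ncost I s f"
| "bcost I s (RLess x y) = 1 + rcost I s x + rcost I s y"
| "bcost I s (BNot b) = 1 + bcost I s b"
| "bcost I s (BAnd b c) = 1 + bcost I s b + bcost I s c"

definition nwrite :: "nat \<Rightarrow> nat \<Rightarrow> nat \<Rightarrow> memory \<Rightarrow> memory" where
  "nwrite a i k s = s\<lparr>nats := (nats s)(a := (nats s a)(i := k))\<rparr>"

definition rwrite :: "nat \<Rightarrow> nat \<Rightarrow> real \<Rightarrow> memory \<Rightarrow> memory" where
  "rwrite a i x s = s\<lparr>reals := (reals s)(a := (reals s a)(i := x))\<rparr>"

text \<open>\<open>exec I c s t s'\<close>: on input \<open>I\<close> and memory \<open>s\<close>, the command \<open>c\<close> terminates after time \<open>t\<close>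
  with memory \<open>s'\<close>.\<close>

inductive exec :: "metric_input \<Rightarrow> com \<Rightarrow> memory \<Rightarrow> nat \<Rightarrow> memory \<Rightarrow> bool" for I where
  Skip: "exec I CSkip s 1 s"
| NAssign: "exec I (CNAssign a e f) s (1 + ncost I s e + ncost I s f)
              (nwrite a (nval I s e) (nval I s f) s)"
| RAssign: "exec I (CRAssign a e x) s (1 + ncost I s e + rcost I s x)
              (rwrite a (nval I s e) (rval I s x) s)"
| Seq: "exec I c s t s' \<Longrightarrow> exec I c' s' t' s'' \<Longrightarrow> exec I (CSeq c c') s (t + t') s''"
| IfTrue: "bval I s b \<Longrightarrow> exec I c s t s' \<Longrightarrow> exec I (CIf b c c') s (1 + bcost I s b + t) s'"
| IfFalse: "\<not> bval I s b \<Longrightarrow> exec I c' s t s' \<Longrightarrow> exec I (CIf b c c') s (1 + bcost I s b + t) s'"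
| WhileFalse: "\<not> bval I s b \<Longrightarrow> exec I (CWhile b c) s (1 + bcost I s b) s"
| WhileTrue: "bval I s b \<Longrightarrow> exec I c s t s' \<Longrightarrow> exec I (CWhile b c) s' t' s'' \<Longrightarrow>
              exec I (CWhile b c) s (1 + bcost I s b + t + t') s''"

definition zero_memory :: memory where
  "zero_memory = \<lparr>nats = (\<lambda>_ _. 0), reals = (\<lambda>_ _. 0)\<rparr>"

text \<open>The output is the set of points marked by a nonzero entry in array \<open>0\<close>.\<close>

definition computes_within :: "com \<Rightarrow> metric_input \<Rightarrow> nat \<Rightarrow> nat set \<Rightarrow> bool" where
  "computes_within c I T Q \<longleftrightarrow>
     (\<exists>t s. exec I c zero_memory t s \<and> t \<le> T \<and> Q = {i. i < points I \<and> nats s 0 i \<noteq> 0})"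

end

(* The coreset condition says that Q hits, for each point v, the set of those p in P that are
   almost furthest from v.  Up to a factor 1 + epsilon the furthest distances fall into O(log(1/epsilon) / epsilon)
   scales (further away, one point hits everything).  At one scale, a weighting of the
   points v under which no p hits much weight has a large subset in which the furthest point of u is not almost
   furthest from v, for u and v distinct; this is a comatching.  Hence the fractional hitting number tau
   of the system is O(L log(1/epsilon) / epsilon).

   Hitting sets of size O(d tau log tau) are found by repeated multiplicative weights: T greedy picks
   with learning rate 1/h keep the system fractionally hit up to a factor (1 - 1/h)^2 as soon as T is at least
   tau h^2 times the logarithm of the number of traces, which by Sauer's lemma is
   d log(e N / d) on N points.  So N can be divided by 16 while h is halved; the losses form a
   convergent product, and the last round, h = 1, is the plain greedy hitting set.
   The algorithm tries every initial h and keeps the smallest set that hits everything,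
   so it needs to know neither d nor L.  Arbitrary spaces reduce to finite ones by compactness. *)

theory Submission
  imports Defs
begin

section \<open>Repeated multiplicative weights\<close>

text \<open>A single greedy run needs about \<open>\<tau> * ln M\<close> picks, where
  \<open>M\<close> is the number of traces on all of \<open>P\<close>, so its size would still
  depend on the number of points. Random sampling could first replace \<open>P\<close> by a small
  set; multiplicative weights do so deterministically. The obstacle is a circularity: the new sample
  size has to exceed a multiple of the logarithm of the number of traces on the previous sample. A
  size falling faster than the square of \<open>h\<close> leaves room for that logarithm, and the
  recursion can continue down to \<open>d * \<tau> * ln \<tau>\<close>, where \<open>ln M\<close> is
  of order \<open>d * ln \<tau>\<close>.

  The exponent 2 of 1/\<epsilon> arises because both \<tau> and \<open>ln \<tau>\<close> contain a
  logarithm of 1/\<epsilon>; each is bounded by a multiple of \<open>1 / sqrt \<epsilon>\<close>.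

  Weights are natural numbers, scaled by \<open>h\<close> in each round, because the machine cannot
  multiply reals with each other. As \<open>h\<close> and the number of rounds are at most
  \<open>n\<close>, they have polynomially many bits.\<close>

definition load :: "(nat \<Rightarrow> nat \<Rightarrow> bool) \<Rightarrow> nat \<Rightarrow> (nat \<Rightarrow> nat) \<Rightarrow> nat \<Rightarrow> nat" where
  "load G n w p = (\<Sum>v<n. w v * of_bool (G v p))"

text \<open>For finite \<open>A\<close>, linear programming duality makes this equivalent to a
  fractional hitting set on \<open>A\<close> of total weight at most \<tau>; the dual form is what
  greedy choices exploit. Natural weights suffice, since rational ones can be scaled.\<close>

definition fractionally_hit :: "(nat \<Rightarrow> nat \<Rightarrow> bool) \<Rightarrow> nat \<Rightarrow> nat set \<Rightarrow> real \<Rightarrow> bool" where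
  "fractionally_hit G n A \<tau> \<longleftrightarrow>
     (\<forall>w. \<exists>p\<in>A. real (\<Sum>v<n. w v) \<le> \<tau> * real (load G n w p))"

text \<open>One representative row per trace on \<open>A\<close>. Weight 1 on these makes the
  initial potential the number of traces, which the VC-dimension controls, instead of the number of
  rows.\<close>

definition first_of_trace :: "(nat \<Rightarrow> nat \<Rightarrow> bool) \<Rightarrow> nat set \<Rightarrow> nat \<Rightarrow> bool" where
  "first_of_trace G A v \<longleftrightarrow> (\<forall>u<v. \<exists>p\<in>A. G u p \<noteq> G v p)"

text \<open>The factors \<open>h - 1\<close> and \<open>h\<close> stand for \<open>1 - 1/h\<close>
  and 1; the common factor \<open>h ^ t\<close> cancels in every comparison of loads. A relation
  leaves ties between best points open, so any tie-breaking of the program is covered.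
  \<open>mw_stall\<close> fills up the step count once no weight can be hit.\<close>

inductive mw :: "(nat \<Rightarrow> nat \<Rightarrow> bool) \<Rightarrow> nat \<Rightarrow> nat set \<Rightarrow> nat \<Rightarrow> nat \<Rightarrow> (nat \<Rightarrow> nat) \<Rightarrow> nat set \<Rightarrow> bool"
  for G n A h where
  mw_init: "mw G n A h 0 (\<lambda>v. of_bool (first_of_trace G A v)) {}"
| mw_pick: "mw G n A h t w B \<Longrightarrow> p \<in> A \<Longrightarrow> 0 < load G n w p \<Longrightarrow>
    (\<And>q. q \<in> A \<Longrightarrow> load G n w q \<le> load G n w p) \<Longrightarrow>
    mw G n A h (Suc t) (\<lambda>v. w v * (h - of_bool (G v p))) (insert p B)"
| mw_stall: "mw G n A h t w B \<Longrightarrow> (\<And>q. q \<in> A \<Longrightarrow> load G n w q = 0) \<Longrightarrow>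
    mw G n A h (Suc t) w B"

text \<open>Halving always passes through \<open>h = 1\<close> before reaching 0, so the last stage
  of a nonempty chain is the one in which a hit erases the weight.\<close>

inductive chain :: "(nat \<Rightarrow> nat \<Rightarrow> bool) \<Rightarrow> nat \<Rightarrow> nat set \<Rightarrow> nat \<Rightarrow> nat \<Rightarrow> nat set \<Rightarrow> bool"
  for G n where
  chain_done: "chain G n A T 0 A"
| chain_stage: "0 < h \<Longrightarrow> mw G n A h T w B \<Longrightarrow> chain G n B (T div 16) (h div 2) C \<Longrightarrow>
    chain G n A T h C"

section \<open>The potential argument for one stage\<close>

lemma fractionally_hit_mono:
  assumes "fractionally_hit G n A \<tau>" "\<tau> \<le> \<sigma>"
  shows "fractionally_hit G n A \<sigma>"
  unfolding fractionally_hit_def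
proof
  fix w :: "nat \<Rightarrow> nat"
  obtain p where p: "p \<in> A" "real (\<Sum>v<n. w v) \<le> \<tau> * real (load G n w p)"
    using assms(1) unfolding fractionally_hit_def by blast
  have "\<tau> * real (load G n w p) \<le> \<sigma> * real (load G n w p)"
    using assms(2) by (intro mult_right_mono) auto
  with p show "\<exists>p\<in>A. real (\<Sum>v<n. w v) \<le> \<sigma> * real (load G n w p)" by force
qed

lemma mw_subset: "mw G n A h t w B \<Longrightarrow> B \<subseteq> A"
proof (induction rule: mw.induct)
  case (mw_pick t w B p)
  then show ?case by blast
qed blast+

lemma mw_card: "mw G n A h t w B \<Longrightarrow> finite B \<and> card B \<le> t"
proof (induction rule: mw.induct)
  case (mw_pick t w B p)
  then have "finite B" "card B \<le> t" by blast+
  then show ?case by (simp add: card_insert_if)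
qed simp_all

text \<open>Later this bounds the bit lengths of the weights, hence the cost of multiplying
  them.\<close>

lemma mw_weight_le: "mw G n A h t w B \<Longrightarrow> 0 < h \<Longrightarrow> w v \<le> h ^ t"
proof (induction rule: mw.induct)
  case (mw_pick t w B p)
  then have "w v \<le> h ^ t" by blast
  then have "w v * (h - of_bool (G v p)) \<le> h ^ t * h" by (intro mult_mono) auto
  then show ?case by (simp add: mult.commute)
next
  case (mw_stall t w B)
  then have "w v \<le> h ^ t" by blast
  then have "w v \<le> h ^ t * 1" by simp
  also have "\<dots> \<le> h ^ t * h" using mw_stall.prems by (intro mult_mono) auto
  finally show ?case by (simp add: mult.commute)
qed simp

text \<open>A list of picks is carried because the set \<open>B\<close> forgets multiplicities,
  while a row loses a factor for every pick that hits it. The best point hits at least a 1/\<tau>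
  fraction of the weight, which multiplies the total by at most \<open>h - 1 / \<tau>\<close>; a
  stall forces the total to be 0.\<close>

lemma mw_potential:
  assumes "mw G n A h t w B" "fractionally_hit G n A \<tau>" "1 \<le> \<tau>" "1 \<le> h"
  defines "M \<equiv> card {v. v < n \<and> first_of_trace G A v}"
  shows "\<exists>ps. set ps = B \<and> (length ps = t \<or> (\<Sum>v<n. w v) = 0) \<and>
    (\<forall>v. w v = of_bool (first_of_trace G A v) * (h - 1) ^ length (filter (G v) ps)
                 * h ^ length (filter (\<lambda>p. \<not> G v p) ps)) \<and>
    real (\<Sum>v<n. w v) \<le> real M * (real h - 1 / \<tau>) ^ t"
  using assms(1)
proof (induction rule: mw.induct)
  case mw_init
  have "(\<Sum>v<n. of_bool (first_of_trace G A v)) = M"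
    unfolding M_def by (simp add: of_bool_def sum.If_cases lessThan_def Int_def)
  then show ?case by (intro exI[of _ "[]"]) simp
next
  case (mw_pick t w B p)
  have nonneg: "0 \<le> real h - 1 / \<tau>" using assms(3,4)
    by (smt (verit) divide_le_eq_1 of_nat_1 of_nat_mono)
  obtain ps where ps: "set ps = B" "length ps = t \<or> (\<Sum>v<n. w v) = 0"
    "\<forall>v. w v = of_bool (first_of_trace G A v) * (h - 1) ^ length (filter (G v) ps)
                 * h ^ length (filter (\<lambda>p. \<not> G v p) ps)"
    "real (\<Sum>v<n. w v) \<le> real M * (real h - 1 / \<tau>) ^ t"
    using mw_pick.IH by blast
  obtain q where q: "q \<in> A" "real (\<Sum>v<n. w v) \<le> \<tau> * real (load G n w q)"
    using assms(2) unfolding fractionally_hit_def by blast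
  have "\<tau> * real (load G n w q) \<le> \<tau> * real (load G n w p)"
    using mw_pick.hyps(4)[OF q(1)] assms(3) by (intro mult_left_mono) auto
  with q(2) have "real (\<Sum>v<n. w v) \<le> \<tau> * real (load G n w p)" by linarith
  then have big: "real (\<Sum>v<n. w v) / \<tau> \<le> real (load G n w p)"
    using assms(3) by (simp add: divide_le_eq mult.commute)
  have "(\<Sum>v<n. w v * (h - of_bool (G v p))) + load G n w p = (\<Sum>v<n. w v * h)"
  proof -
    have "h - of_bool (G v p) + of_bool (G v p) = h" for v using assms(4) by auto
    then show ?thesis unfolding load_def sum.distrib[symmetric] distrib_left[symmetric] by simp
  qed
  then have "(\<Sum>v<n. w v * (h - of_bool (G v p))) + load G n w p = (\<Sum>v<n. w v) * h"
    by (simp only: sum_distrib_right)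
  then have "real (\<Sum>v<n. w v * (h - of_bool (G v p))) + real (load G n w p)
      = real (\<Sum>v<n. w v) * real h"
    by (simp only: of_nat_add[symmetric] of_nat_mult[symmetric])
  then have "real (\<Sum>v<n. w v * (h - of_bool (G v p)))
      = real (\<Sum>v<n. w v) * real h - real (load G n w p)"
    by linarith
  also have "\<dots> \<le> real (\<Sum>v<n. w v) * (real h - 1 / \<tau>)"
    using big by (simp add: algebra_simps)
  also have "\<dots> \<le> (real M * (real h - 1 / \<tau>) ^ t) * (real h - 1 / \<tau>)"
    using ps(4) nonneg by (intro mult_right_mono)
  finally have bound: "real (\<Sum>v<n. w v * (h - of_bool (G v p)))
      \<le> real M * (real h - 1 / \<tau>) ^ Suc t" by (simp add: algebra_simps)
  have pos: "(\<Sum>v<n. w v) \<noteq> 0"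
  proof
    assume "(\<Sum>v<n. w v) = 0"
    then have "load G n w p = 0" by (simp add: load_def)
    with mw_pick.hyps(3) show False by simp
  qed
  show ?case
  proof (intro exI[of _ "p # ps"] conjI)
    show "\<forall>v. w v * (h - of_bool (G v p)) = of_bool (first_of_trace G A v)
        * (h - 1) ^ length (filter (G v) (p # ps))
        * h ^ length (filter (\<lambda>p. \<not> G v p) (p # ps))"
      using ps(3) by simp
    show "set (p # ps) = insert p B" using ps(1) by simp
    show "length (p # ps) = Suc t \<or> (\<Sum>v<n. w v * (h - of_bool (G v p))) = 0"
      using ps(2) pos by auto
  qed (rule bound)
next
  case (mw_stall t w B)
  have nonneg: "0 \<le> real h - 1 / \<tau>" using assms(3,4)
    by (smt (verit) divide_le_eq_1 of_nat_1 of_nat_mono)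
  obtain q where q: "q \<in> A" "real (\<Sum>v<n. w v) \<le> \<tau> * real (load G n w q)"
    using assms(2) unfolding fractionally_hit_def by blast
  then have "(\<Sum>v<n. w v) = 0"
    using mw_stall.hyps(2)[OF q(1)] by (metis mult_zero_right of_nat_0 of_nat_le_0_iff)
  moreover have "0 \<le> real M * (real h - 1 / \<tau>) ^ Suc t" using nonneg by simp
  ultimately show ?case using mw_stall.IH by (metis of_nat_0)
qed

lemma exists_first_of_trace:
  assumes "v < n"
  obtains u where "u < n" "first_of_trace G A u" "\<And>p. p \<in> A \<Longrightarrow> G u p = G v p"
proof -
  define u where "u = (LEAST u. \<forall>p\<in>A. G u p = G v p)"
  have u: "\<forall>p\<in>A. G u p = G v p" unfolding u_def by (rule LeastI[of _ v]) simp
  have "u \<le> v" unfolding u_def by (rule Least_le) simp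
  moreover have "first_of_trace G A u" unfolding first_of_trace_def
  proof (intro allI impI)
    fix x assume "x < u"
    then have "\<not> (\<forall>p\<in>A. G x p = G v p)" unfolding u_def by (rule not_less_Least)
    with u show "\<exists>p\<in>A. G x p \<noteq> G u p" by auto
  qed
  ultimately show ?thesis using that u assms by (metis le_less_trans)
qed

text \<open>For \<open>h = 1\<close> the weights are 0 or 1 and count the traces not yet hit. The
  total is at most \<open>M * exp (- T / \<tau>)\<close>, which is below 1, hence it is 0.\<close>

lemma mw_greedy_hits:
  assumes "mw G n A 1 T w B" "fractionally_hit G n A \<tau>" "1 \<le> \<tau>"
    and "\<tau> * ln (card {v. v < n \<and> first_of_trace G A v}) < T" "v < n"
  shows "\<exists>p\<in>B. G v p"
proof -
  define M where "M = card {v. v < n \<and> first_of_trace G A v}"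
  obtain u where u: "u < n" "first_of_trace G A u" "\<And>p. p \<in> A \<Longrightarrow> G u p = G v p"
    using exists_first_of_trace[OF assms(5)] by blast
  have M: "M > 0" unfolding M_def using u by (auto simp: card_gt_0_iff)
  obtain ps where ps: "set ps = B"
    "\<forall>v. w v = of_bool (first_of_trace G A v) * (1 - 1) ^ length (filter (G v) ps)
                 * 1 ^ length (filter (\<lambda>p. \<not> G v p) ps)"
    "real (\<Sum>v<n. w v) \<le> real M * (1 - 1 / \<tau>) ^ T"
    using mw_potential[OF assms(1-3)] unfolding M_def by auto
  have "(1 - 1 / \<tau>) ^ T \<le> exp (- (1 / \<tau>)) ^ T"
    using assms(3) exp_ge_add_one_self[of "- (1 / \<tau>)"] by (intro power_mono) auto
  then have "real M * (1 - 1 / \<tau>) ^ T \<le> real M * exp (- (1 / \<tau>)) ^ T"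
    by (intro mult_left_mono) auto
  also have "\<dots> = exp (ln M - T / \<tau>)"
    using M by (simp add: exp_diff exp_of_nat_mult[symmetric] exp_minus field_simps)
  also have "\<dots> < 1"
    using assms(3,4) M_def by (simp add: field_simps)
  finally have "real (\<Sum>v<n. w v) < 1" using ps(3) by simp
  then have "w u = 0" using u(1) by (simp del: of_nat_sum)
  \<comment> \<open>\<open>0 ^ k\<close> vanishes exactly for \<open>k > 0\<close>, so weight 0 of a
    representative means that some pick hits it.\<close>
  then have "length (filter (G u) ps) > 0" using ps(2) u(2) by (auto simp: power_0_left split: if_splits)
  then obtain p where "p \<in> set ps" "G u p" by (auto simp: filter_empty_conv)
  then show ?thesis using ps(1) u(3) mw_subset[OF assms(1)] by blast
qed

lemma sum_load_filter:
  "(\<Sum>p\<leftarrow>ps. load G n w p) = (\<Sum>v<n. w v * length (filter (G v) ps))"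
proof (induction ps)
  case (Cons p ps)
  have "w v * length (filter (G v) (p # ps))
      = w v * of_bool (G v p) + w v * length (filter (G v) ps)" for v by simp
  then have "(\<Sum>v<n. w v * length (filter (G v) (p # ps)))
      = load G n w p + (\<Sum>v<n. w v * length (filter (G v) ps))"
    unfolding load_def sum.distrib[symmetric] by (intro sum.cong refl)
  then show ?case using Cons by simp
qed simp

lemma sum_list_less_const:
  fixes f :: "'a \<Rightarrow> nat" and c :: real
  assumes "\<And>p. p \<in> set ps \<Longrightarrow> real (f p) < c" "ps \<noteq> []"
  shows "real (\<Sum>p\<leftarrow>ps. f p) < length ps * c"
  using assms(2,1)
proof (induction ps rule: list_nonempty_induct)
  case (cons p ps)
  then have "real (\<Sum>p\<leftarrow>ps. f p) < length ps * c" "real (f p) < c" by auto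
  then show ?case by (simp add: algebra_simps)
qed auto

text \<open>No row can be neglected: its weight is at most the total, and comparing logarithms shows
  that at least \<open>(1 - x)\<^sup>2 * T / \<tau>\<close> of the picks hit it, where
  \<open>x = 1 / h\<close>. The uniform distribution on the picks is then a fractional hitting set
  supported on \<open>B\<close>.\<close>

lemma mw_preserves_fractionally_hit:
  assumes "mw G n A h T w B" "fractionally_hit G n A \<tau>" "1 \<le> \<tau>" "2 \<le> h" "0 < T" "0 < n"
    and "\<tau> * real h ^ 2 * ln (card {v. v < n \<and> first_of_trace G A v}) \<le> T"
  shows "fractionally_hit G n B (\<tau> / (1 - 1 / h)\<^sup>2)"
proof -
  define M where "M = card {v. v < n \<and> first_of_trace G A v}"
  define x where "x = 1 / real h"
  have x: "0 < x" "x \<le> 1/2" using assms(4) by (auto simp: x_def field_simps)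
  have hx: "real h * x = 1" using assms(4) by (simp add: x_def)
  obtain ps where ps: "set ps = B" "length ps = T \<or> (\<Sum>v<n. w v) = 0"
    "\<forall>v. w v = of_bool (first_of_trace G A v) * (h - 1) ^ length (filter (G v) ps)
                 * h ^ length (filter (\<lambda>p. \<not> G v p) ps)"
    "real (\<Sum>v<n. w v) \<le> real M * (real h - 1 / \<tau>) ^ T"
    using mw_potential[OF assms(1-3)] assms(4) unfolding M_def by auto
  \<comment> \<open>Row 0 is a representative and, as \<open>h \<ge> 2\<close>, keeps a positive
    weight; so the run never stalls and there are exactly \<open>T\<close> picks.\<close>
  have "first_of_trace G A 0" by (simp add: first_of_trace_def)
  then have "w 0 > 0" using ps(3) assms(4) by simp
  then have len: "length ps = T" using ps(2) assms(6) by auto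
  have cnt: "(1 - x)\<^sup>2 * T / \<tau> \<le> length (filter (G v) ps)" if v: "v < n" for v
  proof -
    obtain u where u: "u < n" "first_of_trace G A u" "\<And>p. p \<in> A \<Longrightarrow> G u p = G v p"
      using exists_first_of_trace[OF v] by blast
    have M: "M > 0" unfolding M_def using u by (auto simp: card_gt_0_iff)
    define c where "c = length (filter (G u) ps)"
    have c_eq: "length (filter (G v) ps) = c"
      using u(3) ps(1) mw_subset[OF assms(1)] unfolding c_def
      by (metis (mono_tags, lifting) filter_cong subsetD)
    have "c + length (filter (\<lambda>p. \<not> G u p) ps) = T"
      unfolding c_def using sum_length_filter_compl[of "G u" ps] len by simp
    then have *: "real h ^ T = real h ^ c * real h ^ length (filter (\<lambda>p. \<not> G u p) ps)"
      by (metis power_add)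
    have "real (w u) = (real h - 1) ^ c * real h ^ length (filter (\<lambda>p. \<not> G u p) ps)"
      using ps(3) u(2) assms(4) unfolding c_def by (simp add: of_nat_diff)
    also have "(real h - 1) ^ c = (1 - x) ^ c * real h ^ c"
      using hx by (simp add: power_mult_distrib[symmetric] algebra_simps)
    finally have "real (w u) = (1 - x) ^ c * real h ^ T"
      using * by simp
    moreover have "real (w u) \<le> real (\<Sum>v<n. w v)"
      using u(1) by (simp add: member_le_sum del: of_nat_sum)
    moreover have "(real h - 1 / \<tau>) ^ T = (1 - x / \<tau>) ^ T * real h ^ T"
      using hx by (simp add: power_mult_distrib[symmetric] algebra_simps)
    ultimately have "(1 - x) ^ c * real h ^ T \<le> real M * (1 - x / \<tau>) ^ T * real h ^ T"
      using ps(4) by (simp add: mult.assoc)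
    then have 1: "(1 - x) ^ c \<le> real M * (1 - x / \<tau>) ^ T"
      using assms(4) by (simp add: mult_le_cancel_right)
    have "x / \<tau> \<le> 1" using x assms(3) by (simp add: divide_le_eq)
    then have "(1 - x / \<tau>) ^ T \<le> exp (- (x / \<tau>)) ^ T"
      using exp_ge_add_one_self[of "- (x / \<tau>)"] by (intro power_mono) auto
    then have "real M * (1 - x / \<tau>) ^ T \<le> real M * exp (- (x / \<tau>)) ^ T"
      by (intro mult_left_mono) auto
    also have "\<dots> = exp (ln M - T * x / \<tau>)"
      using M by (simp add: exp_diff exp_of_nat_mult[symmetric] exp_minus field_simps)
    finally have "(1 - x) ^ c \<le> exp (ln M - T * x / \<tau>)" using 1 by simp
    then have "ln ((1 - x) ^ c) \<le> ln M - T * x / \<tau>"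
      using ln_mono[of "(1 - x) ^ c" "exp (ln M - T * x / \<tau>)"] x by simp
    then have 2: "T * x / \<tau> - ln M \<le> c * - ln (1 - x)"
      using x by (simp add: ln_realpow)
    have "- ln (1 - x) = ln (1 / (1 - x))" using x by (simp add: ln_div)
    also have "\<dots> \<le> 1 / (1 - x) - 1" using x by (intro ln_le_minus_one) auto
    also have "\<dots> = x / (1 - x)" using x by (simp add: field_simps)
    finally have "c * - ln (1 - x) \<le> c * (x / (1 - x))" by (intro mult_left_mono) auto
    with 2 have 3: "T * x / \<tau> - ln M \<le> c * x / (1 - x)" by simp
    \<comment> \<open>The sample size makes the initial potential \<open>ln M\<close> at most a
      fraction \<open>x\<close> of the gain \<open>T * x / \<tau>\<close>. This gives one factor
      \<open>1 - x\<close>; the other one comes from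
      \<open>- ln (1 - x) \<le> x / (1 - x)\<close>.\<close>
    have "ln M \<le> T / (\<tau> * real h ^ 2)"
      using assms(3,4,7) unfolding M_def by (simp add: field_simps)
    also have "\<dots> = T * x\<^sup>2 / \<tau>" by (simp add: x_def field_simps)
    finally have "T * x / \<tau> - T * x\<^sup>2 / \<tau> \<le> c * x / (1 - x)" using 3 by linarith
    then have "x * (T * (1 - x) / \<tau>) \<le> x * (c / (1 - x))"
      by (simp add: algebra_simps power2_eq_square diff_divide_distrib)
    then have "T * (1 - x) / \<tau> \<le> c / (1 - x)" using x(1) by (simp only: mult_le_cancel_left_pos)
    then have "(T * (1 - x) / \<tau>) * (1 - x) \<le> c" using x by (simp add: pos_le_divide_eq)
    then show ?thesis using c_eq by (simp add: power2_eq_square algebra_simps)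
  qed
  show ?thesis unfolding fractionally_hit_def
  proof
    fix w' :: "nat \<Rightarrow> nat"
    define z where "z = (1 - x)\<^sup>2 / \<tau>"
    have z: "z > 0" using x assms(3) by (simp add: z_def)
    have "real (\<Sum>v<n. w' v) * (z * T) = (\<Sum>v<n. real (w' v) * (z * T))"
      by (simp add: sum_distrib_right)
    also have "\<dots> \<le> (\<Sum>v<n. real (w' v) * length (filter (G v) ps))"
      using cnt by (intro sum_mono mult_left_mono) (auto simp: z_def)
    also have "\<dots> = real (\<Sum>p\<leftarrow>ps. load G n w' p)" by (simp add: sum_load_filter)
    finally have avg: "real (\<Sum>v<n. w' v) * (z * T) \<le> real (\<Sum>p\<leftarrow>ps. load G n w' p)" .
    have "\<exists>p\<in>B. real (\<Sum>v<n. w' v) * z \<le> load G n w' p"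
    proof (rule ccontr)
      assume "\<not> ?thesis"
      then have less: "\<And>p. p \<in> set ps \<Longrightarrow> real (load G n w' p) < real (\<Sum>v<n. w' v) * z"
        using ps(1) by force
      have "ps \<noteq> []" using len assms(5) by auto
      then have "real (\<Sum>p\<leftarrow>ps. load G n w' p) < length ps * (real (\<Sum>v<n. w' v) * z)"
        using less by (intro sum_list_less_const)
      also have "\<dots> = real (\<Sum>v<n. w' v) * (z * T)" using len by (simp only: mult_ac)
      finally show False using avg by linarith
    qed
    then obtain p where p: "p \<in> B" "real (\<Sum>v<n. w' v) * z \<le> load G n w' p" by blast
    then have "real (\<Sum>v<n. w' v) \<le> load G n w' p / z" using z by (simp only: pos_le_divide_eq)
    also have "\<dots> = \<tau> / (1 - 1 / h)\<^sup>2 * real (load G n w' p)" by (simp add: z_def x_def)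
    finally show "\<exists>p\<in>B. real (\<Sum>v<n. w' v) \<le> \<tau> / (1 - 1 / h)\<^sup>2 * real (load G n w' p)"
      using p(1) by blast
  qed
qed

section \<open>Pajor's lemma and the Sauer-Shelah bound\<close>

lemma card_le_card_shattered:
  assumes "finite A" "\<F> \<subseteq> Pow A"
  shows "card \<F> \<le> card {X. X \<subseteq> A \<and> shattered \<F> X}"
  using assms
proof (induction A arbitrary: \<F> rule: finite_induct)
  case empty
  show ?case
  proof (cases "\<F> = {}")
    case False
    then have "\<F> = {{}}" using empty by auto
    then have "{X. X \<subseteq> {} \<and> shattered \<F> X} = {{}}" by (auto simp: shattered_def)
    with \<open>\<F> = {{}}\<close> show ?thesis by simp
  qed simp
next
  case (insert x A)
  \<comment> \<open>Pajor's induction splits at \<open>x\<close>, deleting it from the members that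
    contain it. Sets shattered by \<open>F0 \<union> F1\<close> are shattered by \<F>, and those
    shattered by \<open>F0 \<inter> F1\<close> remain so after adding \<open>x\<close>. The two
    families together have \<open>card \<F>\<close> members.\<close>
  define F0 F1 where "F0 = {S \<in> \<F>. x \<notin> S}" and "F1 = (\<lambda>S. S - {x}) ` {S \<in> \<F>. x \<in> S}"
  have fin: "finite \<F>" using insert.prems insert.hyps(1) by (meson finite.insertI finite_Pow_iff finite_subset)
  have "card F1 = card {S \<in> \<F>. x \<in> S}" unfolding F1_def
    by (intro card_image inj_onI) (metis (no_types, lifting) insert_Diff mem_Collect_eq)
  moreover have "\<F> = F0 \<union> {S \<in> \<F>. x \<in> S}" "F0 \<inter> {S \<in> \<F>. x \<in> S} = {}" by (auto simp: F0_def)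
  ultimately have "card \<F> = card F0 + card F1"
    using fin by (metis (no_types, lifting) card_Un_disjoint finite_Un)
  then have cards: "card \<F> = card (F0 \<union> F1) + card (F0 \<inter> F1)"
    using fin card_Un_Int[of F0 F1] by (simp add: F0_def F1_def)
  have sub: "F0 \<union> F1 \<subseteq> Pow A" "F0 \<inter> F1 \<subseteq> Pow A"
    using insert.prems by (auto simp: F0_def F1_def)
  let ?S1 = "{X. X \<subseteq> A \<and> shattered (F0 \<union> F1) X}" and ?S2 = "{X. X \<subseteq> A \<and> shattered (F0 \<inter> F1) X}"
  have finS: "finite ?S1" "finite ?S2" using insert.hyps(1) by auto
  have inj: "inj_on (insert x) ?S2"
    using insert.hyps(2) by (intro inj_onI) (metis (no_types, lifting) Diff_insert_absorb mem_Collect_eq subset_iff)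
  have disj: "?S1 \<inter> insert x ` ?S2 = {}" using insert.hyps(2) by auto
  have sh1: "shattered \<F> X" if X: "X \<subseteq> A" "shattered (F0 \<union> F1) X" for X
    unfolding shattered_def
  proof (intro allI impI)
    fix Y assume "Y \<subseteq> X"
    then obtain S where S: "S \<in> F0 \<union> F1" "Y = S \<inter> X" using X(2) unfolding shattered_def by blast
    have "x \<notin> X" using X(1) insert.hyps(2) by blast
    from S(1) show "\<exists>S\<in>\<F>. Y = S \<inter> X"
    proof
      assume "S \<in> F1"
      then obtain S' where "S' \<in> \<F>" "S = S' - {x}" by (auto simp: F1_def)
      then have "Y = S' \<inter> X" using S(2) \<open>x \<notin> X\<close> by auto
      with \<open>S' \<in> \<F>\<close> show ?thesis by blast
    qed (use S(2) in \<open>auto simp: F0_def\<close>)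
  qed
  have sh2: "shattered \<F> (insert x X)" if X: "X \<subseteq> A" "shattered (F0 \<inter> F1) X" for X
    unfolding shattered_def
  proof (intro allI impI)
    fix Y assume Y: "Y \<subseteq> insert x X"
    have "x \<notin> X" using X(1) insert.hyps(2) by blast
    have "Y - {x} \<subseteq> X" using Y by blast
    then obtain S where S: "S \<in> F0" "S \<in> F1" "Y - {x} = S \<inter> X"
      using X(2) unfolding shattered_def by blast
    have "S \<in> \<F>" "x \<notin> S" using S(1) by (auto simp: F0_def)
    have "insert x S \<in> \<F>" using S(2) by (auto simp: F1_def insert_absorb)
    show "\<exists>S\<in>\<F>. Y = S \<inter> insert x X"
    proof (cases "x \<in> Y")
      case True
      then have "Y = insert x S \<inter> insert x X" using S(3) by auto
      with \<open>insert x S \<in> \<F>\<close> show ?thesis by blast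
    next
      case False
      then have "Y = S \<inter> insert x X" using S(3) \<open>x \<notin> S\<close> by auto
      with \<open>S \<in> \<F>\<close> show ?thesis by blast
    qed
  qed
  have "card \<F> \<le> card ?S1 + card ?S2"
    using cards insert.IH[OF sub(1)] insert.IH[OF sub(2)] by linarith
  also have "\<dots> = card (?S1 \<union> insert x ` ?S2)"
    using disj finS card_image[OF inj] by (simp add: card_Un_disjoint)
  also have "\<dots> \<le> card {X. X \<subseteq> insert x A \<and> shattered \<F> X}"
  proof (intro card_mono)
    show "finite {X. X \<subseteq> insert x A \<and> shattered \<F> X}" using insert.hyps(1) by simp
    show "?S1 \<union> insert x ` ?S2 \<subseteq> {X. X \<subseteq> insert x A \<and> shattered \<F> X}"
      using sh1 sh2 by blast
  qed
  finally show ?case .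
qed

text \<open>Multiplication by \<open>x ^ d\<close> with \<open>x = d / N \<le> 1\<close> turns the
  sum into part of the expansion of \<open>(x + 1) ^ N\<close>, which is at most
  \<open>exp d\<close>.\<close>

lemma sum_binomial_le:
  assumes "1 \<le> d" "d \<le> N"
  shows "real (\<Sum>i\<le>d. N choose i) \<le> (exp 1 * N / d) ^ d"
proof -
  define x where "x = real d / real N"
  have x: "0 < x" "x \<le> 1" using assms by (auto simp: x_def)
  have "real (\<Sum>i\<le>d. N choose i) * x ^ d = (\<Sum>i\<le>d. real (N choose i) * x ^ d)"
    by (simp add: sum_distrib_right)
  also have "\<dots> \<le> (\<Sum>i\<le>d. real (N choose i) * x ^ i)"
    using x by (intro sum_mono mult_left_mono power_decreasing) auto
  also have "\<dots> \<le> (\<Sum>i\<le>N. real (N choose i) * x ^ i)"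
    using x assms by (intro sum_mono2) auto
  also have "\<dots> = (x + 1) ^ N" by (simp add: binomial_ring)
  also have "\<dots> \<le> exp x ^ N"
    using x exp_ge_add_one_self[of x] by (intro power_mono) (auto simp: add.commute)
  also have "\<dots> = exp 1 ^ d"
    using assms by (simp add: exp_of_nat_mult[symmetric] x_def)
  finally have "real (\<Sum>i\<le>d. N choose i) \<le> exp 1 ^ d / x ^ d"
    using x by (simp add: pos_le_divide_eq)
  also have "\<dots> = (exp 1 * N / d) ^ d" by (simp add: x_def power_divide[symmetric])
  finally show ?thesis .
qed

text \<open>The separate bound \<open>N\<close> allows a multiple of the sample size to be inserted
  even if repeated picks left fewer points.\<close>

lemma card_first_of_trace_le:
  assumes "finite A" "card A \<le> N" "1 \<le> d" "d \<le> N"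
    and vc: "\<And>X. X \<subseteq> A \<Longrightarrow> shattered ((\<lambda>v. {p. G v p}) ` {..<n}) X \<Longrightarrow> card X \<le> d"
  shows "real (card {v. v < n \<and> first_of_trace G A v}) \<le> (exp 1 * N / d) ^ d"
proof -
  define \<F> where "\<F> = (\<lambda>v. {p \<in> A. G v p}) ` {..<n}"
  have "card {v. v < n \<and> first_of_trace G A v} \<le> card \<F>"
  proof (intro card_inj_on_le[where f = "\<lambda>v. {p \<in> A. G v p}"] inj_onI)
    fix u v assume "u \<in> {v. v < n \<and> first_of_trace G A v}" "v \<in> {v. v < n \<and> first_of_trace G A v}"
      and eq: "{p \<in> A. G u p} = {p \<in> A. G v p}"
    moreover have "\<forall>p\<in>A. G u p = G v p" using eq by blast
    ultimately show "u = v" by (metis (no_types, lifting) first_of_trace_def linorder_neqE_nat mem_Collect_eq)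
  qed (auto simp: \<F>_def)
  also have "\<dots> \<le> card {X. X \<subseteq> A \<and> shattered \<F> X}"
    using assms(1) by (intro card_le_card_shattered) (auto simp: \<F>_def)
  also have "\<dots> \<le> card (\<Union>i\<le>d. {X. X \<subseteq> A \<and> card X = i})"
  proof (intro card_mono)
    show "{X. X \<subseteq> A \<and> shattered \<F> X} \<subseteq> (\<Union>i\<le>d. {X. X \<subseteq> A \<and> card X = i})"
    proof clarify
      fix X assume X: "X \<subseteq> A" "shattered \<F> X"
      have "shattered ((\<lambda>v. {p. G v p}) ` {..<n}) X" unfolding shattered_def
      proof (intro allI impI)
        fix Y assume "Y \<subseteq> X"
        then obtain v where "v < n" "Y = {p \<in> A. G v p} \<inter> X"
          using X(2) unfolding shattered_def \<F>_def by blast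
        moreover have "{p \<in> A. G v p} \<inter> X = {p. G v p} \<inter> X" using X(1) by blast
        ultimately show "\<exists>S\<in>(\<lambda>v. {p. G v p}) ` {..<n}. Y = S \<inter> X" by blast
      qed
      then show "X \<in> (\<Union>i\<le>d. {X. X \<subseteq> A \<and> card X = i})" using vc X(1) by blast
    qed
  qed (use assms(1) in auto)
  also have "\<dots> \<le> (\<Sum>i\<le>d. card {X. X \<subseteq> A \<and> card X = i})" by (intro card_UN_le) simp
  also have "\<dots> = (\<Sum>i\<le>d. card A choose i)" using assms(1) by (simp add: n_subsets)
  also have "\<dots> \<le> (\<Sum>i\<le>d. N choose i)" using assms(2) by (intro sum_mono binomial_right_mono) auto
  finally have "real (card {v. v < n \<and> first_of_trace G A v}) \<le> real (\<Sum>i\<le>d. N choose i)"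
    by (simp only: of_nat_le_iff)
  also have "\<dots> \<le> (exp 1 * N / d) ^ d" by (rule sum_binomial_le[OF assms(3,4)])
  finally show ?thesis .
qed

section \<open>Sample sizes along the chain\<close>

lemma ln_le_two_sqrt:
  assumes "0 < (x::real)"
  shows "ln x \<le> 2 * sqrt x - 2"
proof -
  have "ln x = 2 * ln (sqrt x)" using assms by (simp add: ln_sqrt)
  then show ?thesis using ln_le_minus_one[of "sqrt x"] assms by simp
qed

text \<open>This is why sizes are divided by 16. If \<open>T\<close> grows like
  \<open>16 ^ j\<close>, the factor \<open>(2 ^ j)\<^sup>2 = 4 ^ j\<close> uses only its square
  root; the remaining \<open>4 ^ j\<close> pays for \<open>ln (T / d)\<close> through
  \<open>ln x \<le> 2 * sqrt x - 2\<close>. The constant 1500 is chosen above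
  \<open>81 * 16 = 1296\<close>.\<close>

lemma sample_size_suffices:
  assumes "3 \<le> \<tau>" "1 \<le> d" "1500 * \<tau> * ln \<tau> * real d * 16 ^ j \<le> real T"
  shows "81 * \<tau> * (2 ^ j)\<^sup>2 * (d * ln (exp 1 * (31 * T) / d)) < real T"
proof -
  define \<kappa> where "\<kappa> = 1500 * \<tau> * ln \<tau>"
  define y where "y = real T / d"
  define q where "q = sqrt (y / \<kappa>)"
  have "exp 1 \<le> \<tau>" using exp_le assms(1) by linarith
  then have ln1: "1 \<le> ln \<tau>" using assms(1) by (simp add: ln_ge_iff)
  then have kap: "0 < \<kappa>" using assms(1) by (simp add: \<kappa>_def)
  have ypos: "0 < y"
  proof -
    have "0 < \<kappa> * real d * 16 ^ j" using kap assms(2) by simp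
    also have "\<dots> \<le> real T" using assms(3) by (simp only: \<kappa>_def)
    finally show ?thesis using assms(2) by (simp add: y_def)
  qed
  have "16 ^ j \<le> y / \<kappa>"
    using assms(2,3) kap unfolding y_def \<kappa>_def[symmetric] by (simp add: field_simps)
  then have "sqrt (16 ^ j) \<le> q" by (simp add: q_def)
  moreover have "sqrt (16 ^ j) = 4 ^ j" by (simp add: real_sqrt_power)
  ultimately have q4: "4 ^ j \<le> q" by simp
  have "(1::real) \<le> 4 ^ j" by simp
  then have q1: "1 \<le> q" using q4 by linarith
  have qq: "q\<^sup>2 = y / \<kappa>" using ypos kap by (simp add: q_def)
  \<comment> \<open>Here 31 bounds the ratio of ground set to sample size and 1500 comes from
    \<kappa>. Adding \<open>1 + ln \<tau> + (ln \<tau> - 1)\<close> to 12 stays below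
    \<open>14 * ln \<tau>\<close>, since \<open>ln \<tau> \<ge> 1\<close>.\<close>
  have "ln (31 * 1500) \<le> ln ((2::real) ^ 16)" by simp
  also have "\<dots> = real 16 * ln 2" by (rule ln_realpow)
  also have "\<dots> \<le> 12" using ln2_le_25_over_36 by simp
  finally have lnc: "ln (31 * 1500 :: real) \<le> 12" .
  have lnln: "ln (ln \<tau>) \<le> ln \<tau> - 1" using ln1 by (intro ln_le_minus_one) auto
  have "ln (31 * exp 1 * \<kappa>) = ln ((31 * 1500) * (exp 1 * (\<tau> * ln \<tau>)))"
    by (simp add: \<kappa>_def)
  also have "\<dots> = ln (31 * 1500) + (1 + (ln \<tau> + ln (ln \<tau>)))"
    using assms(1) ln1 by (simp add: ln_mult del: mult_numeral_left)
  also have "\<dots> \<le> 14 * ln \<tau>" using lnc lnln ln1 by linarith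
  finally have k: "ln (31 * exp 1 * \<kappa>) + 2 \<le> 16 * ln \<tau>" using ln1 by linarith
  have "1 \<le> \<kappa>" using mult_mono[of 1 "1500 * \<tau>" 1 "ln \<tau>"] assms(1) ln1 by (simp add: \<kappa>_def)
  moreover have "1 \<le> exp (1::real)" by simp
  ultimately have "1 \<le> exp 1 * \<kappa>" using mult_mono[of 1 "exp (1::real)" 1 \<kappa>] by simp
  then have k0: "0 \<le> ln (31 * exp 1 * \<kappa>)" by simp
  have "exp 1 * (31 * T) / d = (31 * exp 1 * \<kappa>) * (y / \<kappa>)"
    using kap by (simp add: y_def)
  then have "ln (exp 1 * (31 * T) / d) = ln (31 * exp 1 * \<kappa>) + ln (y / \<kappa>)"
    using kap ypos by (simp only: ln_mult_pos mult_pos_pos divide_pos_pos exp_gt_zero zero_less_numeral)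
  also have "\<dots> \<le> ln (31 * exp 1 * \<kappa>) + 2 * q"
    using ln_le_two_sqrt[of "y / \<kappa>"] ypos kap by (simp add: q_def)
  also have "\<dots> \<le> q * ln (31 * exp 1 * \<kappa>) + 2 * q"
    using mult_right_mono[OF q1 k0] by simp
  also have "\<dots> = q * (ln (31 * exp 1 * \<kappa>) + 2)" by (simp add: algebra_simps)
  also have "\<dots> \<le> q * (16 * ln \<tau>)" using k q1 by (intro mult_left_mono) auto
  finally have l: "ln (exp 1 * (31 * T) / d) \<le> q * (16 * ln \<tau>)" .
  have "81 * \<tau> * (2 ^ j)\<^sup>2 * ln (exp 1 * (31 * T) / d) \<le> 81 * \<tau> * 4 ^ j * (q * (16 * ln \<tau>))"
    using l assms(1) by (simp add: power2_eq_square power_mult_distrib[symmetric])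
  also have "\<dots> \<le> 81 * \<tau> * q * (q * (16 * ln \<tau>))"
    using q4 q1 ln1 assms(1) by (intro mult_right_mono mult_left_mono) auto
  also have "\<dots> = 1296 * \<tau> * ln \<tau> * q\<^sup>2" by (simp add: power2_eq_square)
  also have "\<dots> < \<kappa> * q\<^sup>2" using assms(1) ln1 q1 by (simp add: \<kappa>_def)
  also have "\<dots> = y" using qq kap by simp
  finally have "81 * \<tau> * (2 ^ j)\<^sup>2 * ln (exp 1 * (31 * T) / d) < y" .
  then show ?thesis using assms(2) unfolding y_def by (simp add: field_simps)
qed

text \<open>The allowance \<open>exp (4 / 2 ^ s)\<close> telescopes: for \<open>s > 0\<close> the
  stage with \<open>h = 2 ^ s\<close> loses a factor of at most \<open>exp (4 / 2 ^ s)\<close>,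
  which is exactly what the allowance gains when \<open>s\<close> drops by 1. It ends at
  \<open>exp 4 \<le> 81\<close>.\<close>

lemma chain_hits:
  assumes "chain G n A T (2 ^ s) C" "A \<subseteq> P" "card A \<le> 31 * T"
    and "finite P" "0 < n" "3 \<le> \<tau>" "1 \<le> d"
    and vc: "\<And>X. X \<subseteq> P \<Longrightarrow> shattered ((\<lambda>v. {p. G v p}) ` {..<n}) X \<Longrightarrow> card X \<le> d"
    and "1500 * \<tau> * ln \<tau> * real d \<le> real (T div 16 ^ s)"
    and "fractionally_hit G n A (\<tau> * exp (4 / 2 ^ s))"
  shows "C \<subseteq> P \<and> card C \<le> T div 16 ^ s \<and> (\<forall>v<n. \<exists>p\<in>C. G v p)"
  using assms(1,2,3,9,10)
proof (induction s arbitrary: A T)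
  have "exp 1 \<le> \<tau>" using exp_le assms(6) by linarith
  then have "1 \<le> ln \<tau>" using assms(6) by (simp add: ln_ge_iff)
  then have "1500 * 3 * 1 \<le> 1500 * \<tau> * ln \<tau>"
    using assms(6) by (intro mult_mono) auto
  then have d_le: "real d \<le> 1500 * \<tau> * ln \<tau> * real d"
    using mult_right_mono[of 1 "1500 * \<tau> * ln \<tau>" "real d"] by simp
  have "exp 4 = exp (1::real) ^ 4" by (simp add: exp_of_nat_mult[symmetric])
  also have "\<dots> \<le> 3 ^ 4" using exp_le by (intro power_mono) auto
  finally have exp4: "exp (4::real) \<le> 81" by simp
  have enough: "81 * \<tau> * (2 ^ s)\<^sup>2 * ln (card {v. v < n \<and> first_of_trace G A v}) < T"
    if A: "A \<subseteq> P" "card A \<le> 31 * T" "1500 * \<tau> * ln \<tau> * real d \<le> real (T div 16 ^ s)" for A T s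
  proof -
    have "T div 16 ^ s * 16 ^ s \<le> T" by simp
    then have "real (T div 16 ^ s) * 16 ^ s \<le> real T"
      by (metis of_nat_le_iff of_nat_mult of_nat_numeral of_nat_power)
    then have *: "1500 * \<tau> * ln \<tau> * real d * 16 ^ s \<le> real T"
      using mult_right_mono[OF A(3), of "16 ^ s"] by (smt (verit) zero_le_power)
    have "real d \<le> real (T div 16 ^ s)" using d_le A(3) by linarith
    then have "d \<le> T div 16 ^ s" by simp
    then have "d \<le> T" by (meson div_le_dividend le_trans)
    then have M: "real (card {v. v < n \<and> first_of_trace G A v}) \<le> (exp 1 * real (31 * T) / d) ^ d"
      using A assms(4,7) vc by (intro card_first_of_trace_le) (auto intro: finite_subset)
    have "first_of_trace G A 0" by (simp add: first_of_trace_def)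
    then have pos: "0 < card {v. v < n \<and> first_of_trace G A v}"
      using assms(5) by (auto simp: card_gt_0_iff)
    have "0 < exp 1 * real (31 * T) / d" using \<open>d \<le> T\<close> assms(7) by simp
    then have "ln (card {v. v < n \<and> first_of_trace G A v}) \<le> d * ln (exp 1 * real (31 * T) / d)"
      using ln_mono[OF M] pos by (simp add: ln_realpow del: of_nat_mult)
    then have "81 * \<tau> * (2 ^ s)\<^sup>2 * ln (card {v. v < n \<and> first_of_trace G A v})
        \<le> 81 * \<tau> * (2 ^ s)\<^sup>2 * (d * ln (exp 1 * (31 * T) / d))"
      using assms(6) by (intro mult_left_mono) auto
    also have "\<dots> < T" using sample_size_suffices[OF assms(6,7) *] by simp
    finally show ?thesis .
  qed
  \<comment> \<open>The case \<open>m = 0\<close> relies on the default value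
    \<open>ln 0 = 0\<close>.\<close>
  have "0 \<le> ln (real m)" for m by (cases m) auto
  then have lnM: "0 \<le> ln (real (card {v. v < n \<and> first_of_trace G A v}))" for A .
  {
    case (0 A T)
    obtain w B where B: "mw G n A 1 T w B" "chain G n B (T div 16) 0 C"
      using 0(1) by (cases rule: chain.cases) auto
    have C: "C = B" using B(2) by (cases rule: chain.cases) auto
    have "\<tau> * exp 4 * ln (card {v. v < n \<and> first_of_trace G A v})
        \<le> \<tau> * 81 * ln (card {v. v < n \<and> first_of_trace G A v})"
      using exp4 lnM assms(6) by (intro mult_right_mono mult_left_mono) auto
    also have "\<dots> < T" using enough[of A T 0] 0 by (simp add: mult.commute)
    finally have T: "\<tau> * exp 4 * ln (card {v. v < n \<and> first_of_trace G A v}) < T" .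
    have "1 * 1 \<le> \<tau> * exp 4" using assms(6) by (intro mult_mono) auto
    then have "\<exists>p\<in>B. G v p" if "v < n" for v
      using mw_greedy_hits[OF B(1) _ _ T that] 0(5) by simp
    then show ?case using mw_subset[OF B(1)] mw_card[OF B(1)] 0(2) C by auto
  next
    case (Suc s A T)
    obtain w B where B: "mw G n A (2 ^ Suc s) T w B" "chain G n B (T div 16) (2 ^ s) C"
      using Suc(2) by (cases rule: chain.cases) auto
    define x where "x = 1 / (2::real) ^ Suc s"
    have x: "0 < x" "x \<le> 1/2" using one_le_power[of "2::real" s] by (auto simp: x_def field_simps)
    have div: "T div 16 ^ Suc s = (T div 16) div 16 ^ s"
      by (simp add: div_mult2_eq)
    have "1 \<le> T div 16 ^ Suc s" using Suc(5) d_le assms(7) by linarith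
    then have T16: "1 \<le> T div 16"
      unfolding div by (metis div_0 div_by_0 leI le_zero_eq less_one)
    have "exp (4 / 2 ^ Suc s) \<le> exp (4::real)"
    proof -
      have "(1::real) \<le> 2 ^ Suc s" by (rule one_le_power) simp
      then show ?thesis by (simp add: divide_le_eq del: power_Suc)
    qed
    then have e81: "exp (4 / 2 ^ Suc s) \<le> (81::real)" using exp4 by linarith
    have "\<tau> * exp (4 / 2 ^ Suc s) * real (2 ^ Suc s) ^ 2 * ln (card {v. v < n \<and> first_of_trace G A v})
        \<le> \<tau> * 81 * real (2 ^ Suc s) ^ 2 * ln (card {v. v < n \<and> first_of_trace G A v})"
      using e81 lnM assms(6) by (intro mult_right_mono mult_left_mono) auto
    also have "\<dots> \<le> T" using enough[OF Suc(3,4,5)] by (simp add: mult.commute)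
    finally have T: "\<tau> * exp (4 / 2 ^ Suc s) * real (2 ^ Suc s) ^ 2
      * ln (card {v. v < n \<and> first_of_trace G A v}) \<le> T" .
    have "1 * 1 \<le> \<tau> * exp (4 / 2 ^ Suc s)" using assms(6) by (intro mult_mono) auto
    then have "fractionally_hit G n B (\<tau> * exp (4 / 2 ^ Suc s) / (1 - 1 / real (2 ^ Suc s))\<^sup>2)"
      using T16 assms(5) by (intro mw_preserves_fractionally_hit[OF B(1) Suc(6) _ _ _ _ T]) auto
    moreover have "\<tau> * exp (4 / 2 ^ Suc s) / (1 - 1 / real (2 ^ Suc s))\<^sup>2 \<le> \<tau> * exp (4 / 2 ^ s)"
    proof -
      \<comment> \<open>For \<open>x \<le> 1/2\<close> this leads to
        \<open>exp (- 2 * x) \<le> 1 - x\<close>, so the loss \<open>1 / (1 - x)\<^sup>2\<close> of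
        the stage is at most \<open>exp (4 * x)\<close>.\<close>
      have "- 2 * x \<le> - x - 2 * x\<^sup>2"
        using mult_left_mono[OF x(2), of x] x(1) by (simp add: power2_eq_square)
      also have "\<dots> \<le> ln (1 - x)" using x by (intro ln_one_minus_pos_lower_bound) auto
      finally have "exp (- 2 * x) \<le> 1 - x" using x by (simp add: ln_ge_iff)
      then have "exp (- 2 * x) ^ 2 \<le> (1 - x)\<^sup>2" by (intro power_mono) auto
      then have "exp (- 4 * x) \<le> (1 - x)\<^sup>2" by (simp add: exp_of_nat_mult[symmetric])
      then have "exp (4 * x) / (1 - x)\<^sup>2 \<le> exp (4 * x) / exp (- 4 * x)"
        by (intro divide_left_mono) (use x in \<open>auto intro: mult_pos_pos\<close>)
      also have "\<dots> = exp (8 * x)" by (simp add: exp_diff[symmetric])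
      finally have "\<tau> * (exp (4 * x) / (1 - x)\<^sup>2) \<le> \<tau> * exp (8 * x)"
        using assms(6) by (intro mult_left_mono) auto
      then show ?thesis by (simp add: x_def)
    qed
    ultimately have fB: "fractionally_hit G n B (\<tau> * exp (4 / 2 ^ s))"
      by (rule fractionally_hit_mono)
    \<comment> \<open>The remainder is at most 15, hence at most 15 times the positive quotient; 31
      is 16 + 15.\<close>
    have "T \<le> 31 * (T div 16)" using T16 by linarith
    then have cB: "card B \<le> 31 * (T div 16)" using mw_card[OF B(1)] by linarith
    have "B \<subseteq> P" using mw_subset[OF B(1)] Suc(3) by blast
    then show ?case using Suc(1)[OF B(2) _ cB _ fB] Suc(5) unfolding div by blast
  }
qed

section \<open>Fractional hitting sets from comatchings\<close>

text \<open>Comparing with each \<open>u\<close> separately, instead of with the maximum, is the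
  form that the program tests.\<close>

definition near_furthest :: "('a \<Rightarrow> 'a \<Rightarrow> real) \<Rightarrow> 'a set \<Rightarrow> real \<Rightarrow> 'a \<Rightarrow> 'a \<Rightarrow> bool" where
  "near_furthest \<delta> P \<epsilon> v p \<longleftrightarrow> p \<in> P \<and> (\<forall>u\<in>P. (1 - \<epsilon>) * \<delta> v u \<le> \<delta> v p)"

text \<open>Read \<open>N u v\<close> as an arc from \<open>u\<close> to \<open>v\<close>; all
  in-neighbourhoods are light. Double counting arcs with weight \<open>w u * w v\<close> yields a
  vertex whose out-neighbourhood is light as well. Keeping it and deleting both neighbourhoods costs
  at most \<open>2 * \<beta>\<close>, so this can be repeated.\<close>

lemma exists_independent_set:
  fixes w :: "'a \<Rightarrow> nat"
  assumes "finite U" "\<And>v. v \<in> U \<Longrightarrow> N v v"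
    and "\<And>v. v \<in> U \<Longrightarrow> sum w {u \<in> U. N u v} \<le> \<beta>"
    and "2 * \<beta> * m < sum w U"
  shows "\<exists>I\<subseteq>U. card I = Suc m \<and> (\<forall>u\<in>I. \<forall>v\<in>I. u \<noteq> v \<longrightarrow> \<not> N u v)"
  using assms
proof (induction m arbitrary: U)
  case 0
  then have "U \<noteq> {}" by auto
  then obtain v where "v \<in> U" by blast
  then show ?case by (intro exI[of _ "{v}"]) auto
next
  case (Suc m)
  define In Out where "In v = {u \<in> U. N u v}" and "Out u = {v \<in> U. N u v}" for u v
  have pos: "0 < sum w U" using Suc.prems(4) by simp
  have "\<exists>u\<in>U. sum w (Out u) \<le> \<beta>"
  proof (rule ccontr)
    assume "\<not> ?thesis"
    then have "\<And>u. u \<in> U \<Longrightarrow> Suc \<beta> \<le> sum w (Out u)" by force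
    then have "(\<Sum>u\<in>U. w u * Suc \<beta>) \<le> (\<Sum>u\<in>U. w u * sum w (Out u))"
      by (intro sum_mono mult_left_mono) auto
    also have "\<dots> = (\<Sum>u\<in>U. \<Sum>v | v \<in> U \<and> N u v. w u * w v)"
      by (simp add: Out_def sum_distrib_left)
    also have "\<dots> = (\<Sum>v\<in>U. \<Sum>u | u \<in> U \<and> N u v. w u * w v)"
      using Suc.prems(1) by (intro sum.swap_restrict) auto
    also have "\<dots> = (\<Sum>v\<in>U. sum w (In v) * w v)"
      by (simp add: In_def sum_distrib_right)
    also have "\<dots> \<le> (\<Sum>v\<in>U. \<beta> * w v)"
      using Suc.prems(3) unfolding In_def by (intro sum_mono mult_right_mono) auto
    finally have "sum w U * Suc \<beta> \<le> \<beta> * sum w U"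
      by (simp only: sum_distrib_left sum_distrib_right)
    with pos show False by simp
  qed
  then obtain u where u: "u \<in> U" "sum w (Out u) \<le> \<beta>" by blast
  have inu: "sum w (In u) \<le> \<beta>" using Suc.prems(3)[OF u(1)] by (simp add: In_def)
  define U' where "U' = U - (In u \<union> Out u)"
  have "sum w (In u \<union> Out u) \<le> sum w (In u) + sum w (Out u)"
    using Suc.prems(1) sum.union_inter[of "In u" "Out u" w] by (simp add: In_def Out_def)
  moreover have "sum w U = sum w U' + sum w (In u \<union> Out u)"
    unfolding U'_def using Suc.prems(1) by (intro sum.subset_diff) (auto simp: In_def Out_def)
  ultimately have "sum w U \<le> sum w U' + 2 * \<beta>" using u(2) inu by linarith
  then have "2 * \<beta> * m < sum w U'" using Suc.prems(4) by simp
  moreover have "sum w {x \<in> U'. N x v} \<le> \<beta>" if "v \<in> U'" for v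
  proof -
    have "sum w {x \<in> U'. N x v} \<le> sum w {x \<in> U. N x v}"
      using Suc.prems(1) by (intro sum_mono2) (auto simp: U'_def)
    then show ?thesis using Suc.prems(3)[of v] that by (simp add: U'_def)
  qed
  ultimately obtain I where I: "I \<subseteq> U'" "card I = Suc m"
      "\<forall>u\<in>I. \<forall>v\<in>I. u \<noteq> v \<longrightarrow> \<not> N u v"
    using Suc.IH[of U'] Suc.prems(1,2) by (auto simp: U'_def)
  have "finite I" using I(1) Suc.prems(1) unfolding U'_def by (meson finite_Diff finite_subset)
  moreover have "u \<notin> I" using I(1) Suc.prems(2)[OF u(1)] u(1) by (auto simp: U'_def In_def)
  moreover have "\<not> N u v \<and> \<not> N v u" if "v \<in> I" for v
    using that I(1) by (auto simp: U'_def In_def Out_def)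
  ultimately show ?case using I u(1)
    by (intro exI[of _ "insert u I"]) (auto simp: U'_def)
qed

lemma length_comatching_le:
  assumes "comatching V \<delta> \<epsilon> ps" "comatching_index V \<delta> \<epsilon> = enat L"
  shows "length ps \<le> L"
proof -
  have "enat (length ps) \<le> comatching_index V \<delta> \<epsilon>"
    unfolding comatching_index_def using assms(1) by (intro Sup_upper) blast
  then show ?thesis using assms(2) by simp
qed

lemma card_shattered_le:
  assumes "vc_dimension V \<F> = enat d" "X \<subseteq> V" "finite X" "shattered \<F> X"
  shows "card X \<le> d"
proof -
  have "enat (card X) \<le> vc_dimension V \<F>"
    unfolding vc_dimension_def using assms(2-4) by (intro Sup_upper) blast
  then show ?thesis using assms(1) by simp
qed

context Metric_space
begin

lemma comatching_index_ge_2: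
  assumes "x \<in> M" "y \<in> M" "x \<noteq> y" "0 < \<epsilon>" "\<epsilon> < 1" "comatching_index M d \<epsilon> = enat L"
  shows "2 \<le> L"
proof -
  have pos: "0 < d x y" using assms by simp
  have "comatching M d \<epsilon> [(x, y), (y, x)]" unfolding comatching_def
  \<comment> \<open>Any positive \<open>R\<close> below \<open>d x y\<close> would do, since the
    distances off the diagonal are \<open>d x x\<close> and \<open>d y y\<close>, hence 0.\<close>
  proof (intro conjI exI[of _ "d x y / 2"])
    show "\<forall>i<length [(x, y), (y, x)]. d (fst ([(x, y), (y, x)] ! i)) (snd ([(x, y), (y, x)] ! i)) > d x y / 2"
      using pos by (auto simp: less_Suc_eq commute)
    show "\<forall>i<length [(x, y), (y, x)]. \<forall>j<length [(x, y), (y, x)]. i \<noteq> j \<longrightarrow>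
        d (fst ([(x, y), (y, x)] ! i)) (snd ([(x, y), (y, x)] ! j)) \<le> (1 - \<epsilon>) * (d x y / 2)"
      using pos assms by (auto simp: less_Suc_eq)
  qed (use pos assms in auto)
  then show ?thesis using length_comatching_le[OF _ assms(6)] by fastforce
qed

lemma mcball_in_ball_family: "v \<in> M \<Longrightarrow> 0 < r \<Longrightarrow> mcball v r \<in> ball_family M d"
  unfolding ball_family_def by blast

lemma vc_dimension_balls_ge_1:
  assumes "x \<in> M" "y \<in> M" "x \<noteq> y" "vc_dimension M (ball_family M d) = enat k"
  shows "1 \<le> k"
proof -
  have pos: "0 < d x y" using assms by simp
  have "shattered (ball_family M d) {x}" unfolding shattered_def
  proof (intro allI impI)
    fix Y assume "Y \<subseteq> {x}"
    then consider "Y = {}" | "Y = {x}" by blast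
    then show "\<exists>A\<in>ball_family M d. Y = A \<inter> {x}"
    proof cases
      case 1
      have "mcball y (d x y / 2) \<in> ball_family M d"
        using pos assms by (intro mcball_in_ball_family) auto
      moreover have "Y = mcball y (d x y / 2) \<inter> {x}" using 1 pos commute[of y x] by auto
      ultimately show ?thesis by blast
    next
      case 2
      have "mcball x 1 \<in> ball_family M d"
        using assms by (intro mcball_in_ball_family) auto
      moreover have "Y = mcball x 1 \<inter> {x}" using 2 assms by auto
      ultimately show ?thesis by blast
    qed
  qed
  then show ?thesis using card_shattered_le[OF assms(4), of "{x}"] assms(1) by simp
qed

text \<open>In a finite space, open balls of positive radius are closed balls of a smaller radius, so
  complements of the sets \<^const>\<open>near_furthest\<close> are traces of balls.\<close>

lemma card_shattered_near_furthest_le: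
  assumes "finite M" "P \<subseteq> M" "\<epsilon> < 1" "1 \<le> k"
    and "vc_dimension M (ball_family M d) = enat k"
    and "X \<subseteq> P" "shattered ((\<lambda>v. {p. near_furthest d P \<epsilon> v p}) ` M) X"
  shows "card X \<le> k"
\<comment> \<open>Of two points in \<open>X\<close>, one is at positive distance from
  \<open>v\<close>, which makes the threshold \<open>r\<close> positive, as the radii in the ball
  family must be.\<close>
proof (cases "card X \<le> 1")
  case False
  have "finite X" using assms(1,2,6) by (meson finite_subset)
  then obtain x y where xy: "x \<in> X" "y \<in> X" "x \<noteq> y"
    using False by (metis card_le_Suc0_iff_eq One_nat_def)
  have "shattered (ball_family M d) X" unfolding shattered_def
  proof (intro allI impI)
    fix Y assume "Y \<subseteq> X"
    \<comment> \<open>Shattering is symmetric under complements: the far points cut out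
      \<open>X - Y\<close>, so that the ball of near points cuts out \<open>Y\<close>.\<close>
    then obtain v where v: "v \<in> M" "X - Y = {p. near_furthest d P \<epsilon> v p} \<inter> X"
      using assms(7)[unfolded shattered_def, rule_format, of "X - Y"] by auto
    have fin: "finite (d v ` P)" "d v ` P \<noteq> {}"
      using assms(1,2,6) xy(1) by (auto intro: finite_subset)
    define r where "r = (1 - \<epsilon>) * Max (d v ` P)"
    have "d v x > 0 \<or> d v y > 0" using xy v(1) assms(2,6) by (metis mdist_pos_less subsetD)
    then have "0 < Max (d v ` P)"
      using fin xy assms(6) by (subst Max_gr_iff) auto
    then have r: "0 < r" using assms(3) by (simp add: r_def)
    have G: "near_furthest d P \<epsilon> v p \<longleftrightarrow> r \<le> d v p" if "p \<in> P" for p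
    proof -
      obtain q where q: "q \<in> P" "d v q = Max (d v ` P)" using Max_in[OF fin] by force
      have "(1 - \<epsilon>) * d v u \<le> r" if "u \<in> P" for u
        unfolding r_def using fin that assms(3) by (intro mult_left_mono) auto
      then show ?thesis using that q by (force simp: near_furthest_def r_def)
    qed
    \<comment> \<open>The largest distance below \<open>r\<close> is a closed radius containing the
      same points as the open one. The entry \<open>r / 2\<close> keeps the set nonempty and its
      maximum positive.\<close>
    define D where "D = insert (r / 2) {d v p | p. p \<in> M \<and> d v p < r}"
    have finD: "finite D" using assms(1) by (simp add: D_def)
    then have "Max D \<in> D" by (intro Max_in) (auto simp: D_def)
    then have "Max D < r" using r by (auto simp: D_def)
    moreover have "r / 2 \<le> Max D" using finD by (intro Max_ge) (auto simp: D_def)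
    moreover have "d v p \<le> Max D" if "p \<in> M" "d v p < r" for p
      using that finD by (intro Max_ge) (auto simp: D_def)
    ultimately have ball: "d v p \<le> Max D \<longleftrightarrow> d v p < r" if "p \<in> M" for p
      using that by fastforce
    have "mcball v (Max D) \<in> ball_family M d"
      using \<open>r / 2 \<le> Max D\<close> r v(1) by (intro mcball_in_ball_family) auto
    moreover have "Y = mcball v (Max D) \<inter> X"
    proof -
      have "p \<in> Y \<longleftrightarrow> p \<in> mcball v (Max D)" if "p \<in> X" for p
      proof -
        have "p \<in> P" "p \<in> M" using that assms(2,6) by blast+
        have "p \<in> X - Y \<longleftrightarrow> p \<in> {p. near_furthest d P \<epsilon> v p} \<inter> X" by (simp only: v(2))
        then have "p \<in> Y \<longleftrightarrow> \<not> r \<le> d v p" using that G[OF \<open>p \<in> P\<close>] by blast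
        then show ?thesis using ball[OF \<open>p \<in> M\<close>] v(1) \<open>p \<in> M\<close> by (simp add: not_le)
      qed
      then show ?thesis using \<open>Y \<subseteq> X\<close> by blast
    qed
    ultimately show "\<exists>A\<in>ball_family M d. Y = A \<inter> X" by blast
  qed
  then show ?thesis using card_shattered_le[OF assms(5)] assms(2,6) \<open>finite X\<close> by auto
qed (use assms(4) in simp)

text \<open>Let \<open>f v\<close> be a furthest point from \<open>v\<close>; the rows hit by
  \<open>f v\<close> have weight at most \<beta>. If \<open>f v\<close> is not nearly furthest from
  \<open>u\<close>, then \<open>d u (f v)\<close> is below
  \<open>(1 - \<epsilon>) * (1 + \<epsilon>) * R\<close>, hence at most
  \<open>(1 - \<epsilon>\<^sup>2 / 4) * R\<close>, while \<open>d u (f u) > R\<close>. So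
  \<open>L + 1\<close> independent points would form too long a comatching.\<close>

lemma weight_of_scale_le:
  fixes w :: "'a \<Rightarrow> nat"
  assumes "finite M" "P \<subseteq> M" "P \<noteq> {}" "0 < \<epsilon>" "\<epsilon> < 1" "0 < R"
    and "comatching_index M d (\<epsilon>\<^sup>2 / 4) = enat L"
    and U: "U = {v \<in> M. R < Max (d v ` P) \<and> Max (d v ` P) \<le> (1 + \<epsilon>) * R}"
    and "\<And>p. p \<in> P \<Longrightarrow> (\<Sum>v\<in>M. w v * of_bool (near_furthest d P \<epsilon> v p)) \<le> \<beta>"
  shows "sum w U \<le> 2 * \<beta> * L"
proof (rule ccontr)
  assume "\<not> ?thesis"
  then have big: "2 * \<beta> * L < sum w U" by simp
  have fin: "finite (d v ` P)" "d v ` P \<noteq> {}" for v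
    using assms(1-3) by (auto intro: finite_subset)
  have "\<exists>q\<in>P. d v q = Max (d v ` P)" for v using Max_in[OF fin, of v] by force
  then obtain f where f: "\<And>v. f v \<in> P" "\<And>v. d v (f v) = Max (d v ` P)" by metis
  have le: "d v p \<le> d v (f v)" if "p \<in> P" for v p
    using that fin f(2) by simp
  let ?N = "\<lambda>u v. near_furthest d P \<epsilon> u (f v)"
  have "finite U" using assms(1) by (simp add: U)
  moreover have "?N v v" for v
    unfolding near_furthest_def
  proof (intro conjI ballI f(1))
    fix u assume "u \<in> P"
    have "(1 - \<epsilon>) * d v u \<le> 1 * d v u" using assms(4) by (intro mult_right_mono) auto
    then show "(1 - \<epsilon>) * d v u \<le> d v (f v)" using le[OF \<open>u \<in> P\<close>, of v] by simp
  qed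
  moreover have "sum w {u \<in> U. ?N u v} \<le> \<beta>" for v
  proof -
    have "sum w {u \<in> U. ?N u v} \<le> sum w {u \<in> M. ?N u v}"
      using assms(1) by (intro sum_mono2) (auto simp: U)
    also have "\<dots> = (\<Sum>u\<in>M. w u * of_bool (?N u v))"
      using assms(1) by (simp add: of_bool_def if_distrib sum.If_cases Int_def cong: if_cong)
    also have "\<dots> \<le> \<beta>" by (rule assms(9)[OF f(1)])
    finally show ?thesis .
  qed
  ultimately obtain I where I: "I \<subseteq> U" "card I = Suc L"
      "\<forall>u\<in>I. \<forall>v\<in>I. u \<noteq> v \<longrightarrow> \<not> ?N u v"
    using exists_independent_set[of U ?N w \<beta> L] big by blast
  have "finite I" using I(2) by (simp add: card_ge_0_finite)
  then obtain xs where xs: "set xs = I" "distinct xs" using finite_distinct_list by blast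
  define ps where "ps = map (\<lambda>v. (v, f v)) xs"
  have "comatching M d (\<epsilon>\<^sup>2 / 4) ps" unfolding comatching_def
  proof (intro conjI exI[of _ R] allI impI)
    show "set ps \<subseteq> M \<times> M" using xs I(1) f(1) assms(2) by (auto simp: ps_def U)
    show "0 < R" by fact
    show "R < d (fst (ps ! i)) (snd (ps ! i))" if "i < length ps" for i
    proof -
      have "xs ! i \<in> U" using that xs I(1) by (auto simp: ps_def)
      then show ?thesis using that f(2) by (simp add: ps_def U)
    qed
    fix i j assume ij: "i < length ps" "j < length ps" "i \<noteq> j"
    define u v where "u = xs ! i" and "v = xs ! j"
    have uv: "u \<in> I" "v \<in> I" "u \<noteq> v"
      using ij xs by (auto simp: u_def v_def ps_def nth_eq_iff_index_eq)
    then have "\<not> ?N u v" using I(3) by blast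
    then obtain p where p: "p \<in> P" "d u (f v) < (1 - \<epsilon>) * d u p"
      using f(1) by (auto simp: near_furthest_def not_le)
    have "d u p \<le> (1 + \<epsilon>) * R" using le[OF p(1), of u] uv(1) I(1) f(2) by (auto simp: U)
    then have "(1 - \<epsilon>) * d u p \<le> (1 - \<epsilon>) * ((1 + \<epsilon>) * R)"
      using assms(5) by (intro mult_left_mono) auto
    also have "\<dots> = (1 - \<epsilon>\<^sup>2) * R" by (simp add: algebra_simps power2_eq_square)
    also have "\<dots> \<le> (1 - \<epsilon>\<^sup>2 / 4) * R" using assms(6) by (intro mult_right_mono) auto
    finally have "d u (f v) \<le> (1 - \<epsilon>\<^sup>2 / 4) * R" using p(2) by linarith
    then show "d (fst (ps ! i)) (snd (ps ! j)) \<le> (1 - \<epsilon>\<^sup>2 / 4) * R"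
      using ij by (simp add: ps_def u_def v_def)
  qed
  then have "length ps \<le> L" using length_comatching_le assms(7) by blast
  moreover have "length ps = Suc L" using xs I(2) distinct_card[of xs] by (simp add: ps_def)
  ultimately show False by simp
qed

end


section \<open>Covering all furthest distances by geometric scales\<close>

lemma exp_half_le:
  assumes "0 \<le> (x::real)" "x \<le> 1"
  shows "exp (x / 2) \<le> 1 + x"
proof -
  have "exp (x / 2) \<le> 1 + x / 2 + (x / 2)\<^sup>2" using assms by (intro exp_bound) auto
  moreover have "x * x \<le> x * 1" using assms by (intro mult_left_mono) auto
  ultimately show ?thesis using assms by (simp add: power2_eq_square field_simps)
qed

text \<open>A ratio of \<open>4 / \<epsilon>\<close> takes about
  \<open>2 / \<epsilon> * ln (4 / \<epsilon>)\<close> scales, because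
  \<open>exp (\<epsilon> / 2) \<le> 1 + \<epsilon>\<close>. The logarithm is traded for
  \<open>1 / sqrt \<epsilon>\<close> at once, which the final exponent 2 can afford.\<close>

lemma geometric_scales:
  assumes "0 < \<epsilon>" "\<epsilon> < 1"
  obtains S where "4 / \<epsilon> \<le> (1 + \<epsilon>) ^ S" "2 * (real S + 1) \<le> 16 / (\<epsilon> * sqrt \<epsilon>)"
proof -
  define x where "x = 2 / \<epsilon> * ln (4 / \<epsilon>)"
  have "0 \<le> ln (4 / \<epsilon>)" using assms by (intro ln_ge_zero) (simp add: field_simps)
  then have x: "0 \<le> x" using assms by (simp add: x_def)
  define S where "S = nat \<lceil>x\<rceil>"
  have S: "x \<le> S" "S \<le> x + 1" unfolding S_def using x by linarith+
  have "4 / \<epsilon> = exp (x * (\<epsilon> / 2))" using assms by (simp add: x_def)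
  also have "\<dots> \<le> exp (S * (\<epsilon> / 2))" using S(1) assms by simp
  also have "\<dots> = exp (\<epsilon> / 2) ^ S" by (rule exp_of_nat_mult)
  also have "\<dots> \<le> (1 + \<epsilon>) ^ S" using assms exp_half_le by (intro power_mono) auto
  finally have 1: "4 / \<epsilon> \<le> (1 + \<epsilon>) ^ S" .
  have "sqrt 4 = (2::real)" by (metis abs_numeral real_sqrt_abs power2_eq_square mult_2 numeral_Bit0)
  then have "ln (4 / \<epsilon>) \<le> 4 / sqrt \<epsilon> - 2"
    using ln_le_two_sqrt[of "4 / \<epsilon>"] assms by (simp add: real_sqrt_divide)
  then have "x \<le> 2 / \<epsilon> * (4 / sqrt \<epsilon> - 2)" unfolding x_def using assms by (intro mult_left_mono) auto
  also have "\<dots> = 8 / (\<epsilon> * sqrt \<epsilon>) - 4 / \<epsilon>" by (simp add: right_diff_distrib)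
  finally have "2 * (real S + 1) \<le> 16 / (\<epsilon> * sqrt \<epsilon>) - 8 / \<epsilon> + 4" using S(2) by simp
  moreover have "4 \<le> 8 / \<epsilon>" using assms by (simp add: field_simps)
  ultimately have "2 * (real S + 1) \<le> 16 / (\<epsilon> * sqrt \<epsilon>)" by linarith
  with 1 show ?thesis by (rule that)
qed

text \<open>Once a single point \<open>p0\<close> is chosen, only the points whose furthest distance lies between
  half of and \<open>1/\<epsilon>\<close> times the radius of \<open>P\<close> around \<open>p0\<close> remain; they are split into geometric scales.\<close>

lemma fractionally_hit_near_furthest:
  assumes "Metric_space {..<n} \<delta>" "P \<subseteq> {..<n}" "P \<noteq> {}" "0 < \<epsilon>" "\<epsilon> < 1"
    and "comatching_index {..<n} \<delta> (\<epsilon>\<^sup>2 / 4) = enat L" "1 \<le> L"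
  shows "fractionally_hit (near_furthest \<delta> P \<epsilon>) n P (16 * real L / (\<epsilon> * sqrt \<epsilon>))"
  unfolding fractionally_hit_def
proof
  fix w :: "nat \<Rightarrow> nat"
  interpret Metric_space "{..<n}" \<delta> by fact
  let ?G = "near_furthest \<delta> P \<epsilon>"
  define F where "F v = Max (\<delta> v ` P)" for v
  have finP: "finite P" using assms(2) finite_subset by blast
  have fin: "finite (\<delta> v ` P)" "\<delta> v ` P \<noteq> {}" for v using finP assms(3) by auto
  have F_le: "\<delta> v p \<le> F v" if "p \<in> P" for v p using that fin by (simp add: F_def)
  have F_at: "\<exists>q\<in>P. F v = \<delta> v q" for v unfolding F_def using Max_in[OF fin, of v] by force
  obtain S where S: "4 / \<epsilon> \<le> (1 + \<epsilon>) ^ S" "2 * (real S + 1) \<le> 16 / (\<epsilon> * sqrt \<epsilon>)"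
    using geometric_scales[OF assms(4,5)] by blast
  obtain p0 where p0: "p0 \<in> P" using assms(3) by blast
  define D where "D = F p0"
  \<comment> \<open>The scales are open at the lower end. Starting at \<open>D / 4\<close> places
    every remaining row strictly above the lowest end, since its furthest distance is at least
    \<open>D / 2\<close>.\<close>
  define R where "R i = D / 4 * (1 + \<epsilon>) ^ i" for i
  define U where "U i = {v \<in> {..<n}. R i < F v \<and> F v \<le> (1 + \<epsilon>) * R i}" for i
  obtain p where p: "p \<in> P" "\<And>q. q \<in> P \<Longrightarrow> load ?G n w q \<le> load ?G n w p"
  proof -
    have "Max (load ?G n w ` P) \<in> load ?G n w ` P" using finP assms(3) by (intro Max_in) auto
    then obtain p where "p \<in> P" "load ?G n w p = Max (load ?G n w ` P)" by force
    with finP that show ?thesis by simp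
  qed
  define \<beta> where "\<beta> = load ?G n w p"
  have covered: "?G v p0 \<or> (\<exists>i<S. v \<in> U i \<and> 0 < R i)" if v: "v < n" for v
  proof (cases "?G v p0")
    case False
    then obtain u where u: "u \<in> P" "\<delta> v p0 < (1 - \<epsilon>) * \<delta> v u"
      using p0 by (auto simp: near_furthest_def not_le)
    have "(1 - \<epsilon>) * \<delta> v u \<le> (1 - \<epsilon>) * F v" using F_le[OF u(1)] assms(5) by (intro mult_left_mono) auto
    with u(2) have far: "\<delta> v p0 < (1 - \<epsilon>) * F v" by linarith
    obtain q where q: "q \<in> P" "F v = \<delta> v q" using F_at by blast
    obtain q0 where q0: "q0 \<in> P" "D = \<delta> p0 q0" using F_at D_def by blast
    have in_n: "p0 \<in> {..<n}" "q \<in> {..<n}" "q0 \<in> {..<n}" "v \<in> {..<n}"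
      using p0 q q0 assms(2) v by auto
    have "\<delta> v q \<le> \<delta> v p0 + \<delta> p0 q" using in_n by (intro triangle)
    also have "\<delta> p0 q \<le> D" unfolding D_def by (rule F_le[OF q(1)])
    finally have "F v < (1 - \<epsilon>) * F v + D" using far q(2) by linarith
    then have up: "\<epsilon> * F v < D" by (simp add: algebra_simps)
    have "\<delta> p0 q0 \<le> \<delta> v p0 + \<delta> v q0" using in_n by (intro triangle'')
    then have low: "D \<le> 2 * F v" using q0(2) F_le[OF p0, of v] F_le[OF q0(1), of v] by linarith
    have "0 \<le> \<epsilon> * F v" using q(2) assms(4) by simp
    with up have D: "0 < D" by linarith
    then have Rpos: "0 < R i" for i using assms(4) by (simp add: R_def)
    have "F v \<le> D / 4 * (4 / \<epsilon>)" using up assms(4) by (simp add: field_simps)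
    also have "\<dots> \<le> D / 4 * (1 + \<epsilon>) ^ S" using S(1) D by (intro mult_left_mono) auto
    finally have FS: "F v \<le> R S" by (simp add: R_def)
    define k where "k = (LEAST k. F v \<le> R k)"
    have k: "F v \<le> R k" unfolding k_def using FS by (rule LeastI)
    have kS: "k \<le> S" unfolding k_def using FS by (rule Least_le)
    have "\<not> F v \<le> R 0" using low D by (simp add: R_def)
    with k obtain i where i: "k = Suc i" by (cases k) auto
    have "\<not> F v \<le> R i" using i not_less_Least[of i "\<lambda>k. F v \<le> R k"] by (simp add: k_def)
    moreover have "R (Suc i) = (1 + \<epsilon>) * R i" by (simp add: R_def)
    ultimately have "v \<in> U i" using k i v by (simp add: U_def)
    then show ?thesis using i kS Rpos by auto
  qed simp
  \<comment> \<open>For \<open>D = 0\<close> all scales have radius 0, outside the scope of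
    \<open>weight_of_scale_le\<close>; then \<open>J\<close> is empty and \<open>p0\<close> hits
    every row.\<close>
  define J where "J = {i. i < S \<and> 0 < R i}"
  have J: "finite J" "card J \<le> S" using card_mono[of "{..<S}" J] by (auto simp: J_def)
  have scale: "sum w (U i) \<le> 2 * \<beta> * L" if "i \<in> J" for i
  proof (rule weight_of_scale_le[OF _ assms(2-5) _ assms(6)])
    show "0 < R i" using that by (simp add: J_def)
    show "U i = {v \<in> {..<n}. R i < Max (\<delta> v ` P) \<and> Max (\<delta> v ` P) \<le> (1 + \<epsilon>) * R i}"
      by (simp add: U_def F_def)
    show "(\<Sum>v<n. w v * of_bool (?G v q)) \<le> \<beta>" if "q \<in> P" for q
      using p(2)[OF that] by (simp add: \<beta>_def load_def)
  qed simp
  have sumU: "(\<Sum>v<n. w v * of_bool (v \<in> U i)) = sum w (U i)" for i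
    by (simp add: of_bool_def if_distrib sum.If_cases U_def Int_def cong: if_cong)
  have "(\<Sum>v<n. w v) \<le> (\<Sum>v<n. w v * of_bool (?G v p0) + (\<Sum>i\<in>J. w v * of_bool (v \<in> U i)))"
  proof (rule sum_mono)
    fix v assume "v \<in> {..<n}"
    then consider "?G v p0" | i where "i \<in> J" "v \<in> U i" using covered[of v] by (auto simp: J_def)
    then show "w v \<le> w v * of_bool (?G v p0) + (\<Sum>i\<in>J. w v * of_bool (v \<in> U i))"
    proof cases
      case (2 i)
      have "w v * of_bool (v \<in> U i) \<le> (\<Sum>i\<in>J. w v * of_bool (v \<in> U i))"
        using 2 J by (intro member_le_sum) auto
      with 2 show ?thesis by simp
    qed simp
  qed
  also have "\<dots> = load ?G n w p0 + (\<Sum>i\<in>J. \<Sum>v<n. w v * of_bool (v \<in> U i))"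
    unfolding sum.distrib load_def by (subst sum.swap) (rule refl)
  also have "\<dots> \<le> \<beta> + (\<Sum>i\<in>J. 2 * \<beta> * L)"
    unfolding sumU using p(2)[OF p0] scale by (intro add_mono sum_mono) (auto simp: \<beta>_def)
  also have "\<dots> = \<beta> + card J * (2 * \<beta> * L)" by simp
  also have "\<dots> \<le> \<beta> * (2 * L) + S * (2 * \<beta> * L)"
    using J(2) assms(7) by (intro add_mono mult_right_mono) auto
  also have "\<dots> = 2 * (S + 1) * L * \<beta>" by (simp add: algebra_simps)
  finally have "real (\<Sum>v<n. w v) \<le> real (2 * (S + 1) * L * \<beta>)" by (simp only: of_nat_le_iff)
  also have "\<dots> = 2 * (real S + 1) * (L * \<beta>)" by (simp add: algebra_simps)
  also have "\<dots> \<le> 16 / (\<epsilon> * sqrt \<epsilon>) * (L * \<beta>)" using S(2) by (intro mult_right_mono) auto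
  finally show "\<exists>p\<in>P. real (\<Sum>v<n. w v) \<le> 16 * real L / (\<epsilon> * sqrt \<epsilon>) * real (load ?G n w p)"
    using p(1) by (auto simp: \<beta>_def algebra_simps)
qed


text \<open>With \<open>t = 1 / sqrt \<epsilon>\<close> one has
  \<open>\<tau> = 16 * L * t ^ 3\<close> and \<open>ln \<tau> \<le> 5 * t * ln L\<close>: here
  \<open>ln 16 = 4 * ln 2 \<le> 4 * ln L\<close>, and \<open>3 \<le> 5 * ln L\<close> because
  \<open>ln L \<ge> 2/3\<close>. The powers of \<open>t\<close> multiply to
  \<open>1 / \<epsilon>\<^sup>2\<close>.\<close>

lemma fractional_bound_times_ln:
  fixes \<epsilon> :: real
  assumes "0 < \<epsilon>" "\<epsilon> < 1" "2 \<le> L"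
  defines "\<tau> \<equiv> 16 * real L / (\<epsilon> * sqrt \<epsilon>)"
  shows "3 \<le> \<tau>" "\<tau> * ln \<tau> \<le> 80 * (1 / \<epsilon>\<^sup>2) * L * ln L"
proof -
  define t where "t = 1 / sqrt \<epsilon>"
  have t1: "1 \<le> t" using assms by (simp add: t_def)
  have t2: "1 / \<epsilon> = t\<^sup>2" using assms by (simp add: t_def power_divide)
  have tau: "\<tau> = 16 * real L * t ^ 3"
    using assms(1) t2 by (simp add: \<tau>_def t_def power3_eq_cube power2_eq_square field_simps)
  have "1 \<le> t ^ 3" using t1 by simp
  then have "16 * real 2 * 1 \<le> 16 * real L * t ^ 3" using assms(3) by (intro mult_mono) auto
  then show "3 \<le> \<tau>" unfolding tau by simp
  have "ln 2 \<le> ln (real L)" using assms(3) by simp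
  then have L: "2 / 3 \<le> ln (real L)" "ln 2 \<le> ln (real L)" using ln2_ge_two_thirds by linarith+
  have "ln (16::real) = ln (2 ^ 4)" by simp
  also have "\<dots> = 4 * ln 2" using ln_realpow[of 2 4] by (simp del: ln_realpow)
  finally have ln16: "ln (16::real) = 4 * ln 2" .
  have "0 < t" "0 < real L" using t1 assms(3) by auto
  then have "ln \<tau> = ln 16 + ln L + 3 * ln t"
  proof -
    have "ln \<tau> = ln (16 * real L) + ln (t ^ 3)"
      unfolding tau using \<open>0 < t\<close> \<open>0 < real L\<close> ln_mult_pos[of "16 * real L" "t ^ 3"]
      by (metis mult_pos_pos zero_less_numeral zero_less_power)
    also have "ln (16 * real L) = ln 16 + ln (real L)" using ln_mult_pos[of 16 "real L"] \<open>0 < real L\<close> by linarith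
    also have "ln (t ^ 3) = 3 * ln t" using ln_realpow[of t 3] by (simp del: ln_realpow)
    finally show ?thesis .
  qed
  also have "\<dots> \<le> 4 * ln L + ln L + 3 * (t - 1)"
    using ln16 L ln_le_minus_one[of t] \<open>0 < t\<close> by simp
  also have "3 * (t - 1) \<le> (5 * ln L) * (t - 1)" using L t1 by (intro mult_right_mono) auto
  finally have "ln \<tau> \<le> 5 * t * ln L" by (simp add: algebra_simps)
  then have "\<tau> * ln \<tau> \<le> \<tau> * (5 * t * ln L)"
    using \<open>3 \<le> \<tau>\<close> by (intro mult_left_mono) auto
  also have "\<dots> = 80 * (t\<^sup>2)\<^sup>2 * L * ln L" unfolding tau by (simp add: power2_eq_square power3_eq_cube)
  also have "(t\<^sup>2)\<^sup>2 = 1 / \<epsilon>\<^sup>2" unfolding t2[symmetric] by (simp add: power_divide)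
  finally show "\<tau> * ln \<tau> \<le> 80 * (1 / \<epsilon>\<^sup>2) * L * ln L" .
qed

text \<open>The division by 16 is repeated as long as at least \<open>k\<close> remains; stopping
  just before undershooting costs a factor below 16.\<close>

lemma exists_scale_exponent:
  fixes k n :: nat
  assumes "0 < k" "k \<le> n"
  obtains s where "k \<le> n div 16 ^ s" "n div 16 ^ s < 16 * k"
proof -
  define s where "s = (LEAST s. n div 16 ^ Suc s < k)"
  have "n < 16 ^ Suc n" using power_gt_expt[of 16 "Suc n"] by linarith
  then have "n div 16 ^ Suc n < k" using assms(1) by simp
  then have "n div 16 ^ Suc s < k" unfolding s_def by (rule LeastI)
  moreover have "n div 16 ^ Suc s = n div 16 ^ s div 16" by (metis div_mult2_eq power_Suc2)
  ultimately have "n div 16 ^ s < 16 * k" by linarith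
  moreover have "k \<le> n div 16 ^ s"
  proof (cases s)
    case (Suc s')
    then show ?thesis using not_less_Least[of s' "\<lambda>s. n div 16 ^ Suc s < k"] by (simp add: s_def)
  qed (use assms(2) in simp)
  ultimately show ?thesis using that by blast
qed

text \<open>\<open>best\<close> is the guarantee of the search: one chain for each \<open>h\<close>,
  to be matched only if its result hits everything. The proof uses just one value
  \<open>h = 2 ^ s\<close>, where \<open>s\<close> depends on \<open>d\<close> and
  \<open>L\<close>.\<close>

lemma coreset_size_bound_if_chain:
  assumes "Metric_space {..<n} \<delta>" "P \<subseteq> {..<n}" "P \<noteq> {}" "0 < \<epsilon>" "\<epsilon> < 1"
  defines "G \<equiv> near_furthest \<delta> P \<epsilon>"
  assumes "card Q \<le> n"
    and best: "\<And>h. 0 < h \<Longrightarrow> h \<le> n \<Longrightarrow>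
      \<exists>C. chain G n P n h C \<and> ((\<forall>v<n. \<exists>p\<in>C. G v p) \<longrightarrow> card Q \<le> card C)"
  shows "coreset_size_bound 4000000 {..<n} \<delta> \<epsilon> Q"
  unfolding coreset_size_bound_def
proof (intro impI allI)
  assume "\<exists>x\<in>{..<n}. \<exists>y\<in>{..<n}. x \<noteq> y"
  then obtain x y where xy: "x \<in> {..<n}" "y \<in> {..<n}" "x \<noteq> y" by blast
  fix d L assume vc: "vc_dimension {..<n} (ball_family {..<n} \<delta>) = enat d"
    and ci: "comatching_index {..<n} \<delta> (\<epsilon>\<^sup>2 / 4) = enat L"
  interpret Metric_space "{..<n}" \<delta> by fact
  have d: "1 \<le> d" by (rule vc_dimension_balls_ge_1[OF xy vc])
  have "\<epsilon>\<^sup>2 < 1" using assms(4,5) by (simp add: power_less_one_iff)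
  then have L: "2 \<le> L" using assms(4) by (intro comatching_index_ge_2[OF xy _ _ ci]) auto
  define \<tau> where "\<tau> = 16 * real L / (\<epsilon> * sqrt \<epsilon>)"
  have tau: "3 \<le> \<tau>" "\<tau> * ln \<tau> \<le> 80 * (1 / \<epsilon>\<^sup>2) * L * ln L"
    using fractional_bound_times_ln[OF assms(4,5) L] by (simp_all add: \<tau>_def)
  define \<kappa> where "\<kappa> = 1500 * \<tau> * ln \<tau> * real d"
  have "exp 1 \<le> \<tau>" using exp_le tau(1) by linarith
  then have "1 \<le> ln \<tau>" using tau(1) by (simp add: ln_ge_iff)
  then have "1500 * 3 * 1 * 1 \<le> \<kappa>"
    unfolding \<kappa>_def using tau(1) d by (intro mult_mono) auto
  then have kap: "1 \<le> \<kappa>" by simp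
  define k where "k = nat \<lceil>\<kappa>\<rceil>"
  have k: "0 < k" "\<kappa> \<le> k" "k \<le> 2 * \<kappa>" using kap unfolding k_def by linarith+
  \<comment> \<open>If \<open>k\<close> exceeds \<open>n\<close>, the trivial bound
    \<open>card Q \<le> n\<close> is already good enough.\<close>
  have "card Q \<le> 16 * k"
  proof (cases "k \<le> n")
    case True
    obtain s where s: "k \<le> n div 16 ^ s" "n div 16 ^ s < 16 * k"
      using exists_scale_exponent[OF k(1) True] by blast
    have "0 < n div 16 ^ s" using s(1) k(1) by linarith
    then have "16 ^ s \<le> n" by (metis div_less less_numeral_extra(3) not_le)
    moreover have "(2::nat) ^ s \<le> 16 ^ s" by (intro power_mono) auto
    ultimately have "2 ^ s \<le> n" by linarith
    then obtain C where C: "chain G n P n (2 ^ s) C"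
        "(\<forall>v<n. \<exists>p\<in>C. G v p) \<longrightarrow> card Q \<le> card C"
      using best[of "2 ^ s"] by auto
    have finP: "finite P" using assms(2) finite_subset by blast
    have "card P \<le> n" using card_mono[OF _ assms(2)] by simp
    have "fractionally_hit G n P \<tau>"
      using fractionally_hit_near_furthest[OF assms(1-5) ci] L by (simp add: G_def \<tau>_def)
    moreover have "\<tau> \<le> \<tau> * exp (4 / 2 ^ s)"
      using mult_left_mono[of 1 "exp (4 / 2 ^ s)" \<tau>] tau(1) by simp
    ultimately have hit: "fractionally_hit G n P (\<tau> * exp (4 / 2 ^ s))"
      by (rule fractionally_hit_mono)
    have "real k \<le> real (n div 16 ^ s)" using s(1) by simp
    then have "\<kappa> \<le> real (n div 16 ^ s)" using k(2) by linarith
    then have "C \<subseteq> P \<and> card C \<le> n div 16 ^ s \<and> (\<forall>v<n. \<exists>p\<in>C. G v p)"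
      using \<open>card P \<le> n\<close> xy(1) card_shattered_near_furthest_le[OF _ assms(2,5) d vc]
      by (intro chain_hits[OF C(1) order_refl _ finP _ tau(1) d _ _ hit]) (auto simp: \<kappa>_def G_def)
    with C(2) have "card Q \<le> card C" "card C \<le> n div 16 ^ s" by blast+
    then show ?thesis using s(2) by linarith
  qed (use assms(7) in linarith)
  \<comment> \<open>The constants are 16 for the last scale, 2 for rounding \<kappa> up, 1500 from
    \<kappa> and 80 from the bound on \<open>\<tau> * ln \<tau>\<close>; their product 3840000 is
    rounded up.\<close>
  then have "real (card Q) \<le> 16 * (2 * \<kappa>)" using k(3) by linarith
  also have "\<dots> = 48000 * d * (\<tau> * ln \<tau>)" by (simp add: \<kappa>_def)
  also have "\<dots> \<le> 48000 * d * (80 * (1 / \<epsilon>\<^sup>2) * L * ln L)"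
    using tau(2) by (intro mult_left_mono) auto
  also have "\<dots> = 3840000 * (real d * (1 / \<epsilon>\<^sup>2) * real L * ln (real L))" by simp
  also have "\<dots> \<le> 4000000 * (real d * (1 / \<epsilon>\<^sup>2) * real L * ln (real L))"
    using L by (intro mult_right_mono) auto
  also have "\<dots> = 4000000 * real d * (1 / \<epsilon>\<^sup>2) * real L * ln (real L)" by simp
  finally show "real (card Q) \<le> 4000000 * real d * (1 / \<epsilon>\<^sup>2) * real L * ln (real L)" .
qed

section \<open>The program\<close>

definition terminates ::
    "metric_input \<Rightarrow> com \<Rightarrow> nat \<Rightarrow> (memory \<Rightarrow> bool) \<Rightarrow> memory \<Rightarrow> bool" where
  "terminates I c B Q s \<longleftrightarrow> (\<exists>t s'. exec I c s t s' \<and> t \<le> B \<and> Q s')"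

text \<open>Only arrays of naturals are tracked: the program never writes reals and uses them only
  in one test on input distances.\<close>

definition frame :: "nat set \<Rightarrow> memory \<Rightarrow> memory \<Rightarrow> bool" where
  "frame X s s' \<longleftrightarrow> (\<forall>a. a \<notin> X \<longrightarrow> nats s' a = nats s a)"

abbreviation var :: "nat \<Rightarrow> nexp" where
  "var a \<equiv> NGet a (NConst 0)"

definition for_loop :: "nat \<Rightarrow> nexp \<Rightarrow> com \<Rightarrow> com" where
  "for_loop i e c = CSeq (CNAssign i (NConst 0) (NConst 0))
     (CWhile (NLess (var i) e) (CSeq c (CNAssign i (NConst 0) (NAdd (var i) (NConst 1)))))"

lemma nats_nwrite [simp]: "nats (nwrite a i k s) = (nats s)(a := (nats s a)(i := k))"
  by (simp add: nwrite_def)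

lemma frame_refl [simp]: "frame X s s"
  by (simp add: frame_def)

lemma frame_nwrite [simp]: "a \<in> X \<Longrightarrow> frame X s (nwrite a i k s') \<longleftrightarrow> frame X s s'"
  by (auto simp: frame_def)

lemma frame_trans: "frame X s s' \<Longrightarrow> frame Y s' s'' \<Longrightarrow> X \<subseteq> Z \<Longrightarrow> Y \<subseteq> Z \<Longrightarrow> frame Z s s''"
  unfolding frame_def by (metis subsetD)

lemma frameD: "frame X s s' \<Longrightarrow> a \<notin> X \<Longrightarrow> nats s' a = nats s a"
  by (simp add: frame_def)

lemma terminates_mono:
  "terminates I c B Q s \<Longrightarrow> B \<le> B' \<Longrightarrow> (\<And>s'. Q s' \<Longrightarrow> Q' s') \<Longrightarrow> terminates I c B' Q' s"
  unfolding terminates_def by (meson le_trans)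

lemma terminates_skip: "Q s \<Longrightarrow> 1 \<le> B \<Longrightarrow> terminates I CSkip B Q s"
  unfolding terminates_def by (meson exec.Skip)

lemma terminates_assign:
  assumes "1 + ncost I s e + ncost I s f \<le> B" "Q (nwrite a (nval I s e) (nval I s f) s)"
  shows "terminates I (CNAssign a e f) B Q s"
  unfolding terminates_def using assms by (meson exec.NAssign)

text \<open>Nesting makes the postcondition of \<open>c\<close> the precondition of
  \<open>c'\<close>, as with weakest preconditions, while the budgets stay independent of the
  state.\<close>

lemma terminates_seq:
  assumes "terminates I c B (terminates I c' B' Q) s"
  shows "terminates I (CSeq c c') (B + B') Q s"
  using assms unfolding terminates_def by (meson add_mono exec.Seq)

lemma terminates_if:
  assumes "1 + bcost I s b \<le> K"
    and "bval I s b \<Longrightarrow> terminates I c B Q s" "\<not> bval I s b \<Longrightarrow> terminates I c' B Q s"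
  shows "terminates I (CIf b c c') (K + B) Q s"
proof (cases "bval I s b")
  case True
  then obtain t s' where "exec I c s t s'" "t \<le> B" "Q s'"
    using assms(2) unfolding terminates_def by blast
  then show ?thesis unfolding terminates_def
    using exec.IfTrue[OF True] assms(1) by (intro exI conjI) (assumption | simp)+
next
  case False
  then obtain t s' where "exec I c' s t s'" "t \<le> B" "Q s'"
    using assms(3) unfolding terminates_def by blast
  then show ?thesis unfolding terminates_def
    using exec.IfFalse[OF False] assms(1) by (intro exI conjI) (assumption | simp)+
qed

lemma terminates_while:
  fixes m :: "memory \<Rightarrow> nat"
  assumes "Inv s" "m s \<le> N"
    and "\<And>s. Inv s \<Longrightarrow> 1 + bcost I s b \<le> K"
    and "\<And>s. Inv s \<Longrightarrow> bval I s b \<Longrightarrow> 0 < m s \<and> terminates I c B (\<lambda>s'. Inv s' \<and> m s' < m s) s"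
    and "\<And>s. Inv s \<Longrightarrow> \<not> bval I s b \<Longrightarrow> Q s"
  shows "terminates I (CWhile b c) (N * (B + K) + K) Q s"
  using assms(1,2)
proof (induction N arbitrary: s)
  case 0
  then have "\<not> bval I s b" using assms(4) by fastforce
  then show ?case unfolding terminates_def
    using exec.WhileFalse[of I s b c] assms(3)[OF 0(1)] assms(5)[OF 0(1)] by auto
next
  case (Suc N)
  show ?case
  proof (cases "bval I s b")
    case True
    then obtain t s' where body: "exec I c s t s'" "t \<le> B" "Inv s'" "m s' < m s"
      using assms(4)[OF Suc.prems(1)] unfolding terminates_def by blast
    then have "m s' \<le> N" using Suc.prems(2) by linarith
    then obtain t' s'' where rest: "exec I (CWhile b c) s' t' s''" "t' \<le> N * (B + K) + K" "Q s''"
      using Suc.IH[OF body(3)] unfolding terminates_def by blast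
    have "1 + bcost I s b + t + t' \<le> Suc N * (B + K) + K"
      using assms(3)[OF Suc.prems(1)] body(2) rest(2) by simp
    then show ?thesis unfolding terminates_def
      using exec.WhileTrue[OF True body(1) rest(1)] rest(3) by blast
  next
    case False
    have "1 + bcost I s b \<le> Suc N * (B + K) + K" using assms(3)[OF Suc.prems(1)] by simp
    then show ?thesis unfolding terminates_def
      using exec.WhileFalse[OF False, of c] assms(5)[OF Suc.prems(1) False] by blast
  qed
qed

text \<open>The invariant is demanded after the counter has been written, so it may mention the
  counter. Charging for \<open>N'\<close> rounds instead of the actual \<open>N\<close> lets loops
  of varying length share one cost. The bound 12 on \<open>K\<close> covers a test as well as an
  increment of the counter.\<close>

lemma terminates_for:
  assumes "Inv 0 (nwrite i 0 0 s)" "12 \<le> K" "N \<le> N'"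
    and "\<And>k s. k \<le> N \<Longrightarrow> Inv k s \<Longrightarrow> nval I s e = N \<and> ncost I s e \<le> 2"
    and "\<And>k s. k < N \<Longrightarrow> nats s i 0 = k \<Longrightarrow> Inv k s \<Longrightarrow>
      terminates I c B (\<lambda>s'. nats s' i 0 = k \<and> Inv (Suc k) (nwrite i 0 (Suc k) s')) s"
    and "\<And>s. Inv N s \<Longrightarrow> Q s"
  shows "terminates I (for_loop i e c) (K + (N' * (B + K + K) + K)) Q s"
  unfolding for_loop_def
proof (intro terminates_seq terminates_assign)
  let ?Inv = "\<lambda>s. nats s i 0 \<le> N \<and> Inv (nats s i 0) s"
  show "terminates I (CWhile (NLess (var i) e)
          (CSeq c (CNAssign i (NConst 0) (NAdd (var i) (NConst 1)))))
          (N' * (B + K + K) + K) Q (nwrite i (nval I s (NConst 0)) (nval I s (NConst 0)) s)"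
  proof (rule terminates_while[where Inv = ?Inv and m = "\<lambda>s. N - nats s i 0"])
    fix s assume s: "?Inv s"
    then have e: "nval I s e = N" "ncost I s e \<le> 2" using assms(4) by auto
    show "1 + bcost I s (NLess (var i) e) \<le> K" using e(2) assms(2) by simp
    show "Q s" if "\<not> bval I s (NLess (var i) e)"
    proof (rule assms(6))
      have "nats s i 0 = N" using that e(1) s by simp
      with s show "Inv N s" by metis
    qed
    assume "bval I s (NLess (var i) e)"
    then have lt: "nats s i 0 < N" using e(1) by simp
    have "terminates I c B (\<lambda>s'. nats s' i 0 = nats s i 0
        \<and> Inv (Suc (nats s i 0)) (nwrite i 0 (Suc (nats s i 0)) s')) s"
      using assms(5)[OF lt refl] s by blast
    then have "terminates I c B (terminates I (CNAssign i (NConst 0) (NAdd (var i) (NConst 1))) K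
        (\<lambda>s'. ?Inv s' \<and> N - nats s' i 0 < N - nats s i 0)) s"
      by (rule terminates_mono) (use lt assms(2) in \<open>auto intro!: terminates_assign\<close>)
    then show "0 < N - nats s i 0 \<and> terminates I
        (CSeq c (CNAssign i (NConst 0) (NAdd (var i) (NConst 1)))) (B + K)
        (\<lambda>s'. ?Inv s' \<and> N - nats s' i 0 < N - nats s i 0) s"
      using lt by (intro conjI terminates_seq) auto
  qed (use assms(1,3) in auto)
qed (use assms(2) in simp)

section \<open>Bit lengths, cost units and memory layout\<close>

lemma floorlog_le_square:
  assumes "x \<le> n ^ Suc n"
  shows "floorlog 2 x \<le> (n + 1)\<^sup>2"
proof (cases "x = 0")
  case False
  have "n ^ Suc n \<le> (2 ^ n) ^ Suc n" by (intro power_mono) (simp_all add: less_imp_le)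
  also have "\<dots> = 2 ^ (n * Suc n)" by (simp only: power_mult)
  also have "\<dots> < 2 ^ (n + 1)\<^sup>2" by (intro power_strict_increasing) (auto simp: power2_eq_square)
  finally have "x < 2 ^ (n + 1)\<^sup>2" using assms by linarith
  then show ?thesis using False
    by (metis floorlog_leD floorlog_leI one_less_numeral_iff semiring_norm(76) of_nat_less_iff of_nat_numeral of_nat_power le0)
qed (simp add: floorlog_def)

text \<open>A common budget for every single assignment or test of the program. None contains more
  than four products, each at most \<open>n ^ Suc n\<close> and thus of at most
  \<open>(n + 1)\<^sup>2\<close> bits; 60 covers the unit costs.\<close>

definition op_cost :: "nat \<Rightarrow> nat" where
  "op_cost n = 4 * (n + 1)\<^sup>2 + 60"

definition loop_cost :: "nat \<Rightarrow> nat \<Rightarrow> nat" where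
  "loop_cost n B = op_cost n + (n * (B + op_cost n + op_cost n) + op_cost n)"

text \<open>Entries are exactly 0 or 1, so that adding them up counts the set.\<close>

definition marks :: "memory \<Rightarrow> nat \<Rightarrow> nat \<Rightarrow> nat set \<Rightarrow> bool" where
  "marks s a n A \<longleftrightarrow> (\<forall>p<n. nats s a p = of_bool (p \<in> A))"

definition table :: "memory \<Rightarrow> nat \<Rightarrow> (nat \<Rightarrow> nat \<Rightarrow> bool) \<Rightarrow> bool" where
  "table s n G \<longleftrightarrow> (\<forall>v<n. \<forall>p<n. nats s 1 (v * n + p) = of_bool (G v p))"

abbreviation cell :: "nexp \<Rightarrow> nexp \<Rightarrow> nexp" where
  "cell v p \<equiv> NGet 1 (NAdd (NMul v NPoints) p)"

text \<open>Array 1 is the table of the set system (row \<open>v\<close>, column \<open>p\<close>), arrays 2 and 3 mark the current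
  and the next ground set, array 4 holds the weights. Scalars, at index 0: loop counters 5 (\<open>v\<close>),
  6 (\<open>p\<close>), 7, 12 (\<open>t\<close>), 15; a flag 8; a sum 9; the best load 10 and its point 11; the sample size
  13 (\<open>T\<close>); the inverse learning rate 14 (\<open>h\<close>); the size of the best set so far 16.\<close>

definition load_com :: com where
  "load_com = CSeq (CNAssign 9 (NConst 0) (NConst 0)) (for_loop 5 NPoints
     (CNAssign 9 (NConst 0)
       (NAdd (var 9) (NMul (NGet 4 (var 5)) (cell (var 5) (var 6))))))"

text \<open>A final best load of 0 signals a stall; the point in array 11 is meaningful only for a
  positive load.\<close>

definition pick_com :: com where
  "pick_com = CSeq (CNAssign 10 (NConst 0) (NConst 0)) (for_loop 6 NPoints
     (CIf (NLess (NConst 0) (NGet 2 (var 6)))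
       (CSeq load_com
         (CIf (NLess (var 10) (var 9))
           (CSeq (CNAssign 10 (NConst 0) (var 9)) (CNAssign 11 (NConst 0) (var 6)))
           CSkip))
       CSkip))"

definition update_com :: com where
  "update_com = for_loop 5 NPoints
     (CNAssign 4 (var 5) (NMul (NGet 4 (var 5)) (NSub (var 14) (cell (var 5) (var 11)))))"

definition step_com :: com where
  "step_com = CSeq pick_com
     (CIf (NLess (NConst 0) (var 10))
       (CSeq (CNAssign 3 (var 11) (NConst 1)) update_com)
       CSkip)"

text \<open>Naturals have no equality test; two table entries differ iff the sum of their two
  truncated differences is positive.\<close>

definition first_com :: com where
  "first_com = for_loop 5 NPoints
     (CSeq (CNAssign 4 (var 5) (NConst 1)) (for_loop 7 (var 5)
       (CSeq (CNAssign 8 (NConst 0) (NConst 1))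
       (CSeq (for_loop 6 NPoints
          (CIf (BAnd (NLess (NConst 0) (NGet 2 (var 6)))
             (NLess (NConst 0) (NAdd (NSub (cell (var 5) (var 6)) (cell (var 7) (var 6)))
                                     (NSub (cell (var 7) (var 6)) (cell (var 5) (var 6))))))
            (CNAssign 8 (NConst 0) (NConst 0)) CSkip))
         (CIf (NLess (NConst 0) (var 8)) (CNAssign 4 (var 5) (NConst 0)) CSkip)))))"

definition fill_com :: "nat \<Rightarrow> nexp \<Rightarrow> com" where
  "fill_com a e = for_loop 6 NPoints (CNAssign a (var 6) e)"

definition mw_com :: com where
  "mw_com = CSeq first_com (CSeq (fill_com 3 (NConst 0)) (for_loop 12 (var 13) step_com))"

definition stage_com :: com where
  "stage_com = CSeq mw_com (CSeq (fill_com 2 (NGet 3 (var 6)))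
     (CSeq (CNAssign 13 (NConst 0) (NDiv (var 13) (NConst 16)))
           (CNAssign 14 (NConst 0) (NDiv (var 14) (NConst 2)))))"

definition chain_com :: com where
  "chain_com = CWhile (NLess (NConst 0) (var 14)) stage_com"

definition check_com :: com where
  "check_com = CSeq (CNAssign 8 (NConst 0) (NConst 1)) (for_loop 5 NPoints
     (CSeq (CNAssign 9 (NConst 0) (NConst 0))
     (CSeq (for_loop 6 NPoints
        (CIf (BAnd (NLess (NConst 0) (NGet 2 (var 6))) (NLess (NConst 0) (cell (var 5) (var 6))))
          (CNAssign 9 (NConst 0) (NConst 1)) CSkip))
       (CIf (NLess (NConst 0) (var 9)) CSkip (CNAssign 8 (NConst 0) (NConst 0))))))"

definition count_com :: com where
  "count_com = CSeq (CNAssign 9 (NConst 0) (NConst 0)) (for_loop 6 NPoints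
     (CNAssign 9 (NConst 0) (NAdd (var 9) (NGet 2 (var 6)))))"

definition candidate_com :: com where
  "candidate_com = CSeq (CNAssign 14 (NConst 0) (NAdd (var 15) (NConst 1)))
     (CSeq (CNAssign 13 (NConst 0) NPoints)
     (CSeq (fill_com 2 (NInP (var 6)))
     (CSeq chain_com (CSeq check_com (CSeq count_com
       (CIf (BAnd (NLess (NConst 0) (var 8)) (NLess (var 9) (var 16)))
         (CSeq (CNAssign 16 (NConst 0) (var 9)) (fill_com 0 (NGet 2 (var 6))))
         CSkip))))))"

text \<open>An entry starts as membership in \<open>P\<close> and is cleared when some member of
  \<open>P\<close> is too much further away. As reals can be multiplied by \<epsilon> only,
  \<open>(1 - \<epsilon>) * x\<close> appears as \<open>x - \<epsilon> * x\<close>.\<close>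

definition table_com :: com where
  "table_com = for_loop 5 NPoints (for_loop 6 NPoints
     (CSeq (CNAssign 1 (NAdd (NMul (var 5) NPoints) (var 6)) (NInP (var 6)))
       (for_loop 7 NPoints
         (CIf (BAnd (NLess (NConst 0) (NInP (var 7)))
                (RLess (RDist (var 5) (var 6))
                  (RSub (RDist (var 5) (var 7)) (RMulEps (RDist (var 5) (var 7))))))
           (CNAssign 1 (NAdd (NMul (var 5) NPoints) (var 6)) (NConst 0))
           CSkip))))"

text \<open>The first candidate is \<open>P\<close> itself with the crude size \<open>n\<close>, so
  the output is a coreset even if no chain hits everything.\<close>

definition coreset_com :: com where
  "coreset_com = CSeq table_com (CSeq (fill_com 0 (NInP (var 6)))
     (CSeq (CNAssign 16 (NConst 0) NPoints) (for_loop 15 NPoints candidate_com)))"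

text \<open>The cost expressions mirror the nesting of the commands, so that the rules for
  sequences, tests and loops produce them literally; only their growth matters in the end.\<close>

definition step_cost :: "nat \<Rightarrow> nat" where
  "step_cost n = op_cost n + loop_cost n (op_cost n + (op_cost n + loop_cost n (op_cost n) + (op_cost n + (op_cost n + op_cost n)))) + (op_cost n + (op_cost n + loop_cost n (op_cost n)))"

definition first_cost :: "nat \<Rightarrow> nat" where
  "first_cost n = loop_cost n (op_cost n + loop_cost n (op_cost n + (loop_cost n (op_cost n + op_cost n) + (op_cost n + op_cost n))))"

definition mw_cost :: "nat \<Rightarrow> nat" where
  "mw_cost n = (first_cost n) + (loop_cost n (op_cost n) + loop_cost n (step_cost n))"

definition chain_cost :: "nat \<Rightarrow> nat" where
  "chain_cost n = n * ((mw_cost n) + (loop_cost n (op_cost n) + (op_cost n + op_cost n)) + op_cost n) + op_cost n"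

definition check_cost :: "nat \<Rightarrow> nat" where
  "check_cost n = op_cost n + loop_cost n (op_cost n + (loop_cost n (op_cost n + op_cost n)
     + (op_cost n + op_cost n)))"

definition candidate_cost :: "nat \<Rightarrow> nat" where
  "candidate_cost n = op_cost n + (op_cost n + (loop_cost n (op_cost n) + (chain_cost n
     + (check_cost n + (op_cost n + loop_cost n (op_cost n)
     + (op_cost n + (op_cost n + loop_cost n (op_cost n))))))))"

definition table_cost :: "nat \<Rightarrow> nat" where
  "table_cost n = loop_cost n (loop_cost n (op_cost n + loop_cost n (op_cost n + op_cost n)))"

definition coreset_cost :: "nat \<Rightarrow> nat" where
  "coreset_cost n = table_cost n
     + (loop_cost n (op_cost n) + (op_cost n + loop_cost n (candidate_cost n)))"

section \<open>Correctness and cost of the commands\<close>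

locale program =
  fixes I :: metric_input and n :: nat
  assumes points_I [simp]: "points I = n" and n_pos: "0 < n"
begin

abbreviation K :: nat where "K \<equiv> op_cost n"

lemma K_ge: "60 \<le> K" by (simp add: op_cost_def)

lemma floorlog_index: "v < n \<Longrightarrow> floorlog 2 (v * n) \<le> (n + 1)\<^sup>2"
proof (rule floorlog_le_square)
  assume "v < n"
  then have "v * n \<le> n ^ 2" by (simp add: power2_eq_square)
  also have "\<dots> \<le> n ^ Suc n" using n_pos by (intro power_increasing) auto
  finally show "v * n \<le> n ^ Suc n" .
qed

lemma terminates_for_points:
  assumes "Inv 0 (nwrite i 0 0 s)"
    and "\<And>k s. k < n \<Longrightarrow> nats s i 0 = k \<Longrightarrow> Inv k s \<Longrightarrow>
      terminates I c B (\<lambda>s'. nats s' i 0 = k \<and> Inv (Suc k) (nwrite i 0 (Suc k) s')) s"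
    and "\<And>s. Inv n s \<Longrightarrow> Q s"
  shows "terminates I (for_loop i NPoints c) (loop_cost n B) Q s"
  unfolding loop_cost_def using K_ge
  by (intro terminates_for[where Inv = Inv and N = n] assms) auto

lemma load_com:
  assumes "table s n G" "\<forall>v<n. nats s 4 v \<le> n ^ n" "nats s 6 0 < n"
  shows "terminates I load_com (K + loop_cost n K)
    (\<lambda>s'. frame {5, 9} s s' \<and> nats s' 9 0 = load G n (nats s 4) (nats s 6 0)) s"
  unfolding load_com_def
proof (intro terminates_seq terminates_assign)
  let ?p = "nats s 6 0"
  let ?Inv = "\<lambda>k s'. frame {5, 9} s s' \<and> nats s' 9 0 = (\<Sum>v<k. nats s 4 v * of_bool (G v ?p))"
  let ?s = "nwrite 9 (nval I s (NConst 0)) (nval I s (NConst 0)) s"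
  show "terminates I (for_loop 5 NPoints (CNAssign 9 (NConst 0)
      (NAdd (var 9) (NMul (NGet 4 (var 5)) (cell (var 5) (var 6)))))) (loop_cost n K)
      (\<lambda>s'. frame {5, 9} s s' \<and> nats s' 9 0 = load G n (nats s 4) ?p) ?s"
  proof (rule terminates_for_points[where Inv = ?Inv])
    fix k s' assume k: "k < n" "nats s' 5 0 = k" "?Inv k s'"
    have eqs: "nats s' 4 = nats s 4" "nats s' 6 = nats s 6" "nats s' 1 = nats s 1"
      using k(3) by (auto intro: frameD)
    have G: "nats s 1 (k * n + ?p) = of_bool (G k ?p)" using assms(1,3) k(1) by (simp add: table_def)
    have "nats s 4 k * of_bool (G k ?p) \<le> n ^ n * n"
      using assms(2) k(1) n_pos by (intro mult_mono) auto
    then have fl: "floorlog 2 (nats s 4 k * of_bool (G k ?p)) \<le> (n + 1)\<^sup>2"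
      by (intro floorlog_le_square) (simp add: mult.commute)
    show "terminates I (CNAssign 9 (NConst 0)
        (NAdd (var 9) (NMul (NGet 4 (var 5)) (cell (var 5) (var 6))))) K
        (\<lambda>s'. nats s' 5 0 = k \<and> ?Inv (Suc k) (nwrite 5 0 (Suc k) s')) s'"
      using k eqs G fl floorlog_index[OF k(1)]
      by (intro terminates_assign) (auto simp: op_cost_def)
  qed (auto simp: load_def)
qed (use K_ge in simp)

lemma pick_com:
  assumes "table s n G" "\<forall>v<n. nats s 4 v \<le> n ^ n" "marks s 2 n A" "A \<subseteq> {..<n}"
  shows "terminates I pick_com (K + loop_cost n (K + (K + loop_cost n K + (K + (K + K)))))
    (\<lambda>s'. frame {5, 6, 9, 10, 11} s s' \<and> (\<forall>q\<in>A. load G n (nats s 4) q \<le> nats s' 10 0) \<and>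
       (0 < nats s' 10 0 \<longrightarrow> nats s' 11 0 \<in> A \<and> nats s' 10 0 = load G n (nats s 4) (nats s' 11 0))) s"
  unfolding pick_com_def
proof (intro terminates_seq terminates_assign)
  let ?l = "load G n (nats s 4)"
  let ?Inv = "\<lambda>k s'. frame {5, 6, 9, 10, 11} s s' \<and> (\<forall>q\<in>A. q < k \<longrightarrow> ?l q \<le> nats s' 10 0) \<and>
       (0 < nats s' 10 0 \<longrightarrow> nats s' 11 0 \<in> A \<and> nats s' 10 0 = ?l (nats s' 11 0))"
  show "terminates I (for_loop 6 NPoints
      (CIf (NLess (NConst 0) (NGet 2 (var 6)))
       (CSeq load_com
         (CIf (NLess (var 10) (var 9))
           (CSeq (CNAssign 10 (NConst 0) (var 9)) (CNAssign 11 (NConst 0) (var 6)))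
           CSkip))
       CSkip)) (loop_cost n (K + (K + loop_cost n K + (K + (K + K)))))
    (\<lambda>s'. frame {5, 6, 9, 10, 11} s s' \<and> (\<forall>q\<in>A. ?l q \<le> nats s' 10 0) \<and>
       (0 < nats s' 10 0 \<longrightarrow> nats s' 11 0 \<in> A \<and> nats s' 10 0 = ?l (nats s' 11 0)))
    (nwrite 10 (nval I s (NConst 0)) (nval I s (NConst 0)) s)"
  proof (rule terminates_for_points[where Inv = ?Inv], goal_cases)
    case (2 k s')
    have eqs: "nats s' 4 = nats s 4" "nats s' 2 = nats s 2" "nats s' 1 = nats s 1"
      using 2(3) by (auto intro: frameD)
    have A: "nats s' 2 k = of_bool (k \<in> A)" using assms(3) 2(1) eqs by (simp add: marks_def)
    show ?case
    proof (rule terminates_if)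
      assume "bval I s' (NLess (NConst 0) (NGet 2 (var 6)))"
      then have kA: "k \<in> A" using A 2(2) by (auto split: if_splits)
      have "terminates I load_com (K + loop_cost n K)
          (\<lambda>s''. frame {5, 9} s' s'' \<and> nats s'' 9 0 = ?l k) s'"
        using load_com[of s' G] assms(1,2) eqs 2 by (simp add: table_def)
      then show "terminates I (CSeq load_com
         (CIf (NLess (var 10) (var 9))
           (CSeq (CNAssign 10 (NConst 0) (var 9)) (CNAssign 11 (NConst 0) (var 6)))
           CSkip)) (K + loop_cost n K + (K + (K + K)))
        (\<lambda>s''. nats s'' 6 0 = k \<and> ?Inv (Suc k) (nwrite 6 0 (Suc k) s'')) s'"
      proof (intro terminates_seq, elim terminates_mono)
        fix s'' assume s'': "frame {5, 9} s' s'' \<and> nats s'' 9 0 = ?l k"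
        have eqs': "nats s'' 6 = nats s' 6" "nats s'' 10 = nats s' 10" "nats s'' 11 = nats s' 11"
          using s'' by (auto intro: frameD)
        have fr: "frame {5, 6, 9, 10, 11} s s''"
          using 2(3) s'' by (auto intro: frame_trans)
        show "terminates I (CIf (NLess (var 10) (var 9))
           (CSeq (CNAssign 10 (NConst 0) (var 9)) (CNAssign 11 (NConst 0) (var 6)))
           CSkip) (K + (K + K)) (\<lambda>s''. nats s'' 6 0 = k \<and> ?Inv (Suc k) (nwrite 6 0 (Suc k) s'')) s''"
          using 2 K_ge fr kA s'' eqs'
          by (intro terminates_if terminates_seq terminates_assign terminates_skip)
            (auto simp: less_Suc_eq intro: order_trans less_imp_le)
      qed simp
    next
      assume "\<not> bval I s' (NLess (NConst 0) (NGet 2 (var 6)))"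
      then have "k \<notin> A" using A 2(2) by auto
      then show "terminates I CSkip (K + loop_cost n K + (K + (K + K)))
        (\<lambda>s''. nats s'' 6 0 = k \<and> ?Inv (Suc k) (nwrite 6 0 (Suc k) s'')) s'"
        using 2 K_ge by (intro terminates_skip) (auto simp: less_Suc_eq)
    qed (use K_ge in simp)
  qed (use assms(4) in auto)
qed (use K_ge in simp)

lemma update_com:
  assumes "table s n G" "\<forall>v<n. nats s 4 v * nats s 14 0 \<le> n ^ Suc n" "nats s 11 0 < n"
  shows "terminates I update_com (loop_cost n K)
    (\<lambda>s'. frame {4, 5} s s' \<and>
       (\<forall>v<n. nats s' 4 v = nats s 4 v * (nats s 14 0 - of_bool (G v (nats s 11 0))))) s"
  unfolding update_com_def
proof (rule terminates_for_points[where Inv = "\<lambda>k s'. frame {4, 5} s s' \<and> (\<forall>v. nats s' 4 v =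
    (if v < k then nats s 4 v * (nats s 14 0 - of_bool (G v (nats s 11 0))) else nats s 4 v))"],
    goal_cases)
  case (2 k s')
  have eqs: "nats s' 11 = nats s 11" "nats s' 14 = nats s 14" "nats s' 1 = nats s 1"
    using 2(3) by (auto intro: frameD)
  have G: "nats s 1 (k * n + nats s 11 0) = of_bool (G k (nats s 11 0))"
    using assms(1,3) 2(1) by (simp add: table_def)
  have "nats s 4 k * (nats s 14 0 - of_bool (G k (nats s 11 0))) \<le> nats s 4 k * nats s 14 0"
    by (intro mult_left_mono) auto
  also have "\<dots> \<le> n ^ Suc n" using assms(2) 2(1) by blast
  finally have fl: "floorlog 2 (nats s 4 k * (nats s 14 0 - of_bool (G k (nats s 11 0)))) \<le> (n + 1)\<^sup>2"
    by (rule floorlog_le_square)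
  show ?case
    using 2 eqs G fl floorlog_index[OF 2(1)]
    by (intro terminates_assign) (auto simp: op_cost_def less_Suc_eq)
qed auto

text \<open>Array 4 is compared with \<open>w\<close> below \<open>n\<close> only, since the weights
  of \<open>mw\<close> are functions on all naturals.\<close>

definition mw_state :: "(nat \<Rightarrow> nat \<Rightarrow> bool) \<Rightarrow> nat set \<Rightarrow> nat \<Rightarrow> nat \<Rightarrow> memory \<Rightarrow> bool" where
  "mw_state G A h t s \<longleftrightarrow>
     (\<exists>w B. mw G n A h t w B \<and> (\<forall>v<n. nats s 4 v = w v) \<and> marks s 3 n B)"

lemma load_cong: "(\<And>v. v < n \<Longrightarrow> w v = w' v) \<Longrightarrow> load G n w p = load G n w' p"
  unfolding load_def by (intro sum.cong) auto

text \<open>The conditions \<open>h \<le> n\<close> and \<open>t < n\<close> bound the weights by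
  \<open>n ^ n\<close> and their products with \<open>h\<close> by \<open>n ^ Suc n\<close>; this
  keeps the multiplications within the budget.\<close>

lemma step_com:
  assumes "table s n G" "marks s 2 n A" "A \<subseteq> {..<n}" "nats s 14 0 = h" "0 < h" "h \<le> n" "t < n"
    and "mw_state G A h t s"
  shows "terminates I step_com (step_cost n)
    (\<lambda>s'. frame {3, 4, 5, 6, 9, 10, 11} s s' \<and> mw_state G A h (Suc t) s') s"
proof -
  obtain w B where w: "mw G n A h t w B" "\<forall>v<n. nats s 4 v = w v" "marks s 3 n B"
    using assms(8) unfolding mw_state_def by blast
  have ht: "h ^ t * h \<le> n ^ Suc t" using assms(6) power_mono[of h n "Suc t"] by (simp add: mult.commute)
  have wh: "nats s 4 v * h \<le> n ^ Suc n" if "v < n" for v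
  proof -
    have "nats s 4 v * h \<le> h ^ t * h"
      using mw_weight_le[OF w(1) assms(5)] w(2) that by (intro mult_right_mono) auto
    also note ht
    also have "n ^ Suc t \<le> n ^ Suc n" using n_pos assms(7) by (intro power_increasing) auto
    finally show ?thesis .
  qed
  have wn: "nats s 4 v \<le> n ^ n" if "v < n" for v
  proof -
    have "nats s 4 v \<le> h ^ t" using mw_weight_le[OF w(1) assms(5)] w(2) that by simp
    also have "\<dots> \<le> n ^ t" using assms(6) by (intro power_mono) auto
    also have "\<dots> \<le> n ^ n" using n_pos assms(7) by (intro power_increasing) auto
    finally show ?thesis .
  qed
  have load: "load G n (nats s 4) = load G n w"
    using w(2) by (intro ext load_cong) auto
  let ?Q = "\<lambda>s'. frame {3, 4, 5, 6, 9, 10, 11} s s' \<and> mw_state G A h (Suc t) s'"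
  show ?thesis unfolding step_com_def step_cost_def
  proof (intro terminates_seq, rule terminates_mono[OF pick_com[OF assms(1) _ assms(2,3)] order_refl])
    fix s' assume s': "frame {5, 6, 9, 10, 11} s s' \<and> (\<forall>q\<in>A. load G n (nats s 4) q \<le> nats s' 10 0) \<and>
       (0 < nats s' 10 0 \<longrightarrow> nats s' 11 0 \<in> A \<and> nats s' 10 0 = load G n (nats s 4) (nats s' 11 0))"
    have eqs: "nats s' 1 = nats s 1" "nats s' 3 = nats s 3" "nats s' 4 = nats s 4" "nats s' 14 = nats s 14"
      using s' by (auto intro: frameD)
    have fr: "frame {3, 4, 5, 6, 9, 10, 11} s s'" using s' by (auto intro: frame_trans)
    show "terminates I (CIf (NLess (NConst 0) (var 10))
       (CSeq (CNAssign 3 (var 11) (NConst 1)) update_com) CSkip) (K + (K + loop_cost n K)) ?Q s'"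
    proof (rule terminates_if)
      assume "bval I s' (NLess (NConst 0) (var 10))"
      then have pos: "0 < nats s' 10 0" by simp
      define p where "p = nats s' 11 0"
      have p: "p \<in> A" "0 < load G n w p" "\<And>q. q \<in> A \<Longrightarrow> load G n w q \<le> load G n w p"
        using s' pos load by (auto simp: p_def)
      have pn: "p < n" using p(1) assms(3) by auto
      let ?s = "nwrite 3 p 1 s'"
      have "terminates I update_com (loop_cost n K) ?Q ?s"
      proof (rule terminates_mono[OF update_com[of ?s G] order_refl])
        show "table ?s n G" using assms(1) eqs by (simp add: table_def)
        show "\<forall>v<n. nats ?s 4 v * nats ?s 14 0 \<le> n ^ Suc n" using wh eqs assms(4) by simp
        show "nats ?s 11 0 < n" using pn by (simp add: p_def)
        fix s'' assume s'': "frame {4, 5} ?s s'' \<and> (\<forall>v<n. nats s'' 4 v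
            = nats ?s 4 v * (nats ?s 14 0 - of_bool (G v (nats ?s 11 0))))"
        have "nats s'' 3 = nats ?s 3" by (rule frameD[of "{4, 5}"]) (use s'' in auto)
        then have "marks s'' 3 n (insert p B)" using w(3) eqs by (auto simp: marks_def)
        moreover have "\<forall>v<n. nats s'' 4 v = w v * (h - of_bool (G v p))"
          using s'' w(2) eqs assms(4) by (simp add: p_def)
        moreover have "frame {3, 4, 5, 6, 9, 10, 11} s ?s" using fr by simp
        ultimately show "?Q s''"
          using mw_pick[OF w(1) p] s'' unfolding mw_state_def by (blast intro: frame_trans)
      qed
      then show "terminates I (CSeq (CNAssign 3 (var 11) (NConst 1)) update_com) (K + loop_cost n K) ?Q s'"
        using K_ge by (intro terminates_seq terminates_assign) (auto simp: p_def)
    next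
      assume "\<not> bval I s' (NLess (NConst 0) (var 10))"
      then have "\<And>q. q \<in> A \<Longrightarrow> load G n w q = 0" using s' load by simp
      then have "mw_state G A h (Suc t) s'"
        using mw_stall[OF w(1)] w(2,3) eqs unfolding mw_state_def marks_def by auto
      then show "terminates I CSkip (K + loop_cost n K) ?Q s'"
        using fr K_ge by (intro terminates_skip) auto
    qed (use K_ge in simp)
  qed (use wn in auto)
qed


text \<open>The expression reads the loop counter, so its value is prescribed in all states that
  differ from \<open>s\<close> in the counter and the target array only.\<close>

lemma fill_com:
  assumes "a \<noteq> 6" "\<And>k s'. k < n \<Longrightarrow> nats s' 6 0 = k \<Longrightarrow> frame {a, 6} s s' \<Longrightarrow>
      nval I s' e = of_bool (k \<in> A) \<and> ncost I s' e \<le> 10"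
  shows "terminates I (fill_com a e) (loop_cost n K)
    (\<lambda>s'. frame {a, 6} s s' \<and> marks s' a n A) s"
  unfolding fill_com_def
proof (rule terminates_for_points[where Inv = "\<lambda>k s'. frame {a, 6} s s' \<and>
    (\<forall>p<k. nats s' a p = of_bool (p \<in> A))"], goal_cases)
  case (2 k s')
  then have "nval I s' e = of_bool (k \<in> A)" "ncost I s' e \<le> 10" using assms(2)[of k s'] by auto
  then show ?case
    using 2 assms(1) K_ge by (intro terminates_assign) (auto simp: less_Suc_eq)
qed (auto simp: marks_def)

lemma first_com:
  assumes "table s n G" "marks s 2 n A" "A \<subseteq> {..<n}"
  shows "terminates I first_com (first_cost n)
    (\<lambda>s'. frame {4, 5, 6, 7, 8} s s' \<and> (\<forall>v<n. nats s' 4 v = of_bool (first_of_trace G A v))) s"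
  unfolding first_com_def first_cost_def
proof (rule terminates_for_points[where Inv = "\<lambda>k s'. frame {4, 5, 6, 7, 8} s s' \<and>
    (\<forall>v<k. nats s' 4 v = of_bool (first_of_trace G A v))"], goal_cases)
  case outer: (2 k s')
  let ?Inv = "\<lambda>j s''. frame {4, 5, 6, 7, 8} s s'' \<and> nats s'' 5 0 = k \<and>
    (\<forall>v<k. nats s'' 4 v = of_bool (first_of_trace G A v)) \<and>
    nats s'' 4 k = of_bool (\<forall>u<j. \<exists>p\<in>A. G u p \<noteq> G k p)"
  show ?case
  proof (intro terminates_seq terminates_assign, goal_cases)
    case 2
    \<comment> \<open>This loop has only \<open>k\<close> rounds; charging for \<open>n\<close>
      makes the cost independent of \<open>k\<close>.\<close>
    show ?case unfolding loop_cost_def[of n "K + (loop_cost n (K + K) + (K + K))"]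
    proof (rule terminates_for[where Inv = ?Inv and N = k], goal_cases)
      case (5 j s'')
      let ?s = "nwrite 8 0 1 s''"
      let ?Q = "\<lambda>s'. nats s' 7 0 = j \<and> ?Inv (Suc j) (nwrite 7 0 (Suc j) s')"
      have jn: "j < n" using 5(1) \<open>k < n\<close> by simp
      have loop: "terminates I (for_loop 6 NPoints
          (CIf (BAnd (NLess (NConst 0) (NGet 2 (var 6)))
             (NLess (NConst 0) (NAdd (NSub (cell (var 5) (var 6)) (cell (var 7) (var 6)))
                                     (NSub (cell (var 7) (var 6)) (cell (var 5) (var 6))))))
            (CNAssign 8 (NConst 0) (NConst 0)) CSkip)) (loop_cost n (K + K))
          (\<lambda>x. frame {6, 8} ?s x \<and> nats x 8 0 = of_bool (\<forall>p\<in>A. G k p = G j p)) ?s"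
      proof (rule terminates_for_points[where Inv = "\<lambda>i x. frame {6, 8} ?s x \<and>
          nats x 8 0 = of_bool (\<forall>p\<in>A. p < i \<longrightarrow> G k p = G j p)"], goal_cases)
        case (2 i x)
        have eqs: "nats x 5 0 = k" "nats x 7 0 = j" "nats x 1 = nats s 1" "nats x 2 = nats s 2"
          using 2(3) 5 frameD[of "{6, 8}" ?s x] frameD[of "{4, 5, 6, 7, 8}" s s''] by auto
        have G: "nats s 1 (k * n + i) = of_bool (G k i)" "nats s 1 (j * n + i) = of_bool (G j i)"
          "nats s 2 i = of_bool (i \<in> A)"
          using assms 2(1) jn \<open>k < n\<close> by (auto simp: table_def marks_def)
        show ?case
        proof (rule terminates_if, goal_cases)
          case 1
          show ?case using eqs 2(2) floorlog_index[OF jn] floorlog_index[OF \<open>k < n\<close>]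
            by (simp add: op_cost_def)
        next
          case 2
          then have "i \<in> A" "G k i \<noteq> G j i" using eqs G \<open>nats x 6 0 = i\<close> by (auto split: if_splits)
          then show ?case using \<open>nats x 6 0 = i\<close> \<open>frame {6, 8} ?s x \<and> _\<close> K_ge
            by (intro terminates_assign) auto
        next
          case 3
          then have "i \<in> A \<longrightarrow> G k i = G j i" using eqs G \<open>nats x 6 0 = i\<close> by auto
          then show ?case using \<open>nats x 6 0 = i\<close> \<open>frame {6, 8} ?s x \<and> _\<close> K_ge
            by (intro terminates_skip) (auto simp: less_Suc_eq)
        qed
      qed (use assms(3) in auto)
      show ?case
      proof (intro terminates_seq terminates_assign, goal_cases)
        case 2
        show ?case
        unfolding nval.simps proof (rule terminates_mono[OF loop order_refl], goal_cases)
          case (1 x)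
          have eqs: "nats x 5 = nats s'' 5" "nats x 7 = nats s'' 7" "nats x 4 = nats s'' 4"
            using 1 frameD[of "{6, 8}" ?s x] by auto
          have fr: "frame {4, 5, 6, 7, 8} s x"
            using 1 5 by (intro frame_trans[of "{4, 5, 6, 7, 8}" s ?s "{6, 8}" x]) auto
          have split: "(\<forall>u<Suc j. \<exists>p\<in>A. G u p \<noteq> G k p) \<longleftrightarrow>
              (\<forall>u<j. \<exists>p\<in>A. G u p \<noteq> G k p) \<and> \<not> (\<forall>p\<in>A. G k p = G j p)"
            by (auto simp: less_Suc_eq)
          show ?case
            using 1 5 eqs fr K_ge unfolding split
            by (intro terminates_if terminates_assign terminates_skip) auto
        qed
      qed (use K_ge in simp)
    next
      case (6 s'')
      then show ?case by (auto simp: less_Suc_eq first_of_trace_def)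
    qed (use outer K_ge in \<open>auto simp: less_imp_le\<close>)
  qed (use K_ge in simp)
qed auto

lemma mw_com:
  assumes "table s n G" "marks s 2 n A" "A \<subseteq> {..<n}" "nats s 14 0 = h" "0 < h" "h \<le> n"
    and "nats s 13 0 = T" "T \<le> n"
  shows "terminates I mw_com (mw_cost n)
    (\<lambda>s'. frame {3..12} s s' \<and> (\<exists>w B. mw G n A h T w B \<and> marks s' 3 n B)) s"
  unfolding mw_com_def mw_cost_def
proof (intro terminates_seq, rule terminates_mono[OF first_com[OF assms(1-3)] order_refl], goal_cases)
  case (1 s1)
  show ?case
  proof (rule terminates_seq, rule terminates_mono[OF fill_com[where A = "{}"] order_refl], goal_cases)
    case (3 s2)
    have fr: "frame {3..12} s s2"
      using 1 3 by (intro frame_trans[of "{4, 5, 6, 7, 8}" s s1 "{3, 6}" s2]) auto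
    have "nats s2 4 = nats s1 4" using 3 by (auto intro: frameD)
    then have init: "mw_state G A h 0 s2"
      using 1 3 mw_init[of G n A h] unfolding mw_state_def
      by (intro exI[of _ "\<lambda>v. of_bool (first_of_trace G A v)"] exI[of _ "{}"]) auto
    show ?case unfolding loop_cost_def[of n "step_cost n"]
    proof (rule terminates_for[where Inv = "\<lambda>t s'. frame {3..12} s s' \<and> mw_state G A h t s'"
          and N = T], goal_cases)
      case (5 t s')
      have eqs: "nats s' 1 = nats s 1" "nats s' 2 = nats s 2" "nats s' 14 = nats s 14"
        using 5 frameD[of "{3..12}" s s'] by auto
      show ?case
      proof (rule terminates_mono[OF step_com[of s' G A h t] order_refl], goal_cases)
        case (9 s'')
        have "nats s'' 12 = nats s' 12" using 9 by (auto intro: frameD)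
        moreover have "frame {3..12} s s''"
          using 5 9 by (intro frame_trans[of "{3..12}" s s' "{3, 4, 5, 6, 9, 10, 11}" s'']) auto
        ultimately show ?case using 5 9 by (auto simp: mw_state_def marks_def)
      qed (use 5 eqs assms in \<open>auto simp: table_def marks_def\<close>)
    next
      case (4 t s')
      then have "nats s' 13 = nats s 13" by (auto intro: frameD)
      then show ?case using assms(7) by simp
    next
      case 1
      then show ?case using fr init by (auto simp: mw_state_def marks_def)
    qed (use assms K_ge in \<open>auto simp: mw_state_def\<close>)
  qed auto
qed

text \<open>The loop runs the outermost stage first, while \<open>chain\<close> nests the remaining
  stages inside it. The invariant therefore says that any chain from the current state completes one
  from the initial state. The value \<open>h\<close> itself is the measure, which bounds the rounds
  by \<open>n\<close>.\<close>

lemma chain_com: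
  assumes "table s n G" "marks s 2 n A" "A \<subseteq> {..<n}" "nats s 14 0 = h" "h \<le> n"
    and "nats s 13 0 = T" "T \<le> n"
  shows "terminates I chain_com (chain_cost n)
    (\<lambda>s'. frame {2..14} s s' \<and> (\<exists>C\<subseteq>A. chain G n A T h C \<and> marks s' 2 n C)) s"
  unfolding chain_com_def chain_cost_def
proof (rule terminates_while[where m = "\<lambda>s. nats s 14 0" and Inv = "\<lambda>s'. frame {2..14} s s' \<and>
    nats s' 14 0 \<le> n \<and> nats s' 13 0 \<le> n \<and> (\<exists>B\<subseteq>A. marks s' 2 n B \<and>
      (\<forall>C. chain G n B (nats s' 13 0) (nats s' 14 0) C \<longrightarrow> chain G n A T h C))"], goal_cases)
  case (4 s')
  let ?Inv = "\<lambda>s'. frame {2..14} s s' \<and>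
    nats s' 14 0 \<le> n \<and> nats s' 13 0 \<le> n \<and> (\<exists>B\<subseteq>A. marks s' 2 n B \<and>
      (\<forall>C. chain G n B (nats s' 13 0) (nats s' 14 0) C \<longrightarrow> chain G n A T h C))"
  obtain B where B: "B \<subseteq> A" "marks s' 2 n B"
      "\<And>C. chain G n B (nats s' 13 0) (nats s' 14 0) C \<Longrightarrow> chain G n A T h C"
    using 4(1) by blast
  have hpos: "0 < nats s' 14 0" using 4(2) by simp
  have "nats s' 1 = nats s 1" using 4(1) by (auto intro: frameD)
  then have tab: "table s' n G" using assms(1) by (simp add: table_def)
  have "terminates I stage_com ((mw_cost n) + (loop_cost n K + (K + K)))
      (\<lambda>s''. ?Inv s'' \<and> nats s'' 14 0 < nats s' 14 0) s'"
    unfolding stage_com_def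
  proof (intro terminates_seq, rule terminates_mono[OF mw_com[of s' G B "nats s' 14 0" "nats s' 13 0"] order_refl], goal_cases)
    case (9 s1)
    then obtain w B' where B': "mw G n B (nats s' 14 0) (nats s' 13 0) w B'" "marks s1 3 n B'" by blast
    have fr1: "frame {2..14} s s1"
      using 4(1) 9 by (intro frame_trans[of "{2..14}" s s' "{3..12}" s1]) auto
    show ?case
    proof (rule terminates_seq, rule terminates_mono[OF fill_com[where A = B'] order_refl], goal_cases)
      case (2 k x)
      then have "nats x 3 = nats s1 3" by (auto intro: frameD)
      then show ?case using 2 B'(2) by (auto simp: marks_def)
    next
      case (3 s2)
      have fr2: "frame {2..14} s s2"
        using fr1 3 by (intro frame_trans[of "{2..14}" s s1 "{2, 6}" s2]) auto
      have eqs: "nats s2 13 = nats s' 13" "nats s2 14 = nats s' 14"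
        using 3 9 frameD[of "{2, 6}" s1 s2] frameD[of "{3..12}" s' s1] by auto
      have "\<exists>B\<subseteq>A. marks s2 2 n B \<and>
        (\<forall>C. chain G n B (nats s' 13 0 div 16) (nats s' 14 0 div 2) C \<longrightarrow> chain G n A T h C)"
      proof (intro exI[of _ B'] conjI allI impI)
        show "B' \<subseteq> A" using mw_subset[OF B'(1)] B(1) by blast
        show "marks s2 2 n B'" using 3 by simp
        fix C assume "chain G n B' (nats s' 13 0 div 16) (nats s' 14 0 div 2) C"
        then show "chain G n A T h C" by (intro B(3) chain_stage[OF hpos B'(1)])
      qed
      moreover have "nats s' 13 0 div 16 \<le> n" "nats s' 14 0 div 2 \<le> n"
        using 4(1) by (meson div_le_dividend le_trans)+
      ultimately show ?case
        using fr2 eqs hpos K_ge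
        by (intro terminates_seq terminates_assign) (auto simp: marks_def)
    qed auto
  qed (use tab B(1,2) assms(3) hpos 4(1) in auto)
  then show ?case using hpos by simp
next
  case (5 s')
  then have "nats s' 14 0 = 0" by simp
  with 5 show ?case using chain_done by metis
qed (use assms K_ge in auto)

lemma check_com:
  assumes "table s n G" "marks s 2 n A" "A \<subseteq> {..<n}"
  shows "terminates I check_com (check_cost n)
    (\<lambda>s'. frame {5, 6, 8, 9} s s' \<and> nats s' 8 0 = of_bool (\<forall>v<n. \<exists>p\<in>A. G v p)) s"
  unfolding check_com_def check_cost_def
proof (intro terminates_seq terminates_assign, goal_cases)
  case 2
  show ?case
  proof (rule terminates_for_points[where Inv = "\<lambda>k s'. frame {5, 6, 8, 9} s s' \<and>
      nats s' 8 0 = of_bool (\<forall>v<k. \<exists>p\<in>A. G v p)"], goal_cases)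
    case (2 k s')
    let ?s = "nwrite 9 0 0 s'"
    have loop: "terminates I (for_loop 6 NPoints
        (CIf (BAnd (NLess (NConst 0) (NGet 2 (var 6))) (NLess (NConst 0) (cell (var 5) (var 6))))
          (CNAssign 9 (NConst 0) (NConst 1)) CSkip)) (loop_cost n (K + K))
        (\<lambda>x. frame {6, 9} ?s x \<and> nats x 9 0 = of_bool (\<exists>p\<in>A. G k p)) ?s"
    proof (rule terminates_for_points[where Inv = "\<lambda>i x. frame {6, 9} ?s x \<and>
        nats x 9 0 = of_bool (\<exists>p\<in>A. p < i \<and> G k p)"], goal_cases)
      case (2 i x)
      have eqs: "nats x 5 0 = k" "nats x 1 = nats s 1" "nats x 2 = nats s 2"
        using 2(3) \<open>nats s' 5 0 = k\<close> \<open>frame _ s s' \<and> _\<close>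
          frameD[of "{6, 9}" ?s x] frameD[of "{5, 6, 8, 9}" s s'] by auto
      have G: "nats s 1 (k * n + i) = of_bool (G k i)" "nats s 2 i = of_bool (i \<in> A)"
        using assms 2(1) \<open>k < n\<close> by (auto simp: table_def marks_def)
      show ?case
      proof (rule terminates_if, goal_cases)
        case 1
        show ?case using eqs 2(2) floorlog_index[OF \<open>k < n\<close>] by (simp add: op_cost_def)
      next
        case 2
        then have "i \<in> A" "G k i" using eqs G \<open>nats x 6 0 = i\<close> by (auto split: if_splits)
        then show ?case using \<open>nats x 6 0 = i\<close> \<open>frame {6, 9} ?s x \<and> _\<close> K_ge
          by (intro terminates_assign) auto
      next
        case 3
        then have "\<not> (i \<in> A \<and> G k i)" using eqs G \<open>nats x 6 0 = i\<close> by auto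
        then show ?case using \<open>nats x 6 0 = i\<close> \<open>frame {6, 9} ?s x \<and> _\<close> K_ge
          by (intro terminates_skip) (auto simp: less_Suc_eq)
      qed
    qed (use assms(3) in auto)
    show ?case
    proof (intro terminates_seq terminates_assign, goal_cases)
      case 2
      show ?case
      unfolding nval.simps proof (rule terminates_mono[OF loop order_refl], goal_cases)
        case (1 x)
        have eqs: "nats x 5 = nats s' 5" "nats x 8 = nats s' 8"
          using 1 frameD[of "{6, 9}" ?s x] by auto
        have fr: "frame {5, 6, 8, 9} s x"
          using 1 \<open>frame _ s s' \<and> _\<close>
          by (intro frame_trans[of "{5, 6, 8, 9}" s ?s "{6, 9}" x]) auto
        have split: "(\<forall>v<Suc k. \<exists>p\<in>A. G v p) \<longleftrightarrow> (\<forall>v<k. \<exists>p\<in>A. G v p) \<and> (\<exists>p\<in>A. G k p)"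
          by (auto simp: less_Suc_eq)
        show ?case
          using 1 \<open>frame _ s s' \<and> _\<close> \<open>nats s' 5 0 = k\<close> eqs fr K_ge unfolding split
          by (intro terminates_if terminates_assign terminates_skip) auto
      qed
    qed (use K_ge in simp)
  qed auto
qed (use K_ge in simp)

lemma count_com:
  assumes "marks s 2 n A" "A \<subseteq> {..<n}"
  shows "terminates I count_com (K + loop_cost n K)
    (\<lambda>s'. frame {6, 9} s s' \<and> nats s' 9 0 = card A) s"
  unfolding count_com_def
proof (intro terminates_seq terminates_assign, goal_cases)
  case 2
  show ?case
  proof (rule terminates_for_points[where Inv = "\<lambda>k s'. frame {6, 9} s s' \<and>
      nats s' 9 0 = card (A \<inter> {..<k})"], goal_cases)
    case (2 k s')
    have "nats s' 2 = nats s 2" using 2(3) by (auto intro: frameD)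
    moreover have "card (A \<inter> {..<Suc k}) = card (A \<inter> {..<k}) + of_bool (k \<in> A)"
      by (simp add: lessThan_Suc Int_insert_right)
    ultimately show ?case using 2 assms(1) K_ge
      by (intro terminates_assign) (auto simp: marks_def)
  qed (use assms(2) in \<open>auto simp: Int_absorb2\<close>)
qed (use K_ge in simp)


text \<open>Array 16 only bounds the size of the stored set from above, since it starts at
  \<open>n\<close>. The last clause is what \<open>coreset_size_bound_if_chain\<close> requires once
  \<open>m = n\<close>.\<close>

definition best_so_far :: "(nat \<Rightarrow> nat \<Rightarrow> bool) \<Rightarrow> nat set \<Rightarrow> nat \<Rightarrow> memory \<Rightarrow> bool" where
  "best_so_far G P m s \<longleftrightarrow> nats s 16 0 \<le> n \<and>
     (\<exists>Q\<subseteq>P. marks s 0 n Q \<and> card Q \<le> nats s 16 0 \<and> (\<forall>v<n. \<exists>p\<in>Q. G v p)) \<and>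
     (\<forall>h. 0 < h \<longrightarrow> h \<le> m \<longrightarrow>
        (\<exists>C. chain G n P n h C \<and> ((\<forall>v<n. \<exists>p\<in>C. G v p) \<longrightarrow> nats s 16 0 \<le> card C)))"

lemma candidate_com:
  assumes "table s n G" "subset_P I \<subseteq> {..<n}" "nats s 15 0 = k" "k < n"
    and "best_so_far G (subset_P I) k s"
  shows "terminates I candidate_com (candidate_cost n)
    (\<lambda>s'. frame ({0, 16} \<union> {2..14}) s s' \<and> best_so_far G (subset_P I) (Suc k) s') s"
  unfolding candidate_com_def candidate_cost_def
proof (intro terminates_seq terminates_assign, goal_cases)
  case 3
  let ?P = "subset_P I" and ?X = "{0, 16} \<union> {2..14::nat}"
  let ?s = "nwrite 13 0 n (nwrite 14 0 (k + 1) s)"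
  have s_eq: "nwrite 13 (nval I (nwrite 14 (nval I s (NConst 0)) (nval I s (NAdd (var 15) (NConst 1))) s) (NConst 0))
      (nval I (nwrite 14 (nval I s (NConst 0)) (nval I s (NAdd (var 15) (NConst 1))) s) NPoints)
      (nwrite 14 (nval I s (NConst 0)) (nval I s (NAdd (var 15) (NConst 1))) s) = ?s"
    using assms(3) by simp
  show ?case unfolding s_eq
  proof (rule terminates_mono[OF fill_com[where A = ?P] order_refl], goal_cases)
    case s2: (3 s2)
    have e2: "nats s2 1 = nats s 1" "nats s2 13 0 = n" "nats s2 14 0 = Suc k"
      using s2 frameD[of "{2, 6}" ?s s2] by auto
    have f2: "frame ?X s s2"
      using s2 by (intro frame_trans[of ?X s ?s "{2, 6}" s2]) auto
    show ?case
    proof (rule terminates_seq, rule terminates_mono[OF chain_com[of s2 G ?P "Suc k" n] order_refl],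
        goal_cases)
      case s3: (8 s3)
      then obtain C where C: "C \<subseteq> ?P" "chain G n ?P n (Suc k) C" "marks s3 2 n C" by blast
      have Cn: "C \<subseteq> {..<n}" using C(1) assms(2) by blast
      have e3: "nats s3 1 = nats s 1" using s3 e2 frameD[of "{2..14}" s2 s3] by auto
      have f3: "frame ?X s s3" using s3 f2 by (intro frame_trans[of ?X s s2 "{2..14}" s3]) auto
      show ?case
      proof (rule terminates_seq, rule terminates_mono[OF check_com[of s3 G C] order_refl], goal_cases)
        case s4: (4 s4)
        have e4: "nats s4 2 = nats s3 2" using s4 frameD[of "{5, 6, 8, 9}" s3 s4] by auto
        have f4: "frame ?X s s4" using s4 f3 by (intro frame_trans[of ?X s s3 "{5, 6, 8, 9}" s4]) auto
        show ?case
        proof (rule terminates_seq, rule terminates_mono[OF count_com[of s4 C] order_refl], goal_cases)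
          case s5: (3 s5)
          have f5: "frame ?X s s5" using s5 f4 by (intro frame_trans[of ?X s s4 "{6, 9}" s5]) auto
          \<comment> \<open>The frame \<open>?X\<close> contains 0 and 16; this finer one shows that
            the stored set and its size survive until the comparison.\<close>
          have f05: "frame ({1..15} - {1, 15}) s s5"
          proof -
            have "frame ({1..15} - {1, 15}) s s2"
              using s2 by (intro frame_trans[of "{13, 14}" s ?s "{2, 6}" s2]) auto
            then have "frame ({1..15} - {1, 15}) s s3"
              using s3 by (intro frame_trans[of "{1..15} - {1, 15}" s s2 "{2..14}" s3]) auto
            then have "frame ({1..15} - {1, 15}) s s4"
              using s4 by (intro frame_trans[of "{1..15} - {1, 15}" s s3 "{5, 6, 8, 9}" s4]) auto
            then show ?thesis
              using s5 by (intro frame_trans[of "{1..15} - {1, 15}" s s4 "{6, 9}" s5]) auto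
          qed
          have e5: "nats s5 0 = nats s 0" "nats s5 16 = nats s 16"
            using frameD[OF f05, of 0] frameD[OF f05, of 16] by auto
          have flag: "nats s5 8 0 = of_bool (\<forall>v<n. \<exists>p\<in>C. G v p)" "nats s5 9 0 = card C"
            "marks s5 2 n C"
            using s4 s5 C(3) e4 frameD[of "{6, 9}" s4 s5] by (auto simp: marks_def)
          note best = assms(5)[unfolded best_so_far_def]
          \<comment> \<open>Shared by both outcomes of the comparison: \<open>Q\<close> is the new
            set or the old one.\<close>
          have upto: "best_so_far G ?P (Suc k) s'"
            if "nats s' 16 0 \<le> nats s 16 0" "(\<forall>v<n. \<exists>p\<in>C. G v p) \<longrightarrow> nats s' 16 0 \<le> card C"
              "Q \<subseteq> ?P" "marks s' 0 n Q" "card Q \<le> nats s' 16 0" "\<forall>v<n. \<exists>p\<in>Q. G v p" for s' Q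
            unfolding best_so_far_def
          proof (intro conjI allI impI)
            show "nats s' 16 0 \<le> n" using that(1) best by linarith
            show "\<exists>Q\<subseteq>?P. marks s' 0 n Q \<and> card Q \<le> nats s' 16 0 \<and> (\<forall>v<n. \<exists>p\<in>Q. G v p)"
              using that(3-6) by blast
            fix h :: nat assume h: "0 < h" "h \<le> Suc k"
            show "\<exists>C. chain G n ?P n h C \<and> ((\<forall>v<n. \<exists>p\<in>C. G v p) \<longrightarrow> nats s' 16 0 \<le> card C)"
            proof (cases "h \<le> k")
              case True
              then obtain C' where "chain G n ?P n h C'"
                  "(\<forall>v<n. \<exists>p\<in>C'. G v p) \<longrightarrow> nats s 16 0 \<le> card C'" using best h(1) by blast
              then show ?thesis using that(1) le_trans by blast
            next
              case False
              then have "h = Suc k" using h(2) by simp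
              then show ?thesis using C(2) that(2) by blast
            qed
          qed
          show ?case
          proof (rule terminates_if)
            assume "bval I s5 (BAnd (NLess (NConst 0) (var 8)) (NLess (var 9) (var 16)))"
            then have new: "\<forall>v<n. \<exists>p\<in>C. G v p" "card C < nats s 16 0"
              using flag e5 by (auto split: if_splits)
            let ?t = "nwrite 16 0 (card C) s5"
            have "terminates I (fill_com 0 (NGet 2 (var 6))) (loop_cost n K)
              (\<lambda>s'. frame {0, 6} ?t s' \<and> marks s' 0 n C) ?t"
            proof (rule fill_com)
              fix i s' assume i: "i < n" "nats s' 6 0 = i" "frame {0, 6} ?t s'"
              then have "nats s' 2 = nats s5 2" using frameD[of "{0, 6}" ?t s'] by auto
              then show "nval I s' (NGet 2 (var 6)) = of_bool (i \<in> C) \<and> ncost I s' (NGet 2 (var 6)) \<le> 10"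
                using i flag(3) by (simp add: marks_def)
            qed simp
            then have "terminates I (fill_com 0 (NGet 2 (var 6))) (loop_cost n K)
              (\<lambda>s'. frame ?X s s' \<and> best_so_far G ?P (Suc k) s') ?t"
            proof (rule terminates_mono[OF _ order_refl], intro conjI)
              fix s' assume s': "frame {0, 6} ?t s' \<and> marks s' 0 n C"
              have "nats s' 16 0 = card C" using s' frameD[of "{0, 6}" ?t s'] by auto
              then show "best_so_far G ?P (Suc k) s'"
                using upto[of s' C] s' new C(1) by simp
              show "frame ?X s s'"
                using f5 s' by (intro frame_trans[of ?X s ?t "{0, 6}" s']) auto
            qed
            then show "terminates I (CSeq (CNAssign 16 (NConst 0) (var 9)) (fill_com 0 (NGet 2 (var 6))))
                (K + loop_cost n K) (\<lambda>s'. frame ?X s s' \<and> best_so_far G ?P (Suc k) s') s5"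
              using flag(2) K_ge by (intro terminates_seq terminates_assign) auto
          next
            assume "\<not> bval I s5 (BAnd (NLess (NConst 0) (var 8)) (NLess (var 9) (var 16)))"
            then have "(\<forall>v<n. \<exists>p\<in>C. G v p) \<longrightarrow> nats s 16 0 \<le> card C"
              using flag e5 by auto
            moreover obtain Q where "Q \<subseteq> ?P" "marks s 0 n Q" "card Q \<le> nats s 16 0"
                "\<forall>v<n. \<exists>p\<in>Q. G v p" using best by blast
            ultimately have "best_so_far G ?P (Suc k) s5"
              using upto[of s5 Q] e5 by (simp add: marks_def)
            then show "terminates I CSkip (K + loop_cost n K)
                (\<lambda>s'. frame ?X s s' \<and> best_so_far G ?P (Suc k) s') s5"
              using f5 K_ge by (intro terminates_skip) auto
          qed (use K_ge in simp)
        qed (use C(3) Cn e4 in \<open>auto simp: marks_def\<close>)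
      qed (use C(3) Cn e3 assms(1) in \<open>auto simp: table_def\<close>)
    qed (use s2 e2 assms in \<open>auto simp: table_def\<close>)
  qed auto
qed (use K_ge in simp_all)

lemma table_com:
  assumes "G = near_furthest (distance I) (subset_P I) (epsilon I)" "subset_P I \<subseteq> {..<n}"
  shows "terminates I table_com (table_cost n) (\<lambda>s'. frame {1, 5, 6, 7} s s' \<and> table s' n G) s"
  unfolding table_com_def table_cost_def
proof (rule terminates_for_points[where Inv = "\<lambda>k s'. frame {1, 5, 6, 7} s s' \<and>
    (\<forall>v<k. \<forall>p<n. nats s' 1 (v * n + p) = of_bool (G v p))"], goal_cases)
  case outer: (2 k s')
  let ?P = "subset_P I" and ?d = "distance I" and ?e = "epsilon I"
  \<comment> \<open>Addresses in different rows do not collide, so writing row \<open>k\<close>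
    preserves the rows before it.\<close>
  have index: "v * n + p \<noteq> k * n + j" if "v < k" "p < n" for v p j
  proof -
    have "v * n + p < Suc v * n" using that by simp
    also have "\<dots> \<le> k * n" using that by (intro mult_le_mono1) simp
    finally show ?thesis by simp
  qed
  show ?case
  proof (rule terminates_for_points[where Inv = "\<lambda>j s'. frame {1, 5, 6, 7} s s' \<and> nats s' 5 0 = k \<and>
      (\<forall>v<k. \<forall>p<n. nats s' 1 (v * n + p) = of_bool (G v p)) \<and>
      (\<forall>p<j. nats s' 1 (k * n + p) = of_bool (G k p))"], goal_cases)
    case mid: (2 j s2)
    show ?case
    proof (intro terminates_seq terminates_assign, goal_cases)
      case 1
      show ?case using mid floorlog_index[OF outer(1)] by (simp add: op_cost_def)
    next
      case 2
      show ?case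
      proof (rule terminates_for_points[where Inv = "\<lambda>i x. frame {1, 5, 6, 7} s x \<and> nats x 5 0 = k \<and>
          nats x 6 0 = j \<and> (\<forall>v<k. \<forall>p<n. nats x 1 (v * n + p) = of_bool (G v p)) \<and>
          (\<forall>p<j. nats x 1 (k * n + p) = of_bool (G k p)) \<and>
          nats x 1 (k * n + j) = of_bool (j \<in> ?P \<and> (\<forall>u\<in>?P. u < i \<longrightarrow> (1 - ?e) * ?d k u \<le> ?d k j))"],
          goal_cases)
        case 1
        then show ?case using mid index by auto
      next
        case inner: (2 i x)
        show ?case
        proof (rule terminates_if, goal_cases)
          case 1
          show ?case by (simp add: op_cost_def)
        next
          case 2
          then have "i \<in> ?P" "\<not> (1 - ?e) * ?d k i \<le> ?d k j"
            using inner mid(1) outer(1) by (auto simp: algebra_simps split: if_splits)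
          then show ?case using inner index floorlog_index[OF outer(1)]
            by (intro terminates_assign) (auto simp: op_cost_def)
        next
          case 3
          then have "i \<in> ?P \<longrightarrow> (1 - ?e) * ?d k i \<le> ?d k j"
            using inner mid(1) outer(1) by (auto simp: algebra_simps split: if_splits)
          then show ?case using inner K_ge by (intro terminates_skip) (auto simp: less_Suc_eq)
        qed
      next
        case (3 x)
        have "(\<forall>u\<in>?P. u < n \<longrightarrow> (1 - ?e) * ?d k u \<le> ?d k j) \<longleftrightarrow>
            (\<forall>u\<in>?P. (1 - ?e) * ?d k u \<le> ?d k j)" using assms(2) by blast
        then have "nats x 1 (k * n + j) = of_bool (G k j)"
          using 3 by (simp add: assms(1) near_furthest_def)
        with 3 show ?case by (auto simp: less_Suc_eq)
      qed
    qed
  qed (use outer in \<open>auto simp: less_Suc_eq\<close>)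
qed (auto simp: table_def)

lemma coreset_com:
  assumes "G = near_furthest (distance I) (subset_P I) (epsilon I)" "subset_P I \<subseteq> {..<n}"
    and "\<forall>v<n. \<exists>p\<in>subset_P I. G v p"
  shows "terminates I coreset_com (coreset_cost n) (best_so_far G (subset_P I) n) s"
  unfolding coreset_com_def coreset_cost_def
proof (rule terminates_seq, rule terminates_mono[OF table_com[OF assms(1,2)] order_refl])
  let ?P = "subset_P I"
  fix s1 assume s1: "frame {1, 5, 6, 7} s s1 \<and> table s1 n G"
  show "terminates I (CSeq (fill_com 0 (NInP (var 6)))
      (CSeq (CNAssign 16 (NConst 0) NPoints) (for_loop 15 NPoints candidate_com)))
      (loop_cost n K + (K + loop_cost n (candidate_cost n))) (best_so_far G ?P n) s1"
  proof (rule terminates_seq, rule terminates_mono[OF fill_com[where A = ?P] order_refl], goal_cases)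
    case s2: (3 s2)
    have tab: "nats s2 1 = nats s1 1" using s2 by (auto intro: frameD)
    show ?case
    proof (intro terminates_seq terminates_assign, goal_cases)
      case 2
      show ?case
      proof (rule terminates_for_points[where Inv = "\<lambda>k x. table x n G \<and> best_so_far G ?P k x"], goal_cases)
        case 1
        have "card ?P \<le> n" using card_mono[OF _ assms(2)] by simp
        then show ?case using s1 s2 tab assms(3)
          by (auto simp: table_def best_so_far_def marks_def)
      next
        case (2 k x)
        show ?case
        proof (rule terminates_mono[OF candidate_com[of x G k] order_refl], goal_cases)
          case (6 x')
          have "nats x' 1 = nats x 1" "nats x' 15 = nats x 15"
            using 6 frameD[of "{0, 16} \<union> {2..14}" x x'] by auto
          then show ?case using 6 2 by (auto simp: table_def best_so_far_def marks_def)
        qed (use 2 assms in auto)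
      qed auto
    qed (use K_ge in simp)
  qed auto
qed

end

section \<open>Polynomial growth of the cost\<close>

definition poly_bounded :: "(nat \<Rightarrow> nat) \<Rightarrow> bool" where
  "poly_bounded f \<longleftrightarrow> (\<exists>k. \<forall>n. f n \<le> k * (n + 1) ^ k)"

lemma poly_bounded_const: "poly_bounded (\<lambda>_. c)"
  unfolding poly_bounded_def
proof (intro exI[of _ c] allI)
  fix n show "c \<le> c * (n + 1) ^ c" by simp
qed

lemma poly_bounded_id: "poly_bounded (\<lambda>n. n)"
  unfolding poly_bounded_def by (intro exI[of _ 1]) simp

lemma poly_bounded_add:
  assumes "poly_bounded f" "poly_bounded g"
  shows "poly_bounded (\<lambda>n. f n + g n)"
proof -
  obtain j k where jk: "\<And>n. f n \<le> j * (n + 1) ^ j" "\<And>n. g n \<le> k * (n + 1) ^ k"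
    using assms unfolding poly_bounded_def by blast
  have "f n + g n \<le> (j + k) * (n + 1) ^ (j + k)" for n
  proof -
    have "j * (n + 1) ^ j \<le> j * (n + 1) ^ (j + k)" "k * (n + 1) ^ k \<le> k * (n + 1) ^ (j + k)"
      by (intro mult_left_mono power_increasing; simp)+
    then show ?thesis using jk[of n] unfolding add_mult_distrib by linarith
  qed
  then show ?thesis unfolding poly_bounded_def by blast
qed

text \<open>The number \<open>j * k + j + k\<close> dominates both the coefficient
  \<open>j * k\<close> and the exponent \<open>j + k\<close>, as one number has to serve for
  both.\<close>

lemma poly_bounded_mult:
  assumes "poly_bounded f" "poly_bounded g"
  shows "poly_bounded (\<lambda>n. f n * g n)"
proof -
  obtain j k where jk: "\<And>n. f n \<le> j * (n + 1) ^ j" "\<And>n. g n \<le> k * (n + 1) ^ k"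
    using assms unfolding poly_bounded_def by blast
  have "f n * g n \<le> (j * k + j + k) * (n + 1) ^ (j * k + j + k)" for n
  proof -
    have "f n * g n \<le> (j * (n + 1) ^ j) * (k * (n + 1) ^ k)" using jk[of n] by (intro mult_mono) auto
    also have "\<dots> = (j * k) * (n + 1) ^ (j + k)" by (simp add: power_add)
    also have "\<dots> \<le> (j * k + j + k) * (n + 1) ^ (j * k + j + k)"
      by (intro mult_mono power_increasing) auto
    finally show ?thesis .
  qed
  then show ?thesis unfolding poly_bounded_def by blast
qed

lemmas poly_bounded_intros =
  poly_bounded_const poly_bounded_id poly_bounded_add poly_bounded_mult

lemma poly_bounded_op_cost: "poly_bounded op_cost"
  unfolding op_cost_def[abs_def] power2_eq_square by (intro poly_bounded_intros)

lemma poly_bounded_loop_cost: "poly_bounded f \<Longrightarrow> poly_bounded (\<lambda>n. loop_cost n (f n))"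
  unfolding loop_cost_def by (intro poly_bounded_intros poly_bounded_op_cost)

lemma poly_bounded_coreset_cost: "poly_bounded coreset_cost"
  unfolding coreset_cost_def[abs_def] table_cost_def candidate_cost_def check_cost_def
    chain_cost_def mw_cost_def first_cost_def step_cost_def
  by (intro poly_bounded_intros poly_bounded_op_cost poly_bounded_loop_cost)

section \<open>Coresets\<close>

lemma near_furthest_exists:
  assumes "finite P" "P \<noteq> {}" "0 \<le> \<epsilon>" "\<And>u. 0 \<le> \<delta> v u"
  shows "\<exists>p\<in>P. near_furthest \<delta> P \<epsilon> v p"
proof -
  have "Max (\<delta> v ` P) \<in> \<delta> v ` P" using assms(1,2) by (intro Max_in) auto
  then obtain p where p: "p \<in> P" "\<delta> v p = Max (\<delta> v ` P)" by force
  have "(1 - \<epsilon>) * \<delta> v u \<le> \<delta> v p" if "u \<in> P" for u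
  proof -
    have "(1 - \<epsilon>) * \<delta> v u \<le> 1 * \<delta> v u" using assms(3,4) by (intro mult_right_mono) auto
    also have "\<dots> \<le> \<delta> v p" using p(2) that assms(1) by simp
    finally show ?thesis .
  qed
  then show ?thesis using p(1) by (auto simp: near_furthest_def)
qed

lemma furthest_neighbor_coreset_iff:
  assumes "finite P" "P \<noteq> {}" "\<epsilon> < 1"
  shows "furthest_neighbor_coreset V \<delta> \<epsilon> P Q \<longleftrightarrow>
    Q \<subseteq> P \<and> (\<forall>v\<in>V. \<exists>q\<in>Q. near_furthest \<delta> P \<epsilon> v q)"
proof -
  have "(1 - \<epsilon>) * Max (\<delta> v ` P) \<le> \<delta> v q \<longleftrightarrow> (\<forall>u\<in>P. (1 - \<epsilon>) * \<delta> v u \<le> \<delta> v q)" for v q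
  proof
    assume le: "(1 - \<epsilon>) * Max (\<delta> v ` P) \<le> \<delta> v q"
    show "\<forall>u\<in>P. (1 - \<epsilon>) * \<delta> v u \<le> \<delta> v q"
    proof
      fix u assume "u \<in> P"
      then have "(1 - \<epsilon>) * \<delta> v u \<le> (1 - \<epsilon>) * Max (\<delta> v ` P)"
        using assms by (intro mult_left_mono) auto
      with le show "(1 - \<epsilon>) * \<delta> v u \<le> \<delta> v q" by linarith
    qed
  next
    have "Max (\<delta> v ` P) \<in> \<delta> v ` P" using assms(1,2) by (intro Max_in) auto
    then obtain p where p: "p \<in> P" "\<delta> v p = Max (\<delta> v ` P)" by force
    assume "\<forall>u\<in>P. (1 - \<epsilon>) * \<delta> v u \<le> \<delta> v q"
    with p show "(1 - \<epsilon>) * Max (\<delta> v ` P) \<le> \<delta> v q" by metis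
  qed
  then show ?thesis
    unfolding furthest_neighbor_coreset_def near_furthest_def by (auto 0 4)
qed

lemma computes_within_mono: "computes_within c I T Q \<Longrightarrow> T \<le> T' \<Longrightarrow> computes_within c I T' Q"
  unfolding computes_within_def using le_trans by blast

lemma coreset_com_correct:
  assumes "Metric_space {..<n} \<delta>" "P \<subseteq> {..<n}" "P \<noteq> {}" "0 < \<epsilon>" "\<epsilon> < 1"
  shows "\<exists>Q. computes_within coreset_com
      \<lparr>points = n, distance = \<delta>, subset_P = P, epsilon = \<epsilon>\<rparr> (coreset_cost n) Q \<and>
    furthest_neighbor_coreset {..<n} \<delta> \<epsilon> P Q \<and> coreset_size_bound 4000000 {..<n} \<delta> \<epsilon> Q"
proof -
  interpret Metric_space "{..<n}" \<delta> by fact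
  define I where "I = \<lparr>points = n, distance = \<delta>, subset_P = P, epsilon = \<epsilon>\<rparr>"
  define G where "G = near_furthest \<delta> P \<epsilon>"
  interpret program I n using assms(2,3) by unfold_locales (auto simp: I_def)
  have finP: "finite P" using assms(2) finite_subset by blast
  have "terminates I coreset_com (coreset_cost n) (best_so_far G (subset_P I) n) zero_memory"
    using assms(2,4) near_furthest_exists[OF finP assms(3)]
    by (intro coreset_com) (auto simp: I_def G_def)
  then obtain t s where s: "exec I coreset_com zero_memory t s" "t \<le> coreset_cost n"
      "best_so_far G P n s"
    unfolding terminates_def by (auto simp: I_def)
  then obtain Q where Q: "Q \<subseteq> P" "marks s 0 n Q" "card Q \<le> nats s 16 0" "\<forall>v<n. \<exists>p\<in>Q. G v p"
    unfolding best_so_far_def by blast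
  have "Q = {i. i < points I \<and> nats s 0 i \<noteq> 0}"
    using Q(1,2) assms(2) by (auto simp: marks_def)
  then have "computes_within coreset_com I (coreset_cost n) Q"
    unfolding computes_within_def using s(1,2) by blast
  moreover have "furthest_neighbor_coreset {..<n} \<delta> \<epsilon> P Q"
    using Q(1,4) furthest_neighbor_coreset_iff[OF finP assms(3,5)] by (auto simp: G_def)
  moreover have "coreset_size_bound 4000000 {..<n} \<delta> \<epsilon> Q"
  proof (rule coreset_size_bound_if_chain[OF assms])
    show "card Q \<le> n" using Q(3) s(3) unfolding best_so_far_def by linarith
    fix h :: nat assume "0 < h" "h \<le> n"
    then obtain C where "chain G n P n h C" "(\<forall>v<n. \<exists>p\<in>C. G v p) \<longrightarrow> nats s 16 0 \<le> card C"
      using s(3) unfolding best_so_far_def by blast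
    then show "\<exists>C. chain (near_furthest \<delta> P \<epsilon>) n P n h C \<and>
        ((\<forall>v<n. \<exists>p\<in>C. near_furthest \<delta> P \<epsilon> v p) \<longrightarrow> card Q \<le> card C)"
      using Q(3) unfolding G_def by (meson le_trans)
  qed
  ultimately show ?thesis unfolding I_def by blast
qed

section \<open>Transfer between a space and its finite subspaces\<close>

lemma vc_dimension_balls_le_of_isometry:
  assumes "Metric_space V \<delta>" "Metric_space W \<delta>'" "inj_on g W" "g ` W \<subseteq> V"
    and "\<And>x y. \<delta>' x y = \<delta> (g x) (g y)"
  shows "vc_dimension W (ball_family W \<delta>') \<le> vc_dimension V (ball_family V \<delta>)"
  unfolding vc_dimension_def
proof (rule Sup_mono, clarify)
  fix X assume X: "X \<subseteq> W" "finite X" "shattered (ball_family W \<delta>') X"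
  have "shattered (ball_family V \<delta>) (g ` X)" unfolding shattered_def
  proof (intro allI impI)
    fix Y assume Y: "Y \<subseteq> g ` X"
    have "{x \<in> X. g x \<in> Y} \<subseteq> X" by blast
    then obtain v r where vr: "v \<in> W" "r > 0" "{x \<in> X. g x \<in> Y} = Metric_space.mcball W \<delta>' v r \<inter> X"
      using X(3) unfolding shattered_def ball_family_def by blast
    have "g x \<in> Y \<longleftrightarrow> g x \<in> Metric_space.mcball V \<delta> (g v) r" if "x \<in> X" for x
    proof -
      have "g x \<in> Y \<longleftrightarrow> x \<in> Metric_space.mcball W \<delta>' v r" using vr(3) that by blast
      moreover have "x \<in> W" "g x \<in> V" "g v \<in> V" using that X(1) vr(1) assms(4) by auto
      ultimately show ?thesis using vr(1) assms(5)
        by (simp add: Metric_space.in_mcball[OF assms(1)] Metric_space.in_mcball[OF assms(2)])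
    qed
    \<comment> \<open>A ball of the subspace is the trace of the ball of \<open>V\<close> with
      corresponding centre and the same radius.\<close>
    then have "Y = Metric_space.mcball V \<delta> (g v) r \<inter> g ` X" using Y by blast
    moreover have "Metric_space.mcball V \<delta> (g v) r \<in> ball_family V \<delta>"
      unfolding ball_family_def using vr(1,2) assms(4) by blast
    ultimately show "\<exists>A\<in>ball_family V \<delta>. Y = A \<inter> g ` X" by blast
  qed
  moreover have "card (g ` X) = card X"
    using X(1) assms(3) by (meson card_image inj_on_subset)
  moreover have "g ` X \<subseteq> V" "finite (g ` X)" using X(1,2) assms(4) by auto
  ultimately show "\<exists>a\<in>{enat (card X) |X. X \<subseteq> V \<and> finite X \<and> shattered (ball_family V \<delta>) X}.
      enat (card X) \<le> a" by (metis (mono_tags, lifting) CollectI order_refl)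
qed

lemma comatching_index_le_of_isometry:
  assumes "g ` W \<subseteq> V" "\<And>x y. \<delta>' x y = \<delta> (g x) (g y)"
  shows "comatching_index W \<delta>' \<epsilon> \<le> comatching_index V \<delta> \<epsilon>"
  unfolding comatching_index_def
proof (rule Sup_mono, clarify)
  fix ps assume ps: "comatching W \<delta>' \<epsilon> ps"
  have "comatching V \<delta> \<epsilon> (map (map_prod g g) ps)"
    using ps assms(1) unfolding comatching_def
    by (auto simp: assms(2) fst_map_prod snd_map_prod image_subset_iff)
  then show "\<exists>a\<in>{enat (length ps) |ps. comatching V \<delta> \<epsilon> ps}. enat (length ps) \<le> a"
    by (metis (mono_tags, lifting) CollectI length_map order_refl)
qed

text \<open>If no coreset of \<open>V\<close> were small, each small \<open>Q \<subseteq> P\<close> would miss some point of \<open>V\<close>; the finitely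
  many missed points and \<open>P\<close> form a finite space, whose indices are at most those of \<open>V\<close>.\<close>

lemma exists_small_coreset:
  fixes V :: "'a set"
  assumes "Metric_space V \<delta>" "P \<subseteq> V" "finite P" "P \<noteq> {}" "0 < \<epsilon>" "\<epsilon> < 1"
  shows "\<exists>Q. furthest_neighbor_coreset V \<delta> \<epsilon> P Q \<and> coreset_size_bound 4000000 V \<delta> \<epsilon> Q"
proof (cases "(\<exists>x\<in>V. \<exists>y\<in>V. x \<noteq> y) \<and> (\<exists>d. vc_dimension V (ball_family V \<delta>) = enat d) \<and>
    (\<exists>L. comatching_index V \<delta> (\<epsilon>\<^sup>2 / 4) = enat L)")
  \<comment> \<open>In a one-point space or with an infinite index the size bound is vacuous, and
    \<open>P\<close> itself will do.\<close>
  case False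
  have "furthest_neighbor_coreset V \<delta> \<epsilon> P P"
    using near_furthest_exists[OF assms(3,4), of \<epsilon> \<delta>] assms Metric_space.nonneg[OF assms(1)]
    by (simp add: furthest_neighbor_coreset_iff)
  moreover have "coreset_size_bound 4000000 V \<delta> \<epsilon> P"
    unfolding coreset_size_bound_def using False by blast
  ultimately show ?thesis by blast
next
  case True
  then obtain x y d L where xy: "x \<in> V" "y \<in> V" "x \<noteq> y"
    and d: "vc_dimension V (ball_family V \<delta>) = enat d"
    and L: "comatching_index V \<delta> (\<epsilon>\<^sup>2 / 4) = enat L" by blast
  interpret Metric_space V \<delta> by fact
  define G where "G = near_furthest \<delta> P \<epsilon>"
  note iff = furthest_neighbor_coreset_iff[OF assms(3,4,6)]
  define Bad where "Bad = {Q. Q \<subseteq> P \<and> (\<exists>v\<in>V. \<forall>q\<in>Q. \<not> G v q)}"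
  have "\<forall>Q\<in>Bad. \<exists>v. v \<in> V \<and> (\<forall>q\<in>Q. \<not> G v q)" by (auto simp: Bad_def)
  then obtain f where f: "\<And>Q. Q \<in> Bad \<Longrightarrow> f Q \<in> V" "\<And>Q q. Q \<in> Bad \<Longrightarrow> q \<in> Q \<Longrightarrow> \<not> G (f Q) q"
    by metis
  \<comment> \<open>The points \<open>x\<close> and \<open>y\<close> are included because the size
    bound in the finite space is vacuous without two points.\<close>
  define W where "W = P \<union> {x, y} \<union> f ` Bad"
  have "finite Bad" using assms(3) by (simp add: Bad_def)
  then have finW: "finite W" using assms(3) by (simp add: W_def)
  have WV: "W \<subseteq> V" using assms(2) xy f(1) by (auto simp: W_def)
  define n where "n = card W"
  obtain g where g: "bij_betw g {..<n} W"
    using ex_bij_betw_nat_finite[OF finW] by (auto simp: n_def atLeast0LessThan)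
  then have inj: "inj_on g {..<n}" and img: "g ` {..<n} = W" by (auto simp: bij_betw_def)
  define \<delta>' where "\<delta>' i j = \<delta> (g i) (g j)" for i j
  define P' where "P' = {i \<in> {..<n}. g i \<in> P}"
  have gP: "g ` P' = P"
  proof
    show "P \<subseteq> g ` P'"
    proof
      fix p assume "p \<in> P"
      then have "p \<in> g ` {..<n}" using img by (simp add: W_def)
      with \<open>p \<in> P\<close> show "p \<in> g ` P'" by (auto simp: P'_def)
    qed
  qed (auto simp: P'_def)
  have M': "Metric_space {..<n} \<delta>'"
  proof
    fix i j k assume ijk: "i \<in> {..<n}" "j \<in> {..<n}" "k \<in> {..<n}"
    then have "g i \<in> V" "g j \<in> V" "g k \<in> V" using img WV by auto
    then show "\<delta>' i k \<le> \<delta>' i j + \<delta>' j k" unfolding \<delta>'_def by (rule triangle)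
  next
    fix i j assume ij: "i \<in> {..<n}" "j \<in> {..<n}"
    then have "g i \<in> V" "g j \<in> V" using img WV by auto
    then show "\<delta>' i j = 0 \<longleftrightarrow> i = j" using ij inj by (simp add: \<delta>'_def inj_on_eq_iff)
  qed (auto simp: \<delta>'_def commute)
  have P': "P' \<subseteq> {..<n}" "P' \<noteq> {}" using gP assms(4) by (auto simp: P'_def)
  obtain Q' where Q': "furthest_neighbor_coreset {..<n} \<delta>' \<epsilon> P' Q'"
      "coreset_size_bound 4000000 {..<n} \<delta>' \<epsilon> Q'"
    using coreset_com_correct[OF M' P' assms(5,6)] by blast
  have "finite P'" by (simp add: P'_def)
  note Q'_iff = Q'(1)[unfolded furthest_neighbor_coreset_iff[OF this P'(2) assms(6)]]
  define Q where "Q = g ` Q'"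
  have QP: "Q \<subseteq> P" using Q'_iff gP unfolding Q_def by blast
  have "\<exists>q\<in>Q. G v q" if "v \<in> W" for v
  proof -
    have "v \<in> g ` {..<n}" using that img by simp
    then obtain i where i: "i < n" "v = g i" by blast
    then obtain q where q: "q \<in> Q'" "near_furthest \<delta>' P' \<epsilon> i q" using Q'_iff by blast
    have "near_furthest \<delta> P \<epsilon> v (g q)"
      using q(2) unfolding near_furthest_def gP[symmetric] by (auto simp: i(2) \<delta>'_def)
    then show ?thesis using q(1) by (auto simp: Q_def G_def)
  qed
  \<comment> \<open>Otherwise \<open>f Q\<close> would be a point of \<open>W\<close> missed by
    \<open>Q\<close>.\<close>
  then have "Q \<notin> Bad" using f(2)[of Q] by (auto simp: W_def)
  then have "furthest_neighbor_coreset V \<delta> \<epsilon> P Q"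
    using QP by (auto simp: iff Bad_def G_def)
  moreover have "coreset_size_bound 4000000 V \<delta> \<epsilon> Q" unfolding coreset_size_bound_def
  proof (intro impI allI)
    fix d0 L0 assume "vc_dimension V (ball_family V \<delta>) = enat d0"
      "comatching_index V \<delta> (\<epsilon>\<^sup>2 / 4) = enat L0"
    then have eqs: "d0 = d" "L0 = L" using d L by auto
    have "vc_dimension {..<n} (ball_family {..<n} \<delta>') \<le> enat d"
      using vc_dimension_balls_le_of_isometry[OF assms(1) M' inj] img WV d by (simp add: \<delta>'_def)
    then obtain d' where d': "vc_dimension {..<n} (ball_family {..<n} \<delta>') = enat d'" "d' \<le> d"
      by (metis enat_ile enat_ord_simps(1))
    have "comatching_index {..<n} \<delta>' (\<epsilon>\<^sup>2 / 4) \<le> enat L"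
      using comatching_index_le_of_isometry[of g "{..<n}" V \<delta>' \<delta> "\<epsilon>\<^sup>2 / 4"] img WV L
      by (simp add: \<delta>'_def)
    then obtain L' where L': "comatching_index {..<n} \<delta>' (\<epsilon>\<^sup>2 / 4) = enat L'" "L' \<le> L"
      by (metis enat_ile enat_ord_simps(1))
    obtain i j where ij: "i < n" "j < n" "g i = x" "g j = y"
    proof -
      have "x \<in> g ` {..<n}" "y \<in> g ` {..<n}" using img by (auto simp: W_def)
      then show ?thesis using that by blast
    qed
    then have "i \<noteq> j" using xy(3) by blast
    with ij have "real (card Q') \<le> 4000000 * real d' * (1 / \<epsilon>\<^sup>2) * real L' * ln (real L')"
      using Q'(2) d'(1) L'(1) unfolding coreset_size_bound_def by blast
    also have "\<dots> = 4000000 * (1 / \<epsilon>\<^sup>2) * real d' * (real L' * ln (real L'))" by simp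
    also have "\<dots> \<le> 4000000 * (1 / \<epsilon>\<^sup>2) * real d * (real L * ln (real L))"
    proof (intro mult_mono)
      \<comment> \<open>Zero values of \<open>L'\<close> or \<open>L\<close> are covered by the
        default \<open>ln 0 = 0\<close>.\<close>
      show "ln (real L') \<le> ln (real L)" using L'(2) by (cases "L' = 0"; cases "L = 0") auto
      show "0 \<le> ln (real L')" by (cases L') auto
      then show "0 \<le> real L' * ln (real L')" by simp
    qed (use d'(2) L'(2) in auto)
    also have "\<dots> = 4000000 * real d * (1 / \<epsilon>\<^sup>2) * real L * ln (real L)" by simp
    finally have "real (card Q') \<le> 4000000 * real d * (1 / \<epsilon>\<^sup>2) * real L * ln (real L)" .
    moreover have "finite Q'" using Q'_iff \<open>finite P'\<close> finite_subset by blast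
    then have "card Q \<le> card Q'" unfolding Q_def by (rule card_image_le)
    ultimately show "real (card Q) \<le> 4000000 * real d0 * (1 / \<epsilon>\<^sup>2) * real L0 * ln (real L0)"
      unfolding eqs by linarith
  qed
  ultimately show ?thesis by blast
qed

theorem theorem1p4:
  shows "\<exists>C::real. C > 0 \<and>
    (\<forall>(V::'a set) \<delta> P (\<epsilon>::real).
       Metric_space V \<delta> \<longrightarrow> P \<subseteq> V \<longrightarrow> finite P \<longrightarrow> P \<noteq> {} \<longrightarrow> 0 < \<epsilon> \<longrightarrow> \<epsilon> < 1 \<longrightarrow>
       (\<exists>Q. furthest_neighbor_coreset V \<delta> \<epsilon> P Q \<and> coreset_size_bound C V \<delta> \<epsilon> Q)) \<and>
    (\<exists>(c::com) (k::nat). \<forall>(n::nat) \<delta> P (\<epsilon>::real).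
       Metric_space {..<n} \<delta> \<longrightarrow> P \<subseteq> {..<n} \<longrightarrow> P \<noteq> {} \<longrightarrow> 0 < \<epsilon> \<longrightarrow> \<epsilon> < 1 \<longrightarrow>
       (\<exists>Q. computes_within c
              \<lparr>points = n, distance = \<delta>, subset_P = P, epsilon = \<epsilon>\<rparr> (k * (n + 1) ^ k) Q \<and>
            furthest_neighbor_coreset {..<n} \<delta> \<epsilon> P Q \<and>
            coreset_size_bound C {..<n} \<delta> \<epsilon> Q))"
proof -
  obtain k where k: "\<And>n. coreset_cost n \<le> k * (n + 1) ^ k"
    using poly_bounded_coreset_cost unfolding poly_bounded_def by blast
  have "\<exists>Q. computes_within coreset_com
      \<lparr>points = n, distance = \<delta>, subset_P = P, epsilon = \<epsilon>\<rparr> (k * (n + 1) ^ k) Q \<and>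
    furthest_neighbor_coreset {..<n} \<delta> \<epsilon> P Q \<and> coreset_size_bound 4000000 {..<n} \<delta> \<epsilon> Q"
    if "Metric_space {..<n} \<delta>" "P \<subseteq> {..<n}" "P \<noteq> {}" "0 < \<epsilon>" "\<epsilon> < 1" for n \<delta> P \<epsilon>
    using coreset_com_correct[OF that] computes_within_mono[OF _ k] by blast
  then show ?thesis
    by (intro exI[of _ "4000000 :: real"] conjI exI[of _ coreset_com] exI[of _ k] allI impI
        exists_small_coreset) auto
qed

end
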